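(* Let $n\ge 2$ and $1\le p\le\infty$. Let $\varphi\in\mathrm{M\ddot{o}b}(B)$ and $\psi=|D\varphi|^{\frac{n-2}{2}}$, and let $W_{\varphi,\psi}f:=\psi\cdot(f\circ\varphi)$. Then the operator norm of $W_{\varphi,\psi}$ on $h^p(B)$ is $$\|W_{\varphi,\psi}\|_{h^p\to h^p}=\left(\frac{1+|\varphi(0)|}{1-|\varphi(0)|}\right)^{\left|\frac{n-1}{p}-\frac{n-2}{2}\right|},$$ where $\frac{n-1}{p}$ is interpreted as $0$ when $p=\infty$.
   Context: $B$ is the open unit ball and $S=\partial B$ the unit sphere of $\mathbb{R}^n$; $\sigma$ is the surface measure on $S$ normalized so that $\sigma(S)=1$. For $1\le p<\infty$, $h^p(B)$ is the space of complex-valued harmonic functions $f$ on $B$ with $\|f\|_{h^p}:=\sup_{0\le r<1}\left(\int_S|f(r\zeta)|^p\,d\sigma(\zeta)\right)^{1/p}<\infty$; $h^\infty(B)$ is the space of bounded complex-valued harmonic functions on $B$ with $\|f\|_{h^\infty}:=\sup_{x\in B}|f(x)|$. $D\varphi(x)$ is the Jacobian matrix, $J_\varphi(x)=\det D\varphi(x)$, and $|D\varphi(x)|:=|J_\varphi(x)|^{1/n}$. $\widehat{\mathbb{R}}^n=\mathbb{R}^n\cup\{\infty\}$ is the one-point compactification of $\mathbb{R}^n$. A Möbius transformation of $\widehat{\mathbb{R}}^n$ is a finite composition of reflections in spheres ($x\mapsto a+r^2(x-a)/|x-a|^2$, with $a\mapsto\infty$, $\infty\mapsto a$, where $a\in\mathbb{R}^n$,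 $r>0$) and reflections in hyperplanes ($x\mapsto x-2(x\cdot a-t)a$, $\infty\mapsto\infty$, where $|a|=1$, $t\in\mathbb{R}$). $\mathrm{M\ddot{o}b}(B)$ is the group of Möbius transformations mapping $B$ onto $B$. *)

theory Defs
  imports "HOL-Analysis.Analysis"
begin

subsection \<open>Normalized surface measure on the unit sphere\<close>

text \<open>
  The library has no surface measure. As usual in polar coordinates, the surface measure of a
  Borel set \<open>A\<close> of the unit sphere of \<open>\<real>\<^sup>n\<close> is \<open>n\<close> times the Lebesgue measure of the cone
  \<open>{r \<zeta> | 0 < r < 1, \<zeta> \<in> A}\<close>; normalized to total mass 1 it is the image of the uniform
  distribution on the unit ball under the radial projection \<open>sgn x = x / \<bar>x\<bar>\<close>.
\<close>

definition sphere_measure :: "(real ^ 'n) measure" where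
  "sphere_measure =
     restrict_space (distr (uniform_measure lborel (ball 0 1)) borel sgn) (sphere 0 1)"

lemma emeasure_sphere_measure:
  assumes "A \<in> sets borel" "A \<subseteq> sphere (0 :: real ^ 'n) 1"
  shows "emeasure sphere_measure A =
           emeasure lborel {r *\<^sub>R \<zeta> |r \<zeta>. 0 < r \<and> r < 1 \<and> \<zeta> \<in> A} /
           emeasure lborel (ball (0 :: real ^ 'n) 1)"
proof -
  have sgn: "(sgn :: real ^ 'n \<Rightarrow> real ^ 'n) \<in> borel_measurable borel"
    unfolding sgn_div_norm by measurable
  have pre: "sgn -` A \<inter> space borel \<in> sets borel"
    using sgn assms(1) by (rule measurable_sets)
  have cone: "ball 0 1 \<inter> sgn -` A = {r *\<^sub>R \<zeta> |r \<zeta>. 0 < r \<and> r < 1 \<and> \<zeta> \<in> A}" (is "?L = ?R")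
  proof (intro equalityI subsetI)
    fix x assume x: "x \<in> ?L"
    with assms(2) have "norm (sgn x) = 1" by (auto simp: dist_norm)
    hence "x \<noteq> 0" by auto
    hence "x = norm x *\<^sub>R sgn x" "0 < norm x" by (simp_all add: sgn_div_norm)
    with x show "x \<in> ?R" by fastforce
  next
    fix x assume "x \<in> ?R"
    then obtain r \<zeta> where *: "x = r *\<^sub>R \<zeta>" "0 < r" "r < 1" "\<zeta> \<in> A" by blast
    with assms(2) have "norm \<zeta> = 1" by (auto simp: dist_norm)
    with * show "x \<in> ?L" by (simp add: sgn_div_norm)
  qed
  have "emeasure sphere_measure A = emeasure (uniform_measure lborel (ball 0 1)) (sgn -` A)"
    unfolding sphere_measure_def using assms sgn
    by (subst emeasure_restrict_space) (auto simp: emeasure_distr)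
  also have "\<dots> = emeasure lborel (ball 0 1 \<inter> sgn -` A) / emeasure lborel (ball (0 :: real ^ 'n) 1)"
    using pre by (subst emeasure_uniform_measure) auto
  finally show ?thesis unfolding cone .
qed

lemma emeasure_sphere_measure_sphere:
  "emeasure sphere_measure (sphere (0 :: real ^ 'n) 1) = 1"
proof -
  have cone: "{r *\<^sub>R \<zeta> |r \<zeta>. 0 < r \<and> r < 1 \<and> \<zeta> \<in> sphere (0 :: real ^ 'n) 1} = ball 0 1 - {0}"
    (is "?L = ?R")
  proof (intro equalityI subsetI)
    fix x assume "x \<in> ?R"
    then have "x = norm x *\<^sub>R sgn x" "0 < norm x" "norm x < 1" "sgn x \<in> sphere 0 1"
      by (simp_all add: sgn_div_norm)
    then show "x \<in> ?L" by blast
  qed auto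
  have "emeasure lborel (ball (0 :: real ^ 'n) 1 - {0}) = emeasure lborel (ball (0 :: real ^ 'n) 1)"
    by (intro emeasure_Diff_null_set) auto
  moreover have "emeasure lborel (ball (0 :: real ^ 'n) 1) \<noteq> 0"
    by (simp add: emeasure_ball less_imp_neq[OF unit_ball_vol_pos, symmetric])
  moreover have "emeasure lborel (ball (0 :: real ^ 'n) 1) \<noteq> top"
    by (simp add: emeasure_ball)
  ultimately show ?thesis
    by (subst emeasure_sphere_measure, simp, simp, unfold cone)
       (simp add: ennreal_divide_self less_top)
qed


subsection \<open>Harmonic functions and harmonic Hardy spaces\<close>

text \<open>
  On an open set, the second-order conditions below depend only on the values of \<open>f\<close> on that set.
\<close>

definition partial_deriv :: "real ^ 'n \<Rightarrow> (real ^ 'n \<Rightarrow> complex) \<Rightarrow> real ^ 'n \<Rightarrow> complex" where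
  "partial_deriv b f x = frechet_derivative f (at x) b"

definition laplacian :: "(real ^ 'n \<Rightarrow> complex) \<Rightarrow> real ^ 'n \<Rightarrow> complex" where
  "laplacian f x = (\<Sum>b\<in>Basis. partial_deriv b (partial_deriv b f) x)"

definition C2_on :: "(real ^ 'n \<Rightarrow> complex) \<Rightarrow> (real ^ 'n) set \<Rightarrow> bool" where
  "C2_on f S \<longleftrightarrow>
     (\<forall>x\<in>S. f differentiable at x) \<and>
     (\<forall>b\<in>Basis. \<forall>x\<in>S. partial_deriv b f differentiable at x) \<and>
     (\<forall>b\<in>Basis. \<forall>c\<in>Basis. continuous_on S (partial_deriv c (partial_deriv b f)))"

definition harmonic_on :: "(real ^ 'n \<Rightarrow> complex) \<Rightarrow> (real ^ 'n) set \<Rightarrow> bool" where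
  "harmonic_on f S \<longleftrightarrow> open S \<and> C2_on f S \<and> (\<forall>x\<in>S. laplacian f x = 0)"

text \<open>
  The exponent ranges over \<open>[1, \<infinity>]\<close>, as an extended nonnegative real. Functions on the ball are
  total functions whose values outside the ball are irrelevant.
\<close>

definition hp_norm :: "ennreal \<Rightarrow> (real ^ 'n \<Rightarrow> complex) \<Rightarrow> ennreal" where
  "hp_norm p f =
     (if p = \<infinity> then (SUP x\<in>ball 0 1. ennreal (norm (f x)))
      else (SUP r\<in>{0..<1}. ennreal
              ((\<integral>\<zeta>. norm (f (r *\<^sub>R \<zeta>)) powr enn2real p \<partial>sphere_measure) powr (1 / enn2real p))))"

definition hp_space :: "ennreal \<Rightarrow> (real ^ 'n \<Rightarrow> complex) set" where
  "hp_space p = {f. harmonic_on f (ball 0 1) \<and> hp_norm p f < \<infinity>}"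

definition hp_opnorm ::
    "ennreal \<Rightarrow> ((real ^ 'n \<Rightarrow> complex) \<Rightarrow> (real ^ 'n \<Rightarrow> complex)) \<Rightarrow> ennreal" where
  "hp_opnorm p T = (SUP f\<in>{f \<in> hp_space p. hp_norm p f \<le> 1}. hp_norm p (T f))"


subsection \<open>Moebius transformations\<close>

text \<open>
  The one-point compactification of \<open>\<real>\<^sup>n\<close> is the option type, with \<open>None\<close> as the point at infinity
  (as in \<open>Alexandroff_compactification\<close>).
\<close>

definition sphere_reflection ::
    "real ^ 'n \<Rightarrow> real \<Rightarrow> (real ^ 'n) option \<Rightarrow> (real ^ 'n) option" where
  "sphere_reflection a r z =
     (case z of
        None \<Rightarrow> Some a
      | Some x \<Rightarrow> if x = a then None
                 else Some (a + (r\<^sup>2 / (norm (x - a))\<^sup>2) *\<^sub>R (x - a)))"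

definition hyperplane_reflection ::
    "real ^ 'n \<Rightarrow> real \<Rightarrow> (real ^ 'n) option \<Rightarrow> (real ^ 'n) option" where
  "hyperplane_reflection a t z =
     (case z of
        None \<Rightarrow> None
      | Some x \<Rightarrow> Some (x - (2 * (x \<bullet> a - t)) *\<^sub>R a))"

inductive_set moebius :: "((real ^ 'n) option \<Rightarrow> (real ^ 'n) option) set" where
  sphere: "r > 0 \<Longrightarrow> sphere_reflection a r \<in> moebius"
| hyperplane: "norm a = 1 \<Longrightarrow> hyperplane_reflection a t \<in> moebius"
| comp: "\<Phi> \<in> moebius \<Longrightarrow> \<Psi> \<in> moebius \<Longrightarrow> \<Phi> \<circ> \<Psi> \<in> moebius"

definition moebius_ball :: "((real ^ 'n) option \<Rightarrow> (real ^ 'n) option) set" where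
  "moebius_ball = {\<Phi> \<in> moebius. \<Phi> ` (Some ` ball 0 1) = Some ` ball 0 1}"

text \<open>
  The point map underlying an extended map; it is meaningful only where the value is not the point
  at infinity, in particular on the unit ball for members of \<open>moebius_ball\<close>.
\<close>

definition point_map :: "((real ^ 'n) option \<Rightarrow> (real ^ 'n) option) \<Rightarrow> real ^ 'n \<Rightarrow> real ^ 'n" where
  "point_map \<Phi> x = the (\<Phi> (Some x))"

definition deriv_size :: "(real ^ 'n \<Rightarrow> real ^ 'n) \<Rightarrow> real ^ 'n \<Rightarrow> real" where
  "deriv_size \<phi> x = \<bar>det (jacobian \<phi> (at x))\<bar> powr (1 / real CARD('n))"

definition weighted_comp ::
    "(real ^ 'n \<Rightarrow> real ^ 'n) \<Rightarrow> (real ^ 'n \<Rightarrow> real) \<Rightarrow>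
     (real ^ 'n \<Rightarrow> complex) \<Rightarrow> (real ^ 'n \<Rightarrow> complex)" where
  "weighted_comp \<phi> \<psi> f = (\<lambda>x. of_real (\<psi> x) * f (\<phi> x))"

end

theory Submission
  imports Defs
begin

text \<open>
  Let \<open>n\<close> be the dimension, \<open>k = \<bar>D\<phi>\<bar>\<close> the conformal factor of \<open>\<phi>\<close>, \<open>a\<close> the point with \<open>\<phi> a = 0\<close>, and
  \<open>W f = k powr ((n - 2) / 2) (f \<circ> \<phi>)\<close>. Three facts determine the norm of \<open>W\<close>. First, \<open>W f\<close> is harmonic if
  \<open>f\<close> is (Kelvin transform). Second, on the sphere \<open>k z = (1 - \<bar>a\<bar>\<^sup>2) / \<bar>a - z\<bar>\<^sup>2\<close> ranges from \<open>1 / M\<close> to \<open>M\<close>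
  with \<open>M = (1 + \<bar>\<phi> 0\<bar>) / (1 - \<bar>\<phi> 0\<bar>)\<close>. Third, \<open>\<phi>\<close> has the jacobian \<open>k ^ (n - 1)\<close> on the sphere. So, for \<open>f\<close>
  harmonic near the closed ball, the integral of \<open>\<bar>W f\<bar> powr p\<close> over the sphere equals the integral of
  \<open>\<bar>f\<bar> powr p\<close> against the weight \<open>k powr (p (n - 2) / 2 - (n - 1))\<close>, taken at the preimage point. Its maximum is the
  \<open>p\<close>-th power of the claimed norm.

  For the upper bound (\<open>integral_W_le\<close>), \<open>f\<close> is approximated by its dilations \<open>x \<mapsto> f (s x)\<close>, and the integral means
  of \<open>\<bar>W f\<bar> powr p\<close> increase with the radius. For the lower bound (\<open>integral_W_nearly_attained\<close>), the
  test functions are Poisson kernels, whose \<open>p\<close>-th powers concentrate at a boundary point where the weight is maximal. For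
  \<open>p = \<infinity>\<close> the constant 1 is extremal.

  The analysis on the sphere rests on a single identity, \<open>Green_symmetry\<close>: the integral of
  \<open>g (t z) h (r z / t)\<close> over the sphere does not depend on \<open>t\<close> for harmonic \<open>g\<close> and \<open>h\<close>. It comes from the vanishing of
  integrals of directional derivatives with radial cutoffs, and it gives the mean value property and
  then \<open>Poisson_formula\<close>. The Poisson formula for \<open>W f\<close> at the point \<open>a\<close> is exactly the change of variables
  for harmonic functions, since the Poisson kernel at \<open>a\<close> is a multiple of \<open>k powr (n / 2)\<close>; by
  approximation it holds for all continuous functions (\<open>change_of_variables_sphere\<close>).

  Finally, an algebraic normal form shows that a Moebius transformation of the ball is an orthogonal map,
  possibly after a reflection in a sphere orthogonal to the unit sphere (\<open>moebius_ball_cases\<close>); both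
  kinds satisfy the three facts above.
\<close>

section \<open>Integration over the unit sphere\<close>

abbreviation sphere_integral ::
    "(real^'n \<Rightarrow> 'b::{banach, second_countable_topology}) \<Rightarrow> 'b" (binder "\<ointegral>" 10)
  where "sphere_integral F \<equiv> integral\<^sup>L sphere_measure F"

lemma space_sphere_measure: "space (sphere_measure :: (real^'n) measure) = sphere 0 1"
  unfolding sphere_measure_def by (simp add: space_restrict_space)

lemma sets_sphere_measure: "sets (sphere_measure :: (real^'n) measure) = sets (restrict_space borel (sphere 0 1))"
  unfolding sphere_measure_def by (simp add: sets_restrict_space)

interpretation sphere_measure: finite_measure "sphere_measure :: (real^'n) measure"
proof
  show "emeasure (sphere_measure :: (real^'n) measure) (space sphere_measure) \<noteq> \<infinity>"
    by (simp add: space_sphere_measure emeasure_sphere_measure_sphere)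
qed

lemma measure_sphere_measure_space:
  "measure (sphere_measure :: (real^'n) measure) (space sphere_measure) = 1"
  by (simp add: measure_def space_sphere_measure emeasure_sphere_measure_sphere)

lemma id_measurable_sphere_measure: "(\<lambda>x. x) \<in> measurable (sphere_measure :: (real^'n) measure) borel"
  by (subst measurable_cong_sets[OF sets_sphere_measure refl])
     (rule measurable_restrict_space1, simp)

text \<open>
  Continuity on the product of the two spaces makes the integrand bounded, so finiteness of the
  measures gives joint integrability. It is used for the sphere measure and for Lebesgue measure
  on a ball or an interval.
\<close>
lemma Fubini_continuous_compact:
  fixes F :: "'a::euclidean_space \<Rightarrow> 'b::euclidean_space \<Rightarrow> 'c::{banach, second_countable_topology}"
  assumes M: "finite_measure M" "(\<lambda>x. x) \<in> measurable M borel" "space M = K" "compact K"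
    and N: "finite_measure N" "(\<lambda>x. x) \<in> measurable N borel" "space N = L" "compact L"
    and F: "continuous_on (K \<times> L) (\<lambda>(x, y). F x y)"
  shows "(\<integral>x. (\<integral>y. F x y \<partial>N) \<partial>M) = (\<integral>y. (\<integral>x. F x y \<partial>M) \<partial>N)"
    and "integrable M (\<lambda>x. \<integral>y. F x y \<partial>N)"
proof -
  interpret M: finite_measure M by fact
  interpret N: finite_measure N by fact
  interpret P: pair_sigma_finite M N ..
  interpret MN: finite_measure "M \<Otimes>\<^sub>M N" by (rule finite_measure_pair_measure; fact)
  let ?G = "\<lambda>z. indicator (K \<times> L) z *\<^sub>R (case z of (x, y) \<Rightarrow> F x y)"
  have "closed (K \<times> L)" using M N by (intro closed_Times compact_imp_closed)
  then have G: "?G \<in> borel_measurable (borel \<Otimes>\<^sub>M borel)"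
    unfolding borel_prod using F by (intro borel_measurable_continuous_on_indicator) auto
  have id: "(\<lambda>(x, y). (x, y)) \<in> measurable (M \<Otimes>\<^sub>M N) (borel \<Otimes>\<^sub>M borel)"
    unfolding split_def
    by (rule measurable_Pair[OF measurable_compose[OF measurable_fst M(2)] measurable_compose[OF measurable_snd N(2)]])
  have "(\<lambda>(x,y). F x y) \<in> borel_measurable (M \<Otimes>\<^sub>M N) \<longleftrightarrow> (\<lambda>z. ?G (case z of (x,y) \<Rightarrow> (x,y))) \<in> borel_measurable (M \<Otimes>\<^sub>M N)"
    using M(3) N(3) by (intro measurable_cong) (auto simp: space_pair_measure)
  then have meas: "(\<lambda>(x,y). F x y) \<in> borel_measurable (M \<Otimes>\<^sub>M N)"
    using measurable_compose[OF id G] by simp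
  have "compact ((\<lambda>(x,y). F x y) ` (K \<times> L))"
    using F M(4) N(4) by (intro compact_continuous_image compact_Times)
  then obtain B where "\<forall>w \<in> (\<lambda>(x,y). F x y) ` (K \<times> L). norm w \<le> B"
    using compact_imp_bounded bounded_iff by metis
  then have B: "\<And>x y. x \<in> K \<Longrightarrow> y \<in> L \<Longrightarrow> norm (F x y) \<le> B" by auto
  have int: "integrable (M \<Otimes>\<^sub>M N) (\<lambda>(x,y). F x y)"
    by (rule MN.integrable_const_bound[where B = B, OF _ meas])
       (use M(3) N(3) B in \<open>auto simp: space_pair_measure\<close>)
  from P.Fubini_integral[OF int] show "(\<integral>x. (\<integral>y. F x y \<partial>N) \<partial>M) = (\<integral>y. (\<integral>x. F x y \<partial>M) \<partial>N)" ..
  from P.integrable_fst'[OF int] show "integrable M (\<lambda>x. \<integral>y. F x y \<partial>N)" by simp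
qed

lemma integrable_sphere_continuous:
  fixes F :: "real^'n \<Rightarrow> 'c::{banach, second_countable_topology}"
  assumes "continuous_on (sphere 0 1) F"
  shows "integrable sphere_measure F"
proof -
  have "F \<in> borel_measurable sphere_measure"
    by (subst measurable_cong_sets[OF sets_sphere_measure refl])
       (use assms in \<open>rule borel_measurable_continuous_on_restrict\<close>)
  moreover have "compact (F ` sphere 0 1)" using assms by (intro compact_continuous_image) auto
  then obtain B where "\<And>x. x \<in> sphere 0 1 \<Longrightarrow> norm (F x) \<le> B"
    by (metis compact_imp_bounded bounded_iff image_eqI)
  ultimately show ?thesis
    by (intro sphere_measure.integrable_const_bound[where B = B]) (auto simp: space_sphere_measure)
qed

lemma integral_sphere_cong:
  "(\<And>z. norm z = 1 \<Longrightarrow> F z = G z) \<Longrightarrow>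
    (\<ointegral>z. F z) = (\<integral>z. G z \<partial>(sphere_measure :: (real^'n) measure))"
  by (rule Bochner_Integration.integral_cong) (auto simp: space_sphere_measure)

lemma integral_sphere_mono:
  fixes F G :: "real^'n \<Rightarrow> real"
  assumes "continuous_on (sphere 0 1) F" "continuous_on (sphere 0 1) G" "\<And>z. norm z = 1 \<Longrightarrow> F z \<le> G z"
  shows "(\<ointegral>z. F z) \<le> (\<ointegral>z. G z)"
  using assms by (intro integral_mono integrable_sphere_continuous) (auto simp: space_sphere_measure)

lemma norm_integral_sphere_le:
  fixes F :: "real^'n \<Rightarrow> 'c::{banach, second_countable_topology}"
  assumes "continuous_on (sphere 0 1) F" "\<And>z. norm z = 1 \<Longrightarrow> norm (F z) \<le> c"
  shows "norm (\<ointegral>z. F z) \<le> c"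
proof -
  have "norm (\<ointegral>z. F z) \<le> (\<ointegral>z. norm (F z))"
    by (rule integral_norm_bound)
  also have "\<dots> \<le> (\<integral>z. c \<partial>(sphere_measure :: (real^'n) measure))"
    using assms by (intro integral_sphere_mono continuous_intros)
  finally show ?thesis by (simp add: measure_sphere_measure_space)
qed

lemma borel_measurable_sgn: "(sgn :: real^'n \<Rightarrow> real^'n) \<in> borel_measurable borel"
  unfolding sgn_div_norm by measurable

lemma borel_measurable_sphere_sgn:
  fixes F :: "real^'n \<Rightarrow> 'c::{banach, second_countable_topology}"
  assumes "continuous_on (sphere 0 1) F"
  shows "(\<lambda>x. indicator (sphere 0 1) (sgn x) *\<^sub>R F (sgn x)) \<in> borel_measurable borel"
proof -
  have "(\<lambda>x. indicator (sphere 0 1) x *\<^sub>R F x) \<in> borel_measurable borel"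
    using assms by (intro borel_measurable_continuous_on_indicator) auto
  from measurable_compose[OF borel_measurable_sgn this] show ?thesis .
qed

text \<open>
  The indicator only matters at the origin: \<open>sgn 0 = 0\<close> is not on the sphere, where alone \<open>F\<close> is
  assumed to be continuous.
\<close>
abbreviation sgn_ext :: "(real^'n \<Rightarrow> 'c::{banach, second_countable_topology}) \<Rightarrow> real^'n \<Rightarrow> 'c"
  where "sgn_ext F x \<equiv> indicator (sphere 0 1) (sgn x) *\<^sub>R F (sgn x)"

lemma integral_ball_sgn_ext:
  fixes F :: "real^'n \<Rightarrow> 'c::{banach, second_countable_topology}"
  assumes F: "continuous_on (sphere 0 1) F"
  shows "(\<integral>x. indicator (ball 0 1) x *\<^sub>R sgn_ext F x \<partial>lborel) =
         measure lborel (ball (0::real^'n) 1) *\<^sub>R (\<ointegral>z. F z)"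
proof -
  let ?v = "measure lborel (ball (0::real^'n) 1)"
  have v: "emeasure lborel (ball (0::real^'n) 1) = ennreal ?v" "?v > 0"
    using emeasure_lborel_ball_finite[of "0::real^'n" 1] content_ball_pos[of 1 "0::real^'n"]
    by (auto simp: emeasure_eq_ennreal_measure)
  have "(\<ointegral>z. F z) =
      (\<integral>x. indicator (sphere 0 1) x *\<^sub>R F x \<partial>distr (uniform_measure lborel (ball 0 1)) borel sgn)"
    unfolding sphere_measure_def by (subst integral_restrict_space) auto
  also have "\<dots> = (\<integral>x. sgn_ext F x \<partial>uniform_measure lborel (ball 0 1))"
    using borel_measurable_sgn F
    by (subst integral_distr) (auto intro!: borel_measurable_continuous_on_indicator)
  also have "uniform_measure lborel (ball (0::real^'n) 1) = density lborel (\<lambda>x. ennreal (indicator (ball 0 1) x / ?v))"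
    unfolding uniform_measure_def v(1) using v(2)
    by (intro density_cong borel_measurable_divide_ennreal measurable_compose[OF _ measurable_ennreal]
         borel_measurable_divide borel_measurable_indicator borel_measurable_const AE_I2)
       (auto simp: divide_ennreal simp flip: ennreal_indicator)
  also have "(\<integral>x. sgn_ext F x \<partial>\<dots>) = (\<integral>x. (indicator (ball 0 1) x / ?v) *\<^sub>R sgn_ext F x \<partial>lborel)"
    by (rule integral_density) (auto intro!: borel_measurable_sphere_sgn[OF F] borel_measurable_divide borel_measurable_indicator)
  also have "\<dots> = (\<integral>x. (1 / ?v) *\<^sub>R (indicator (ball 0 1) x *\<^sub>R sgn_ext F x) \<partial>lborel)"
    by (rule Bochner_Integration.integral_cong) auto
  also have "\<dots> = (1 / ?v) *\<^sub>R (\<integral>x. indicator (ball 0 1) x *\<^sub>R sgn_ext F x \<partial>lborel)"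
    by (rule integral_scaleR_right)
  finally show ?thesis using v(2) by simp
qed

lemma integrable_indicator_bounded:
  fixes G :: "real^'n \<Rightarrow> 'c::{banach, second_countable_topology}"
  assumes "G \<in> borel_measurable borel" "\<And>x. norm (G x) \<le> B" "A \<in> sets borel" "A \<subseteq> cball 0 R"
  shows "integrable lborel (\<lambda>x. indicator A x *\<^sub>R G x)"
proof (rule Bochner_Integration.integrable_bound)
  show "integrable lborel (\<lambda>x. indicator (cball (0::real^'n) R) x *\<^sub>R B)"
    using emeasure_lborel_cball_finite by (intro integrable_scaleR_left integrable_real_indicator) auto
  show "AE x in lborel. norm (indicator A x *\<^sub>R G x) \<le> norm (indicator (cball 0 R) x *\<^sub>R B)"
  proof (rule AE_I2)
    fix x :: "real^'n"
    have "0 \<le> B" using assms(2)[of x] norm_ge_zero order_trans by blast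
    then show "norm (indicator A x *\<^sub>R G x) \<le> norm (indicator (cball 0 R) x *\<^sub>R B)"
      using assms(2)[of x] assms(4) by (auto simp: indicator_def)
  qed
qed (use assms in measurable)

text \<open>
  A function that is homogeneous of degree 0 scales its integral over a ball by \<open>s\<^sup>n\<close>; subtracting
  the integral over the ball of radius \<open>s\<close> gives the shell.
\<close>
lemma integral_shell_sgn_ext:
  fixes F :: "real^'n \<Rightarrow> 'c::{banach, second_countable_topology}"
  assumes F: "continuous_on (sphere 0 1) F" and s: "0 < s" "s < 1"
  shows "(\<integral>x. indicator (ball 0 1 - ball 0 s) x *\<^sub>R sgn_ext F x \<partial>lborel) =
         ((1 - s ^ CARD('n)) * measure lborel (ball (0::real^'n) 1)) *\<^sub>R (\<ointegral>z. F z)"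
proof -
  have "compact (F ` sphere 0 1)" using F by (intro compact_continuous_image) auto
  then obtain B where B: "\<And>x. x \<in> sphere 0 1 \<Longrightarrow> norm (F x) \<le> B" "B > 0"
    by (metis compact_imp_bounded bounded_pos image_eqI)
  have B': "norm (sgn_ext F x) \<le> B" for x using B by (auto simp: indicator_def)
  have int: "integrable lborel (\<lambda>x. indicator (ball 0 r) x *\<^sub>R sgn_ext F x)" for r
    by (rule integrable_indicator_bounded[OF borel_measurable_sphere_sgn[OF F] B', of _ r]) auto
  note sm = borel_measurable_sphere_sgn[OF F]
  have "(\<integral>x. indicator (ball 0 s) x *\<^sub>R sgn_ext F x \<partial>lborel) =
     (\<integral>x. indicator (ball 0 s) x *\<^sub>R sgn_ext F x \<partial>density (distr lborel borel (\<lambda>x. 0 + s *\<^sub>R x)) (\<lambda>_. ennreal (\<bar>s\<bar>^DIM(real^'n))))"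
    using lborel_affine[of s "0::real^'n"] s by (simp add: ennreal_power)
  also have "\<dots> = (\<integral>x. s ^ CARD('n) *\<^sub>R (indicator (ball 0 s) (s *\<^sub>R x) *\<^sub>R sgn_ext F (s *\<^sub>R x)) \<partial>lborel)"
    by (subst integral_density)
       (use s in \<open>auto intro!: sm borel_measurable_scaleR borel_measurable_indicator borel_measurable_const integral_distr simp del: scaleR_scaleR\<close>)
  also have "\<dots> = s ^ CARD('n) *\<^sub>R (\<integral>x. indicator (ball 0 s) (s *\<^sub>R x) *\<^sub>R sgn_ext F (s *\<^sub>R x) \<partial>lborel)"
    by (rule integral_scaleR_right)
  also have "(\<lambda>x. indicator (ball 0 s) (s *\<^sub>R x) *\<^sub>R sgn_ext F (s *\<^sub>R x)) = (\<lambda>x. indicator (ball 0 1) x *\<^sub>R sgn_ext F x)"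
    using s by (auto simp: fun_eq_iff indicator_def sgn_scaleR)
  finally have sc: "(\<integral>x. indicator (ball 0 s) x *\<^sub>R sgn_ext F x \<partial>lborel) =
     s ^ CARD('n) *\<^sub>R (\<integral>x. indicator (ball 0 1) x *\<^sub>R sgn_ext F x \<partial>lborel)" .
  have "(\<integral>x. indicator (ball 0 1 - ball 0 s) x *\<^sub>R sgn_ext F x \<partial>lborel) =
    (\<integral>x. indicator (ball 0 1) x *\<^sub>R sgn_ext F x - indicator (ball 0 s) x *\<^sub>R sgn_ext F x \<partial>lborel)"
    using s by (intro Bochner_Integration.integral_cong) (auto simp: indicator_def)
  also have "\<dots> = (\<integral>x. indicator (ball 0 1) x *\<^sub>R sgn_ext F x \<partial>lborel) - (\<integral>x. indicator (ball 0 s) x *\<^sub>R sgn_ext F x \<partial>lborel)"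
    by (rule Bochner_Integration.integral_diff) (rule int)+
  finally show ?thesis
    unfolding sc integral_ball_sgn_ext[OF F] by (simp add: algebra_simps)
qed

text \<open>
  The radial weights approximate the indicator of every open shell \<open>s < \<bar>x\<bar> < 1\<close> from below, so \<open>F\<close>
  integrates to 0 over all shells. On a thin shell, \<open>F x\<close> is uniformly close to \<open>F (sgn x)\<close>, whose
  integral over the shell is a positive multiple of the integral of \<open>F\<close> over the sphere.
\<close>
lemma integral_sphere_eq_0_if_radial_integrals_eq_0:
  fixes F :: "real^'n \<Rightarrow> complex"
  assumes F: "continuous_on (cball 0 1) F"
    and rad: "\<And>q :: real \<Rightarrow> real. continuous_on UNIV q \<Longrightarrow> (\<And>u. u \<ge> 1 \<Longrightarrow> q u = 0) \<Longrightarrow>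
        (\<integral>x. q (x \<bullet> x) *\<^sub>R (indicator (cball 0 1) x *\<^sub>R F x) \<partial>lborel) = 0"
  shows "(\<ointegral>z. F z) = 0"
proof -
  have FS: "continuous_on (sphere 0 1) F" using F by (rule continuous_on_subset) auto
  let ?v = "measure lborel (ball (0::real^'n) 1)"
  have v: "?v > 0" by (simp add: content_ball_pos)
  let ?FF = "\<lambda>x. indicator (cball 0 1) x *\<^sub>R F x"
  have FFm: "?FF \<in> borel_measurable borel"
    using F by (intro borel_measurable_continuous_on_indicator) auto
  have "compact (F ` cball 0 1)" using F by (intro compact_continuous_image) auto
  then obtain B where B: "\<And>x. x \<in> cball 0 1 \<Longrightarrow> norm (F x) \<le> B" "B > 0"
    by (metis compact_imp_bounded bounded_pos image_eqI)
  have FFB: "norm (?FF x) \<le> B" for x using B by (auto simp: indicator_def)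
  have shell: "(\<integral>x. indicator (ball 0 1 - cball 0 s) x *\<^sub>R F x \<partial>lborel) = 0" if s: "0 < s" "s < 1" for s
  proof -
    \<comment> \<open>The factor \<open>(u - s\<^sup>2) (1 - u)\<close> is positive exactly for \<open>s\<^sup>2 < u < 1\<close>, that is, on the shell.\<close>
    define q where "q = (\<lambda>j u. min 1 (real j * max 0 ((u - s\<^sup>2) * (1 - u))))"
    have q01: "0 \<le> q j u" "q j u \<le> 1" for j u unfolding q_def by auto
    have q0: "q j u = 0" if "u \<ge> 1 \<or> u \<le> s\<^sup>2" for j u
    proof -
      have "s\<^sup>2 < 1" using s by (simp add: power_less_one_iff abs_square_less_1)
      then have "(u - s\<^sup>2) * (1 - u) \<le> 0" using that by (auto intro: mult_nonneg_nonpos mult_nonpos_nonneg)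
      then show ?thesis unfolding q_def by (simp add: max_absorb1)
    qed
    have q1: "(\<lambda>j. q j u) \<longlonglongrightarrow> 1" if "s\<^sup>2 < u" "u < 1" for u
    proof -
      have pos: "(u - s\<^sup>2) * (1 - u) > 0" using that by simp
      obtain N where N: "real N * ((u - s\<^sup>2) * (1 - u)) > 1"
        using reals_Archimedean3[OF pos] by blast
      have "q j u = 1" if "j \<ge> N" for j
      proof -
        have "real j * ((u - s\<^sup>2) * (1 - u)) \<ge> real N * ((u - s\<^sup>2) * (1 - u))"
          using that pos by (intro mult_right_mono) auto
        then show ?thesis using N pos unfolding q_def by (simp add: max_absorb2)
      qed
      then have "eventually (\<lambda>j. q j u = 1) sequentially" by (auto simp: eventually_sequentially)
      then show ?thesis by (rule tendsto_eventually)
    qed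
    have lim: "(\<lambda>j. \<integral>x. q j (x \<bullet> x) *\<^sub>R ?FF x \<partial>lborel) \<longlonglongrightarrow> (\<integral>x. indicator (ball 0 1 - cball 0 s) x *\<^sub>R F x \<partial>lborel)"
    proof (rule integral_dominated_convergence[where w = "\<lambda>x. indicator (cball 0 1) x *\<^sub>R B"])
      have "(\<lambda>x. indicator (ball 0 1 - cball 0 s) x *\<^sub>R ?FF x) \<in> borel_measurable borel"
        by (intro borel_measurable_scaleR borel_measurable_indicator FFm) auto
      moreover have "(\<lambda>x. indicator (ball 0 1 - cball 0 s) x *\<^sub>R ?FF x) = (\<lambda>x. indicator (ball 0 1 - cball 0 s) x *\<^sub>R F x)"
        by (auto simp: indicator_def fun_eq_iff)
      ultimately show "(\<lambda>x. indicator (ball 0 1 - cball 0 s) x *\<^sub>R F x) \<in> borel_measurable lborel" by simp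
      have qm: "q j \<in> borel_measurable borel" for j
        unfolding q_def by (intro borel_measurable_continuous_onI continuous_intros)
      show "(\<lambda>x. q j (x \<bullet> x) *\<^sub>R ?FF x) \<in> borel_measurable lborel" for j
        using borel_measurable_scaleR[OF measurable_compose[OF _ qm[of j], of "\<lambda>x. x \<bullet> x" borel] FFm]
        by simp
      show "integrable lborel (\<lambda>x. indicator (cball (0::real^'n) 1) x *\<^sub>R B)"
        using emeasure_lborel_cball_finite by (intro integrable_scaleR_left integrable_real_indicator) auto
      show "AE x in lborel. norm (q j (x \<bullet> x) *\<^sub>R ?FF x) \<le> indicator (cball 0 1) x *\<^sub>R B" for j
      proof (rule AE_I2)
        fix x :: "real^'n"
        have "norm (q j (x \<bullet> x) *\<^sub>R ?FF x) \<le> 1 * norm (?FF x)"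
          unfolding norm_scaleR using q01 by (intro mult_right_mono) auto
        also have "\<dots> \<le> indicator (cball 0 1) x *\<^sub>R B"
          using B by (auto simp: indicator_def)
        finally show "norm (q j (x \<bullet> x) *\<^sub>R ?FF x) \<le> indicator (cball 0 1) x *\<^sub>R B" .
      qed
      show "AE x in lborel. (\<lambda>j. q j (x \<bullet> x) *\<^sub>R ?FF x) \<longlonglongrightarrow> indicator (ball 0 1 - cball 0 s) x *\<^sub>R F x"
      proof (rule AE_I2)
        fix x :: "real^'n"
        consider "norm x \<ge> 1" | "norm x \<le> s" | "s < norm x" "norm x < 1" by linarith
        then show "(\<lambda>j. q j (x \<bullet> x) *\<^sub>R ?FF x) \<longlonglongrightarrow> indicator (ball 0 1 - cball 0 s) x *\<^sub>R F x"
        proof cases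
          case 1
          then have "x \<bullet> x \<ge> 1" by (simp add: dot_square_norm)
          then show ?thesis using 1 q0 by (auto simp: indicator_def)
        next
          case 2
          then have "x \<bullet> x \<le> s\<^sup>2" using s by (simp add: dot_square_norm power_mono)
          then show ?thesis using 2 q0 by (auto simp: indicator_def)
        next
          case 3
          then have "x \<bullet> x > s\<^sup>2" "x \<bullet> x < 1"
            using s by (auto simp: dot_square_norm power_strict_mono power_less_one_iff abs_square_less_1)
          from tendsto_scaleR[OF q1[OF this] tendsto_const[of "F x"]] 3 show ?thesis by (auto simp: indicator_def)
        qed
      qed
    qed
    have "(\<integral>x. q j (x \<bullet> x) *\<^sub>R ?FF x \<partial>lborel) = 0" for j
      by (rule rad) (auto simp: q_def intro!: continuous_intros q0[unfolded q_def])
    then show ?thesis using lim by (simp add: LIMSEQ_const_iff)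
  qed
  have "norm (\<ointegral>z. F z) \<le> e" if e: "e > 0" for e
  proof -
    have "uniformly_continuous_on (cball 0 1) F" using F by (intro compact_uniformly_continuous) auto
    then obtain d where d: "d > 0" "\<And>x y. x \<in> cball 0 1 \<Longrightarrow> y \<in> cball 0 1 \<Longrightarrow> dist x y < d \<Longrightarrow> dist (F x) (F y) < e"
      unfolding uniformly_continuous_on_def using e by metis
    define s where "s = max (1/2) (1 - d/2)"
    have s: "0 < s" "s < 1" using d by (auto simp: s_def)
    have close: "norm (F x - F (sgn x)) \<le> e" if "norm x < 1" "s \<le> norm x" for x
    proof -
      have nx: "norm x > 0" using that s by linarith
      have "x - sgn x = (norm x - 1) *\<^sub>R sgn x" using nx by (simp add: sgn_div_norm left_diff_distrib scaleR_diff_left)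
      then have "norm (x - sgn x) = 1 - norm x" using that nx by (simp add: norm_sgn)
      also have "\<dots> < d" using that d unfolding s_def by (auto simp: max_def split: if_splits)
      finally have "dist x (sgn x) < d" by (simp add: dist_norm)
      then have "dist (F x) (F (sgn x)) < e" using that by (intro d) (auto simp: norm_sgn)
      then show ?thesis by (simp add: dist_norm)
    qed
    let ?D = "ball (0::real^'n) 1 - ball 0 s"
    have sF: "(\<integral>x. indicator ?D x *\<^sub>R F x \<partial>lborel) = 0"
    proof -
      have "(\<integral>x. indicator ?D x *\<^sub>R F x \<partial>lborel) = (\<integral>x. indicator (ball 0 1 - cball 0 s) x *\<^sub>R F x \<partial>lborel)"
      proof (rule integral_cong_AE)
        have m: "(\<lambda>x. indicator A x *\<^sub>R ?FF x) \<in> borel_measurable lborel" if "A \<in> sets borel" for A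
          using borel_measurable_scaleR[OF borel_measurable_indicator[of A borel] FFm] that by simp
        have e: "(\<lambda>x. indicator A x *\<^sub>R ?FF x) = (\<lambda>x. indicator A x *\<^sub>R F x)" if "A \<subseteq> cball 0 1" for A
          using that by (auto simp: indicator_def fun_eq_iff)
        have *: "(\<lambda>x. indicator A x *\<^sub>R F x) \<in> borel_measurable lborel" if "A \<in> sets borel" "A \<subseteq> cball 0 1" for A
          using m[OF that(1)] unfolding e[OF that(2)] .
        show "(\<lambda>x. indicator ?D x *\<^sub>R F x) \<in> borel_measurable lborel" by (rule *) auto
        show "(\<lambda>x. indicator (ball 0 1 - cball 0 s) x *\<^sub>R F x) \<in> borel_measurable lborel" by (rule *) auto
        have "sphere (0::real^'n) s \<in> null_sets lborel"
          using negligible_sphere[of "0::real^'n" s] by (simp add: negligible_iff_null_sets null_sets_completion_iff)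
        then have "AE x in lborel. x \<notin> sphere (0::real^'n) s" by (rule AE_not_in)
        then show "AE x in lborel. indicator ?D x *\<^sub>R F x = indicator (ball 0 1 - cball 0 s) x *\<^sub>R F x"
          by eventually_elim (auto simp: indicator_def)
      qed
      then show ?thesis using shell[OF s] by simp
    qed
    let ?m = "(1 - s ^ CARD('n)) * ?v"
    have m: "?m > 0" using s v by (simp add: power_less_one_iff)
    have meas: "sgn_ext F \<in> borel_measurable borel" by (rule borel_measurable_sphere_sgn[OF FS])
    have i1: "integrable lborel (\<lambda>x. indicator ?D x *\<^sub>R sgn_ext F x)"
      by (rule integrable_indicator_bounded[OF meas, of B _ 1]) (use B in \<open>auto simp: indicator_def\<close>)
    have i2: "integrable lborel (\<lambda>x. indicator ?D x *\<^sub>R ?FF x)"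
      by (rule integrable_indicator_bounded[OF FFm FFB, of _ 1]) auto
    have "(\<integral>x. indicator ?D x *\<^sub>R sgn_ext F x \<partial>lborel) = (\<integral>x. indicator ?D x *\<^sub>R sgn_ext F x \<partial>lborel) - (\<integral>x. indicator ?D x *\<^sub>R ?FF x \<partial>lborel)"
    proof -
      have "(\<integral>x. indicator ?D x *\<^sub>R ?FF x \<partial>lborel) = (\<integral>x. indicator ?D x *\<^sub>R F x \<partial>lborel)"
        by (rule Bochner_Integration.integral_cong) (auto simp: indicator_def)
      then show ?thesis using sF by simp
    qed
    also have "\<dots> = (\<integral>x. indicator ?D x *\<^sub>R sgn_ext F x - indicator ?D x *\<^sub>R ?FF x \<partial>lborel)"
      by (rule Bochner_Integration.integral_diff[symmetric]) (fact i1 i2)+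
    also have "norm \<dots> \<le> (\<integral>x. indicator ?D x *\<^sub>R (sgn_ext (\<lambda>_. e) x) \<partial>lborel)"
    proof (rule Bochner_Integration.integral_norm_bound_integral)
      show "integrable lborel (\<lambda>x. indicator ?D x *\<^sub>R sgn_ext F x - indicator ?D x *\<^sub>R ?FF x)"
        using i1 i2 by (rule Bochner_Integration.integrable_diff)
      show "integrable lborel (\<lambda>x. indicator ?D x *\<^sub>R sgn_ext (\<lambda>_. e) x)"
        by (rule integrable_indicator_bounded[OF borel_measurable_sphere_sgn, of _ e _ 1]) (use e in \<open>auto simp: indicator_def\<close>)
      fix x :: "real^'n"
      have "norm (F (sgn x) - F x) \<le> e" "norm (sgn x) = 1" if "x \<in> ?D"
      proof -
        from that s have "x \<noteq> 0" by auto
        then show "norm (sgn x) = 1" by (simp add: norm_sgn)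
        show "norm (F (sgn x) - F x) \<le> e" using close[of x] that by (simp add: norm_minus_commute)
      qed
      then show "norm (indicator ?D x *\<^sub>R sgn_ext F x - indicator ?D x *\<^sub>R ?FF x) \<le> indicator ?D x *\<^sub>R (sgn_ext (\<lambda>_. e) x)"
        by (auto simp: indicator_def)
    qed
    also have "\<dots> = ?m * e"
      by (subst integral_shell_sgn_ext) (use s in \<open>auto simp: measure_sphere_measure_space\<close>)
    finally have "?m * norm (\<ointegral>z. F z) \<le> ?m * e"
      unfolding integral_shell_sgn_ext[OF FS s] using m by simp
    then show ?thesis using m mult_le_cancel_left_pos by blast
  qed
  then have "norm (\<ointegral>z. F z) \<le> 0" by (meson dense_ge)
  then show ?thesis by simp
qed

section \<open>Integrals of directional derivatives\<close>

text \<open>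
  By translation invariance \<open>F (x + b) - F x\<close> integrates to 0. By the fundamental theorem of
  calculus this difference is the integral of \<open>F' (x + t b) b\<close> over \<open>0 \<le> t \<le> 1\<close>, and after an
  exchange of the integrals the inner one does not depend on \<open>t\<close>.
\<close>
lemma integral_directional_derivative_eq_0:
  fixes F :: "real^'n \<Rightarrow> complex"
  assumes d: "\<And>x. (F has_derivative F' x) (at x)"
    and c: "continuous_on UNIV (\<lambda>x. F' x b)"
    and supp: "\<And>x. norm x > R \<Longrightarrow> F x = 0"
  shows "(\<integral>x. F' x b \<partial>lborel) = 0"
proof -
  have supp': "F' x b = 0" if "norm x > R" for x
  proof -
    have "open {x::real^'n. norm x > R}" by (intro open_Collect_less continuous_intros)
    then have "((\<lambda>x. 0) has_derivative F' x) (at x)"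
      using that supp by (intro has_derivative_transform_within_open[OF d]) auto
    then have "F' x = (\<lambda>_. 0)" by (rule has_derivative_unique) simp
    then show ?thesis by simp
  qed
  define K where "K = cball (0::real^'n) (\<bar>R\<bar> + norm b)"
  define M where "M = restrict_space lborel K"
  define N where "N = restrict_space lborel {0..1::real}"
  have outK: "norm (x + t *\<^sub>R b) > R" if "x \<notin> K" "t \<in> {0..1}" for x t
  proof -
    have "norm x \<le> norm (x + t *\<^sub>R b) + norm (t *\<^sub>R b)" using norm_triangle_ineq4[of "x + t *\<^sub>R b" "t *\<^sub>R b"] by simp
    moreover have "norm (t *\<^sub>R b) \<le> norm b" using that by (simp add: mult_left_le_one_le)
    ultimately show ?thesis using that(1) unfolding K_def by auto
  qed
  have Kb: "K \<in> sets borel" unfolding K_def by auto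
  have contF: "continuous_on UNIV F" using d by (meson continuous_at_imp_continuous_on has_derivative_continuous)
  have M: "finite_measure M" "(\<lambda>x. x) \<in> measurable M borel" "space M = K" "compact K"
    using emeasure_lborel_cball_finite[of "0::real^'n" "\<bar>R\<bar> + norm b"] unfolding M_def K_def
    by (auto intro!: measurable_restrict_space1 finite_measureI simp: space_restrict_space emeasure_restrict_space)
  have N: "finite_measure N" "(\<lambda>x. x) \<in> measurable N borel" "space N = {0..1}" "compact {0..1::real}"
    unfolding N_def
    by (auto intro!: measurable_restrict_space1 finite_measureI simp: space_restrict_space emeasure_restrict_space)
  have iM: "(\<integral>x. G x \<partial>M) = (\<integral>x. G x \<partial>lborel)" if "\<And>x. x \<notin> K \<Longrightarrow> G x = 0" for G :: "real^'n \<Rightarrow> complex"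
    unfolding M_def using that Kb
    by (subst integral_restrict_space) (auto intro!: Bochner_Integration.integral_cong simp: indicator_def)
  have transl: "(\<integral>x. G (x + t *\<^sub>R b) \<partial>lborel) = (\<integral>x. G x \<partial>lborel)" if "continuous_on UNIV G" for t and G :: "real^'n \<Rightarrow> complex"
  proof -
    have "(\<integral>x. G x \<partial>lborel) = (\<integral>x. G x \<partial>distr lborel borel ((+) (t *\<^sub>R b)))" by (simp add: lborel_distr_plus)
    also have "\<dots> = (\<integral>x. G (t *\<^sub>R b + x) \<partial>lborel)"
      using that by (subst integral_distr) (auto intro: borel_measurable_continuous_onI)
    finally show ?thesis by (simp add: add.commute)
  qed
  have FTC: "(\<integral>t. F' (x + t *\<^sub>R b) b \<partial>N) = F (x + b) - F x" for x
  proof -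
    have "(\<integral>t. F' (x + t *\<^sub>R b) b \<partial>N) = (\<integral>t. indicator {0..1} t *\<^sub>R F' (x + t *\<^sub>R b) b \<partial>lborel)"
      unfolding N_def by (subst integral_restrict_space) auto
    also have "\<dots> = F (x + 1 *\<^sub>R b) - F (x + 0 *\<^sub>R b)"
    proof (rule integral_FTC_atLeastAtMost)
      show "continuous_on {0..1} (\<lambda>t. F' (x + t *\<^sub>R b) b)"
        by (intro continuous_on_compose2[OF c] continuous_intros) auto
      fix t :: real
      have "((\<lambda>t. F (x + t *\<^sub>R b)) has_derivative (\<lambda>h. F' (x + t *\<^sub>R b) (h *\<^sub>R b))) (at t within {0..1})"
        by (rule has_derivative_compose[OF _ d]) (auto intro!: derivative_eq_intros)
      moreover have "F' (x + t *\<^sub>R b) (h *\<^sub>R b) = h *\<^sub>R F' (x + t *\<^sub>R b) b" for h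
        using has_derivative_bounded_linear[OF d] by (simp add: linear_cmul bounded_linear.linear)
      ultimately show "((\<lambda>t. F (x + t *\<^sub>R b)) has_vector_derivative F' (x + t *\<^sub>R b) b) (at t within {0..1})"
        unfolding has_vector_derivative_def by simp
    qed simp
    finally show ?thesis by simp
  qed
  have intF: "integrable lborel (\<lambda>x. F (x + t *\<^sub>R b))" if "t \<in> {0..1}" for t
  proof -
    have "continuous_on K (\<lambda>x. F (x + t *\<^sub>R b))" by (intro continuous_on_compose2[OF contF] continuous_intros) auto
    then have "integrable lborel (\<lambda>x. indicator K x *\<^sub>R F (x + t *\<^sub>R b))"
      using M(4) by (intro borel_integrable_compact)
    moreover have "(\<lambda>x. indicator K x *\<^sub>R F (x + t *\<^sub>R b)) = (\<lambda>x. F (x + t *\<^sub>R b))"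
      using outK that supp by (fastforce simp: indicator_def fun_eq_iff)
    ultimately show ?thesis by simp
  qed
  have "(\<integral>x. (\<integral>t. F' (x + t *\<^sub>R b) b \<partial>N) \<partial>M) = (\<integral>x. F (x + b) - F x \<partial>lborel)"
    unfolding FTC using outK[of _ 1] outK[of _ 0] supp by (intro iM) auto
  also have "\<dots> = 0"
    using intF[of 0] intF[of 1] transl[OF contF, of 1] by simp
  finally have "0 = (\<integral>x. (\<integral>t. F' (x + t *\<^sub>R b) b \<partial>N) \<partial>M)" by simp
  also have "\<dots> = (\<integral>t. (\<integral>x. F' (x + t *\<^sub>R b) b \<partial>M) \<partial>N)"
    by (rule Fubini_continuous_compact(1)[OF M N])
       (auto simp: split_def intro!: continuous_on_compose2[OF c] continuous_intros)
  also have "\<dots> = (\<integral>t. (\<integral>x. F' x b \<partial>lborel) \<partial>N)"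
  proof (rule Bochner_Integration.integral_cong)
    fix t assume "t \<in> space N"
    then have "(\<integral>x. F' (x + t *\<^sub>R b) b \<partial>M) = (\<integral>x. F' (x + t *\<^sub>R b) b \<partial>lborel)"
      using N outK supp' by (intro iM) auto
    also have "\<dots> = (\<integral>x. F' x b \<partial>lborel)" by (rule transl[OF c])
    finally show "(\<integral>x. F' (x + t *\<^sub>R b) b \<partial>M) = (\<integral>x. F' x b \<partial>lborel)" .
  qed simp
  also have "\<dots> = measure N (space N) *\<^sub>R (\<integral>x. F' x b \<partial>lborel)" by simp
  also have "measure N (space N) = 1" unfolding N_def by (simp add: measure_restrict_space space_restrict_space)
  finally show ?thesis by simp
qed

section \<open>Second derivatives and harmonic functions\<close>

text \<open>
  The first and second derivative are carried along as explicit functions, since the chain and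
  product rules and the trace of the second derivative are simpler in this form than with iterated
  partial derivatives.
\<close>
definition twice_derivs :: "(real^'n \<Rightarrow> 'b::real_normed_vector) \<Rightarrow> (real^'n \<Rightarrow> real^'n \<Rightarrow> 'b) \<Rightarrow>
    (real^'n \<Rightarrow> real^'n \<Rightarrow> real^'n \<Rightarrow> 'b) \<Rightarrow> (real^'n) set \<Rightarrow> bool" where
  "twice_derivs f D H S \<longleftrightarrow>
     (\<forall>x\<in>S. (f has_derivative D x) (at x)) \<and>
     (\<forall>x\<in>S. \<forall>v. ((\<lambda>y. D y v) has_derivative H x v) (at x)) \<and>
     (\<forall>x\<in>S. \<forall>w. linear (\<lambda>v. H x v w)) \<and>
     (\<forall>v w. continuous_on S (\<lambda>x. H x v w))"

lemma twice_derivsD: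
  assumes "twice_derivs f D H S"
  shows "x \<in> S \<Longrightarrow> (f has_derivative D x) (at x)"
    and "x \<in> S \<Longrightarrow> ((\<lambda>y. D y v) has_derivative H x v) (at x)"
    and "x \<in> S \<Longrightarrow> linear (\<lambda>v. H x v w)"
    and "continuous_on S (\<lambda>x. H x v w)"
    and "x \<in> S \<Longrightarrow> linear (D x)"
    and "x \<in> S \<Longrightarrow> linear (H x v)"
    and "continuous_on S (\<lambda>x. D x v)"
    and "continuous_on S f"
proof -
  show 1: "x \<in> S \<Longrightarrow> (f has_derivative D x) (at x)"
    and 2: "x \<in> S \<Longrightarrow> ((\<lambda>y. D y v) has_derivative H x v) (at x)"
    and "x \<in> S \<Longrightarrow> linear (\<lambda>v. H x v w)" "continuous_on S (\<lambda>x. H x v w)" for x v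
    using assms unfolding twice_derivs_def by blast+
  show "x \<in> S \<Longrightarrow> linear (D x)" "x \<in> S \<Longrightarrow> linear (H x v)"
    using 1 2 has_derivative_linear by blast+
  show "continuous_on S (\<lambda>x. D x v)"
    by (rule continuous_at_imp_continuous_on) (use 2 has_derivative_continuous in blast)
  show "continuous_on S f"
    by (rule continuous_at_imp_continuous_on) (use 1 has_derivative_continuous in blast)
qed

lemma twice_derivs_subset: "twice_derivs f D H S \<Longrightarrow> T \<subseteq> S \<Longrightarrow> twice_derivs f D H T"
  unfolding twice_derivs_def by (meson continuous_on_subset subsetD)

lemma linear_Basis_expand:
  fixes L :: "real^'n \<Rightarrow> 'b::real_vector"
  assumes "linear L"
  shows "(\<Sum>b\<in>Basis. (v \<bullet> b) *\<^sub>R L b) = L v"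
proof -
  have "L v = L (\<Sum>b\<in>Basis. (v \<bullet> b) *\<^sub>R b)" by (simp add: euclidean_representation)
  also have "\<dots> = (\<Sum>b\<in>Basis. (v \<bullet> b) *\<^sub>R L b)" by (simp only: linear_sum[OF assms] linear_cmul[OF assms])
  finally show ?thesis ..
qed

text \<open>
  The partial derivatives assemble to full derivatives by expanding the direction in the standard
  basis; the laplacian becomes the trace of \<open>H\<close>.
\<close>
lemma harmonic_on_twice_derivs:
  fixes f :: "real^'n \<Rightarrow> complex"
  assumes "harmonic_on f S"
  obtains D H where "twice_derivs f D H S" "\<And>x. x \<in> S \<Longrightarrow> (\<Sum>b\<in>Basis. H x b b) = 0"
proof -
  from assms have op: "open S" and C2: "C2_on f S" and lap: "\<And>x. x \<in> S \<Longrightarrow> laplacian f x = 0"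
    unfolding harmonic_on_def by auto
  define D where "D = (\<lambda>x. frechet_derivative f (at x))"
  define H where "H = (\<lambda>x v w. \<Sum>b\<in>Basis. (v \<bullet> b) *\<^sub>R frechet_derivative (partial_deriv b f) (at x) w)"
  have 1: "(f has_derivative D x) (at x)" if "x \<in> S" for x
    using C2 that unfolding C2_on_def D_def by (simp add: frechet_derivative_works)
  have 2: "(partial_deriv b f has_derivative frechet_derivative (partial_deriv b f) (at x)) (at x)"
    if "x \<in> S" "b \<in> Basis" for x b
    using C2 that unfolding C2_on_def by (simp add: frechet_derivative_works)
  have 3: "D x v = (\<Sum>b\<in>Basis. (v \<bullet> b) *\<^sub>R partial_deriv b f x)" if "x \<in> S" for x v
    using linear_Basis_expand[OF has_derivative_linear[OF 1[OF that]], of v] by (simp add: partial_deriv_def D_def)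
  have 4: "((\<lambda>y. D y v) has_derivative H x v) (at x)" if "x \<in> S" for x v
  proof (rule has_derivative_transform_within_open[OF _ op that])
    show "((\<lambda>y. \<Sum>b\<in>Basis. (v \<bullet> b) *\<^sub>R partial_deriv b f y) has_derivative H x v) (at x)"
      unfolding H_def using 2 that by (intro has_derivative_sum has_derivative_scaleR_right) auto
  qed (simp add: 3)
  have 5: "linear (\<lambda>v. H x v w)" for x w
    unfolding H_def by (intro linearI) (simp_all add: inner_add_left scaleR_add_left sum.distrib scaleR_sum_right)
  have Hb: "H x v b = (\<Sum>c\<in>Basis. (v \<bullet> c) *\<^sub>R partial_deriv b (partial_deriv c f) x)" for x v b
    by (simp add: H_def partial_deriv_def)
  have "continuous_on S (\<lambda>x. H x v w)" for v w
  proof -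
    have "continuous_on S (\<lambda>x. \<Sum>b\<in>Basis. (w \<bullet> b) *\<^sub>R H x v b)"
      unfolding Hb using C2 unfolding C2_on_def by (intro continuous_on_sum continuous_on_scaleR continuous_on_const) auto
    then show ?thesis
      by (rule continuous_on_eq) (use linear_Basis_expand[OF has_derivative_linear[OF 4]] in auto)
  qed
  then have "twice_derivs f D H S" unfolding twice_derivs_def using 1 4 5 by blast
  moreover have "(\<Sum>b\<in>Basis. H x b b) = 0" if "x \<in> S" for x
  proof -
    have "H x b b = partial_deriv b (partial_deriv b f) x" if "b \<in> Basis" for b
    proof -
      have "H x b b = (\<Sum>c\<in>Basis. (if c = b then partial_deriv b (partial_deriv c f) x else 0))"
        unfolding Hb using that by (intro sum.cong) (auto simp: inner_Basis)
      then show ?thesis using that by simp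
    qed
    then show ?thesis using lap[OF that] unfolding laplacian_def by simp
  qed
  ultimately show ?thesis using that by blast
qed

lemma harmonic_onI:
  fixes f :: "real^'n \<Rightarrow> complex"
  assumes op: "open S" and td: "twice_derivs f D H S" and tr: "\<And>x. x \<in> S \<Longrightarrow> (\<Sum>b\<in>Basis. H x b b) = 0"
  shows "harmonic_on f S"
proof -
  note T = twice_derivsD[OF td]
  have p: "partial_deriv b f x = D x b" if "x \<in> S" for x b
    unfolding partial_deriv_def using frechet_derivative_at[OF T(1)[OF that]] by simp
  have pd: "(partial_deriv b f has_derivative H x b) (at x)" if "x \<in> S" for x b
    by (rule has_derivative_transform_within_open[OF T(2)[OF that] op that]) (simp add: p)
  have pp: "partial_deriv c (partial_deriv b f) x = H x b c" if "x \<in> S" for x b c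
    using frechet_derivative_at[OF pd[OF that]] by (simp add: partial_deriv_def[of c])
  have "continuous_on S (partial_deriv c (partial_deriv b f))" for b c
    by (rule continuous_on_eq[OF T(4)]) (simp add: pp)
  then have "C2_on f S" unfolding C2_on_def using T(1) pd unfolding differentiable_def by blast
  then show ?thesis unfolding harmonic_on_def laplacian_def using op tr by (simp add: pp)
qed

lemma harmonic_on_continuous_on: "harmonic_on f S \<Longrightarrow> continuous_on S f"
  by (metis harmonic_on_twice_derivs twice_derivsD(8))

lemma harmonic_on_open: "harmonic_on f S \<Longrightarrow> open S"
  by (simp add: harmonic_on_def)

lemma harmonic_on_subset:
  assumes "harmonic_on f S" "T \<subseteq> S" "open T" shows "harmonic_on f T"
proof -
  obtain D H where "twice_derivs f D H S" "\<And>x. x \<in> S \<Longrightarrow> (\<Sum>b\<in>Basis. H x b b) = 0"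
    using harmonic_on_twice_derivs[OF assms(1)] by blast
  then show ?thesis using assms(2)
    by (intro harmonic_onI[OF assms(3) twice_derivs_subset]) auto
qed

lemma twice_derivs_transform:
  assumes "twice_derivs f D H S" "open S" "\<And>x. x \<in> S \<Longrightarrow> f x = g x"
  shows "twice_derivs g D H S"
proof -
  have "(g has_derivative D x) (at x)" if "x \<in> S" for x
    by (rule has_derivative_transform_within_open[OF twice_derivsD(1)[OF assms(1) that] assms(2) that assms(3)])
  then show ?thesis using assms(1) unfolding twice_derivs_def by blast
qed

lemma harmonic_on_cong:
  assumes "harmonic_on f S" "\<And>x. x \<in> S \<Longrightarrow> f x = g x"
  shows "harmonic_on g S"
proof -
  obtain D H where f: "twice_derivs f D H S" "\<And>x. x \<in> S \<Longrightarrow> (\<Sum>b\<in>Basis. H x b b) = 0"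
    using harmonic_on_twice_derivs[OF assms(1)] by blast
  have op: "open S" using assms(1) by (rule harmonic_on_open)
  show ?thesis by (rule harmonic_onI[OF op twice_derivs_transform[OF f(1) op assms(2)] f(2)])
qed

lemma harmonic_on_const: "open S \<Longrightarrow> harmonic_on (\<lambda>x::real^'n. c) S"
  by (rule harmonic_onI[where D = "\<lambda>_ _. 0" and H = "\<lambda>_ _ _. 0"])
     (auto simp: twice_derivs_def linear_iff)

lemma harmonic_on_linear:
  assumes "open S" "linear L" shows "harmonic_on (L :: real^'n \<Rightarrow> complex) S"
  using assms
  by (intro harmonic_onI[where D = "\<lambda>_. L" and H = "\<lambda>_ _ _. 0"])
     (auto simp: twice_derivs_def linear_iff linear_linear intro!: bounded_linear_imp_has_derivative)

lemma harmonic_on_add: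
  assumes "harmonic_on f S" "harmonic_on g S" shows "harmonic_on (\<lambda>x. f x + g x) S"
proof -
  obtain D H where f: "twice_derivs f D H S" "\<And>x. x \<in> S \<Longrightarrow> (\<Sum>b\<in>Basis. H x b b) = 0"
    using harmonic_on_twice_derivs[OF assms(1)] by blast
  obtain E K where g: "twice_derivs g E K S" "\<And>x. x \<in> S \<Longrightarrow> (\<Sum>b\<in>Basis. K x b b) = 0"
    using harmonic_on_twice_derivs[OF assms(2)] by blast
  show ?thesis
  proof (rule harmonic_onI)
    show "twice_derivs (\<lambda>x. f x + g x) (\<lambda>x v. D x v + E x v) (\<lambda>x v w. H x v w + K x v w) S"
      unfolding twice_derivs_def
      by (intro conjI ballI allI has_derivative_add continuous_on_add linear_compose_add)
         (auto intro: twice_derivsD[OF f(1)] twice_derivsD[OF g(1)])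
  qed (use f(2) g(2) harmonic_on_open[OF assms(1)] in \<open>auto simp: sum.distrib\<close>)
qed

lemma harmonic_on_cmult:
  assumes "harmonic_on f S" shows "harmonic_on (\<lambda>x. c * f x) S"
proof -
  obtain D H where f: "twice_derivs f D H S" "\<And>x. x \<in> S \<Longrightarrow> (\<Sum>b\<in>Basis. H x b b) = 0"
    using harmonic_on_twice_derivs[OF assms(1)] by blast
  have "linear (\<lambda>v. c * L v)" if "linear L" for L :: "real^'n \<Rightarrow> complex"
    using that by (auto simp: linear_iff algebra_simps)
  note lin = this
  show ?thesis
  proof (rule harmonic_onI)
    show "twice_derivs (\<lambda>x. c * f x) (\<lambda>x v. c * D x v) (\<lambda>x v w. c * H x v w) S"
      unfolding twice_derivs_def
      by (intro conjI ballI allI has_derivative_mult_right continuous_on_mult continuous_on_const lin)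
         (auto intro: twice_derivsD[OF f(1)])
  qed (use f(2) harmonic_on_open[OF assms(1)] in \<open>auto simp flip: sum_distrib_left\<close>)
qed

lemma twice_derivs_compose:
  fixes f :: "real^'n \<Rightarrow> complex" and G :: "real^'n \<Rightarrow> real^'n"
  assumes f: "twice_derivs f D H T" and G: "twice_derivs G G' G'' S" and sub: "G ` S \<subseteq> T"
    and opS: "open S"
  shows "twice_derivs (\<lambda>x. f (G x)) (\<lambda>x v. D (G x) (G' x v))
     (\<lambda>x v w. D (G x) (G'' x v w) + H (G x) (G' x v) (G' x w)) S"
proof -
  note F = twice_derivsD[OF f] and g = twice_derivsD[OF G]
  have GT: "G x \<in> T" if "x \<in> S" for x using that sub by auto
  have exp: "L v = (\<Sum>b\<in>Basis. (v \<bullet> b) *\<^sub>R L b)" if "linear L" for L :: "real^'n \<Rightarrow> complex" and v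
    using linear_Basis_expand[OF that] by simp
  have contDG: "continuous_on S (\<lambda>x. D (G x) b)" for b
    using continuous_on_compose2[OF F(7) g(8) sub] .
  have contHG: "continuous_on S (\<lambda>x. H (G x) b c)" for b c
    using continuous_on_compose2[OF F(4) g(8) sub] .
  have 1: "((\<lambda>x. f (G x)) has_derivative (\<lambda>v. D (G x) (G' x v))) (at x)" if "x \<in> S" for x
    using has_derivative_compose[OF g(1)[OF that] F(1)[OF GT[OF that]]] .
  have 2: "((\<lambda>y. D (G y) (G' y v)) has_derivative (\<lambda>w. D (G x) (G'' x v w) + H (G x) (G' x v) (G' x w))) (at x)"
    if x: "x \<in> S" for x v
  proof -
    have "((\<lambda>y. \<Sum>b\<in>Basis. (G' y v \<bullet> b) *\<^sub>R D (G y) b) has_derivative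
        (\<lambda>w. \<Sum>b\<in>Basis. (G' x v \<bullet> b) *\<^sub>R H (G x) b (G' x w) + (G'' x v w \<bullet> b) *\<^sub>R D (G x) b)) (at x)"
      by (intro has_derivative_sum has_derivative_scaleR has_derivative_inner_left g(2)[OF x]
          has_derivative_compose[OF g(1)[OF x] F(2)[OF GT[OF x]]])
    moreover have "(\<lambda>w. \<Sum>b\<in>Basis. (G' x v \<bullet> b) *\<^sub>R H (G x) b (G' x w) + (G'' x v w \<bullet> b) *\<^sub>R D (G x) b) =
        (\<lambda>w. D (G x) (G'' x v w) + H (G x) (G' x v) (G' x w))"
      unfolding sum.distrib linear_Basis_expand[OF F(3)[OF GT[OF x]]] linear_Basis_expand[OF F(5)[OF GT[OF x]]]
      by (simp add: add.commute)
    ultimately have "((\<lambda>y. \<Sum>b\<in>Basis. (G' y v \<bullet> b) *\<^sub>R D (G y) b) has_derivative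
        (\<lambda>w. D (G x) (G'' x v w) + H (G x) (G' x v) (G' x w))) (at x)" by simp
    then show ?thesis
      by (rule has_derivative_transform_within_open[OF _ opS x])
         (use linear_Basis_expand[OF F(5)[OF GT]] in auto)
  qed
  have 3: "linear (\<lambda>v. D (G x) (G'' x v w) + H (G x) (G' x v) (G' x w))" if "x \<in> S" for x w
    using linear_compose[OF g(3)[OF that] F(5)[OF GT[OF that]]] linear_compose[OF g(5)[OF that] F(3)[OF GT[OF that]]]
    by (intro linear_compose_add) (auto simp: o_def)
  have 4: "continuous_on S (\<lambda>x. D (G x) (G'' x v w) + H (G x) (G' x v) (G' x w))" for v w
  proof -
    have "continuous_on S (\<lambda>x. (\<Sum>b\<in>Basis. (G'' x v w \<bullet> b) *\<^sub>R D (G x) b) +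
            (\<Sum>b\<in>Basis. (G' x v \<bullet> b) *\<^sub>R (\<Sum>c\<in>Basis. (G' x w \<bullet> c) *\<^sub>R H (G x) b c)))"
      by (intro continuous_intros contDG contHG g)
    then show ?thesis
    proof (rule continuous_on_eq)
      fix x assume x: "x \<in> S"
      show "(\<Sum>b\<in>Basis. (G'' x v w \<bullet> b) *\<^sub>R D (G x) b) +
            (\<Sum>b\<in>Basis. (G' x v \<bullet> b) *\<^sub>R (\<Sum>c\<in>Basis. (G' x w \<bullet> c) *\<^sub>R H (G x) b c)) =
        D (G x) (G'' x v w) + H (G x) (G' x v) (G' x w)"
        unfolding linear_Basis_expand[OF F(6)[OF GT[OF x]]] linear_Basis_expand[OF F(3)[OF GT[OF x]]]
          linear_Basis_expand[OF F(5)[OF GT[OF x]]] ..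
    qed
  qed
  show ?thesis unfolding twice_derivs_def using 1 2 3 4 by blast
qed

lemma twice_derivs_scaleR:
  fixes k :: "real^'n \<Rightarrow> real" and f :: "real^'n \<Rightarrow> complex"
  assumes k: "twice_derivs k k' k'' S" and f: "twice_derivs f D H S"
  shows "twice_derivs (\<lambda>x. k x *\<^sub>R f x) (\<lambda>x v. k x *\<^sub>R D x v + k' x v *\<^sub>R f x)
     (\<lambda>x v w. (k x *\<^sub>R H x v w + k' x w *\<^sub>R D x v) + (k' x v *\<^sub>R D x w + k'' x v w *\<^sub>R f x)) S"
proof -
  note K = twice_derivsD[OF k] and F = twice_derivsD[OF f]
  have lin: "linear (\<lambda>v. c *\<^sub>R L v)" if "linear L" for L :: "real^'n \<Rightarrow> complex" and c
    using that by (rule linear_compose_scale_right)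
  have lin': "linear (\<lambda>v. L v *\<^sub>R c)" if "linear L" for L :: "real^'n \<Rightarrow> real" and c :: complex
    using that by (auto simp: linear_iff scaleR_add_left)
  show ?thesis
    unfolding twice_derivs_def
    by (intro conjI ballI allI has_derivative_add has_derivative_scaleR linear_compose_add lin lin' continuous_intros)
       (auto intro: K F)
qed

text \<open>
  The trace of a bilinear form is multiplied by \<open>c\<close> under a linear map that is \<open>\<surd>c\<close> times an
  orthogonal one. This is why the laplacian behaves well under conformal maps.
\<close>
lemma sum_Basis_conformal:
  fixes B :: "real^'n \<Rightarrow> real^'n \<Rightarrow> complex"
  assumes B: "\<And>w. linear (\<lambda>v. B v w)" "\<And>v. linear (B v)"
    and L: "\<And>u v. (\<Sum>b\<in>Basis. (L b \<bullet> u) * (L b \<bullet> v)) = c * (u \<bullet> v)"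
  shows "(\<Sum>b\<in>Basis. B (L b) (L b)) = c *\<^sub>R (\<Sum>b\<in>Basis. B b b)"
proof -
  have "B (L b) (L b) = (\<Sum>u\<in>Basis. \<Sum>v\<in>Basis. ((L b \<bullet> u) * (L b \<bullet> v)) *\<^sub>R B u v)" for b
  proof -
    have "B (L b) (L b) = (\<Sum>u\<in>Basis. (L b \<bullet> u) *\<^sub>R (\<Sum>v\<in>Basis. (L b \<bullet> v) *\<^sub>R B u v))"
      by (simp only: linear_Basis_expand[OF B(2)] linear_Basis_expand[OF B(1)])
    then show ?thesis by (simp add: scaleR_sum_right)
  qed
  then have "(\<Sum>b\<in>Basis. B (L b) (L b)) = (\<Sum>b\<in>Basis. \<Sum>u\<in>Basis. \<Sum>v\<in>Basis. ((L b \<bullet> u) * (L b \<bullet> v)) *\<^sub>R B u v)"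
    by simp
  also have "\<dots> = (\<Sum>u\<in>Basis. \<Sum>v\<in>Basis. \<Sum>b\<in>Basis. ((L b \<bullet> u) * (L b \<bullet> v)) *\<^sub>R B u v)"
    by (subst sum.swap) (intro sum.cong refl sum.swap)
  also have "\<dots> = (\<Sum>u\<in>Basis. \<Sum>v\<in>Basis. (c * (u \<bullet> v)) *\<^sub>R B u v)"
    by (simp only: L flip: scaleR_sum_left)
  also have "\<dots> = (\<Sum>u\<in>Basis. \<Sum>v\<in>Basis. (if v = u then c *\<^sub>R B u u else 0))"
    by (intro sum.cong refl) (auto simp: inner_Basis)
  also have "\<dots> = c *\<^sub>R (\<Sum>b\<in>Basis. B b b)"
    by (simp add: scaleR_sum_right)
  finally show ?thesis .
qed

lemma harmonic_on_affine:
  fixes f :: "real^'n \<Rightarrow> complex" and U :: "real^'n \<Rightarrow> real^'n"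
  assumes f: "harmonic_on f T" and U: "orthogonal_transformation U"
  shows "harmonic_on (\<lambda>x. f (b + c *\<^sub>R U x)) ((\<lambda>x. b + c *\<^sub>R U x) -` T)"
proof -
  let ?G = "\<lambda>x. b + c *\<^sub>R U x"
  obtain D H where DH: "twice_derivs f D H T" "\<And>x. x \<in> T \<Longrightarrow> (\<Sum>b\<in>Basis. H x b b) = 0"
    using harmonic_on_twice_derivs[OF f] by blast
  have linU: "linear U" using U by (rule orthogonal_transformation_linear)
  have bl: "bounded_linear U" using linU by (simp add: linear_linear)
  have cU: "(?G has_derivative (\<lambda>v. c *\<^sub>R U v)) (at x)" for x
    by (auto intro!: derivative_eq_intros bounded_linear_imp_has_derivative[OF bl])
  have G: "twice_derivs ?G (\<lambda>x v. c *\<^sub>R U v) (\<lambda>_ _ _. 0) S" for S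
    unfolding twice_derivs_def using cU by (auto simp: linear_iff)
  have contG: "continuous_on UNIV ?G"
    using cU by (meson continuous_at_imp_continuous_on has_derivative_continuous)
  have op: "open (?G -` T)" using continuous_open_preimage[OF contG] harmonic_on_open[OF f] by simp
  obtain V where V: "orthogonal_transformation V" "\<And>x. U (V x) = x"
    using orthogonal_transformation_inv[OF U] orthogonal_transformation_surj[OF U] by (metis surj_f_inv_f)
  have adj: "U x \<bullet> y = x \<bullet> V y" for x y
    using U V(2) unfolding orthogonal_transformation_def by metis
  show ?thesis
  proof (rule harmonic_onI[OF op twice_derivs_compose[OF DH(1) G _ op]])
    fix x assume x: "x \<in> ?G -` T"
    note T = twice_derivsD[OF DH(1)]
    have "(\<Sum>b\<in>Basis. H (?G x) (c *\<^sub>R U b) (c *\<^sub>R U b)) = c\<^sup>2 *\<^sub>R (\<Sum>b\<in>Basis. H (?G x) b b)"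
    proof (rule sum_Basis_conformal[where B = "H (?G x)" and L = "\<lambda>v. c *\<^sub>R U v"])
      fix u v :: "real^'n"
      have "(\<Sum>b\<in>Basis. (c *\<^sub>R U b \<bullet> u) * (c *\<^sub>R U b \<bullet> v)) = c\<^sup>2 * (\<Sum>b\<in>Basis. (V u \<bullet> b) * (V v \<bullet> b))"
        unfolding sum_distrib_left adj inner_scaleR_left
        by (intro sum.cong) (auto simp: inner_commute power2_eq_square)
      also have "(\<Sum>b\<in>Basis. (V u \<bullet> b) * (V v \<bullet> b)) = V u \<bullet> V v"
        by (rule euclidean_inner[symmetric])
      also have "\<dots> = u \<bullet> v" using V(1) unfolding orthogonal_transformation_def by auto
      finally show "(\<Sum>b\<in>Basis. (c *\<^sub>R U b \<bullet> u) * (c *\<^sub>R U b \<bullet> v)) = c\<^sup>2 * (u \<bullet> v)" .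
    qed (use x T in auto)
    then show "(\<Sum>b\<in>Basis. D (?G x) 0 + H (?G x) (c *\<^sub>R U b) (c *\<^sub>R U b)) = 0"
      using DH(2) x linear_0[OF T(5)] by simp
  qed auto
qed

section \<open>The Kelvin transform\<close>

definition inversion :: "real^'n \<Rightarrow> real^'n" where
  "inversion x = (1 / (x \<bullet> x)) *\<^sub>R x"

text \<open>
  The first and second derivative of the inversion, the latter in the directions \<open>v\<close> and \<open>w\<close>.
\<close>
definition inversion_d :: "real^'n \<Rightarrow> real^'n \<Rightarrow> real^'n" where
  "inversion_d x v = (1 / (x \<bullet> x)) *\<^sub>R v - (2 * (x \<bullet> v) / (x \<bullet> x)\<^sup>2) *\<^sub>R x"

definition inversion_dd :: "real^'n \<Rightarrow> real^'n \<Rightarrow> real^'n \<Rightarrow> real^'n" where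
  "inversion_dd x v w = (8 * (x \<bullet> v) * (x \<bullet> w) / (x \<bullet> x)^3) *\<^sub>R x
     - ((2 * (x \<bullet> w) / (x \<bullet> x)\<^sup>2) *\<^sub>R v + (2 * (v \<bullet> w) / (x \<bullet> x)\<^sup>2) *\<^sub>R x + (2 * (x \<bullet> v) / (x \<bullet> x)\<^sup>2) *\<^sub>R w)"

lemma has_derivative_inversion:
  fixes x :: "real^'n"
  assumes x: "x \<noteq> 0"
  shows "(inversion has_derivative inversion_d x) (at x)"
    and "((\<lambda>y. inversion_d y v) has_derivative inversion_dd x v) (at x)"
proof -
  have d1: "((\<lambda>y. 1 / (y \<bullet> y)) has_derivative (\<lambda>w. - (2 * (x \<bullet> w) / (x \<bullet> x)\<^sup>2))) (at x)"
    using x by (auto intro!: derivative_eq_intros simp: fun_eq_iff inner_commute power2_eq_square field_simps)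
  have d2: "((\<lambda>y. 2 * (y \<bullet> v) / (y \<bullet> y)\<^sup>2) has_derivative
      (\<lambda>w. 2 * (v \<bullet> w) / (x \<bullet> x)\<^sup>2 - 8 * (x \<bullet> v) * (x \<bullet> w) / (x \<bullet> x)^3)) (at x)"
  proof -
    have s: "x \<bullet> x \<noteq> 0" using x by simp
    have "((\<lambda>y. 2 * (y \<bullet> v)) has_derivative (\<lambda>w. 2 * (w \<bullet> v))) (at x)"
      by (auto intro!: derivative_eq_intros)
    from has_derivative_mult[OF has_derivative_mult[OF this d1] d1]
    have "((\<lambda>y. 2 * (y \<bullet> v) * (1 / (y \<bullet> y)) * (1 / (y \<bullet> y))) has_derivative
       (\<lambda>w. 2 * (x \<bullet> v) * (1 / (x \<bullet> x)) * - (2 * (x \<bullet> w) / (x \<bullet> x)\<^sup>2) +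
         (2 * (x \<bullet> v) * - (2 * (x \<bullet> w) / (x \<bullet> x)\<^sup>2) + 2 * (w \<bullet> v) * (1 / (x \<bullet> x))) * (1 / (x \<bullet> x)))) (at x)" .
    moreover have "2 * p * (1 / s) * - (2 * q / s\<^sup>2) + (2 * p * - (2 * q / s\<^sup>2) + 2 * r * (1 / s)) * (1 / s) =
        2 * r / s\<^sup>2 - 8 * p * q / s ^ 3" if "s \<noteq> 0" for p q r s :: real
      using that by (simp add: field_simps power2_eq_square power3_eq_cube)
    note this[OF s]
    ultimately show ?thesis by (simp add: inner_commute power2_eq_square mult.assoc)
  qed
  have "((\<lambda>y. (1 / (y \<bullet> y)) *\<^sub>R y) has_derivative
      (\<lambda>w. (1 / (x \<bullet> x)) *\<^sub>R w + (- (2 * (x \<bullet> w) / (x \<bullet> x)\<^sup>2)) *\<^sub>R x)) (at x)"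
    by (rule has_derivative_scaleR[OF d1 has_derivative_ident])
  then show "(inversion has_derivative inversion_d x) (at x)"
    by (simp add: inversion_def[abs_def] inversion_d_def[abs_def])
  have "((\<lambda>y. (1 / (y \<bullet> y)) *\<^sub>R v - (2 * (y \<bullet> v) / (y \<bullet> y)\<^sup>2) *\<^sub>R y) has_derivative
      (\<lambda>w. (1 / (x \<bullet> x)) *\<^sub>R 0 + (- (2 * (x \<bullet> w) / (x \<bullet> x)\<^sup>2)) *\<^sub>R v -
        ((2 * (x \<bullet> v) / (x \<bullet> x)\<^sup>2) *\<^sub>R w +
         (2 * (v \<bullet> w) / (x \<bullet> x)\<^sup>2 - 8 * (x \<bullet> v) * (x \<bullet> w) / (x \<bullet> x)^3) *\<^sub>R x))) (at x)"
    by (intro has_derivative_diff has_derivative_scaleR[OF d1 has_derivative_const] has_derivative_scaleR[OF d2 has_derivative_ident])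
  then show "((\<lambda>y. inversion_d y v) has_derivative inversion_dd x v) (at x)"
    unfolding inversion_d_def[abs_def] inversion_dd_def[abs_def]
    by (rule back_subst[where P = "\<lambda>D. (_ has_derivative D) (at x)"])
       (auto simp: fun_eq_iff scaleR_diff_left algebra_simps)
qed

lemma twice_derivs_inversion: "twice_derivs inversion inversion_d inversion_dd (- {0})"
  unfolding twice_derivs_def
proof (intro conjI ballI allI)
  show "linear (\<lambda>v. inversion_dd x v w)" for x w :: "real^'n"
    by (rule linearI)
       (simp_all add: inversion_dd_def inner_add_left inner_add_right add_divide_distrib algebra_simps)
  show "continuous_on (- {0}) (\<lambda>x. inversion_dd x v w)" for v w :: "real^'n"
    unfolding inversion_dd_def by (intro continuous_intros) auto
qed (auto intro: has_derivative_inversion)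

lemma twice_derivs_norm_powr:
  "twice_derivs (\<lambda>x::real^'n. (x \<bullet> x) powr a) (\<lambda>x v. 2 * a * (x \<bullet> v) * (x \<bullet> x) powr (a - 1))
     (\<lambda>x v w. 2 * a * (v \<bullet> w) * (x \<bullet> x) powr (a - 1) + 4 * a * (a - 1) * (x \<bullet> v) * (x \<bullet> w) * (x \<bullet> x) powr (a - 2))
     (- {0})"
proof -
  have d: "((\<lambda>y::real^'n. (y \<bullet> y) powr a) has_derivative (\<lambda>v. 2 * a * (x \<bullet> v) * (x \<bullet> x) powr (a - 1))) (at x)"
    if "x \<noteq> 0" for x :: "real^'n" and a
  proof -
    have "((\<lambda>y::real^'n. (y \<bullet> y) powr a) has_derivative (\<lambda>v. (2 * (x \<bullet> v)) *\<^sub>R (a * (x \<bullet> x) powr (a - 1)))) (at x)"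
    proof (rule has_derivative_compose[where g = "\<lambda>u. u powr a" and g' = "\<lambda>h. h *\<^sub>R (a * (x \<bullet> x) powr (a - 1))"])
      show "((\<lambda>y. y \<bullet> y) has_derivative (\<lambda>v. 2 * (x \<bullet> v))) (at x)"
        by (auto intro!: derivative_eq_intros simp: inner_commute)
      have "((\<lambda>u. u powr a) has_real_derivative a * (x \<bullet> x) powr (a - 1)) (at (x \<bullet> x))"
        using that by (intro has_real_derivative_powr) simp
      then show "((\<lambda>u. u powr a) has_derivative (\<lambda>h. h *\<^sub>R (a * (x \<bullet> x) powr (a - 1)))) (at (x \<bullet> x))"
        by (simp add: has_field_derivative_def mult_commute_abs)
    qed
    then show ?thesis by (simp add: mult_ac)
  qed
  show ?thesis unfolding twice_derivs_def
  proof (intro conjI ballI allI)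
    fix x v :: "real^'n" assume x: "x \<in> - {0}"
    have "((\<lambda>y. 2 * a * (y \<bullet> v) * (y \<bullet> y) powr (a - 1)) has_derivative
       (\<lambda>w. 2 * a * (x \<bullet> v) * (2 * (a - 1) * (x \<bullet> w) * (x \<bullet> x) powr (a - 1 - 1)) + 2 * a * (w \<bullet> v) * (x \<bullet> x) powr (a - 1))) (at x)"
      using x by (intro has_derivative_mult d) (auto intro!: derivative_eq_intros)
    then show "((\<lambda>y. 2 * a * (y \<bullet> v) * (y \<bullet> y) powr (a - 1)) has_derivative
       (\<lambda>w. 2 * a * (v \<bullet> w) * (x \<bullet> x) powr (a - 1) + 4 * a * (a - 1) * (x \<bullet> v) * (x \<bullet> w) * (x \<bullet> x) powr (a - 2))) (at x)"
      by (simp add: algebra_simps inner_commute)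
  next
    show "linear (\<lambda>v. 2 * a * (v \<bullet> w) * (x \<bullet> x) powr (a - 1) + 4 * a * (a - 1) * (x \<bullet> v) * (x \<bullet> w) * (x \<bullet> x) powr (a - 2))"
      for w x :: "real^'n"
      by (rule linearI) (simp_all add: inner_add_left inner_add_right algebra_simps)
  next
    show "continuous_on (- {0}) (\<lambda>x. 2 * a * (v \<bullet> w) * (x \<bullet> x) powr (a - 1) + 4 * a * (a - 1) * (x \<bullet> v) * (x \<bullet> w) * (x \<bullet> x) powr (a - 2))"
      for v w :: "real^'n"
      by (intro continuous_intros) auto
  qed (use d in auto)
qed

text \<open>
  The derivative of the inversion is \<open>1 / \<bar>x\<bar>\<^sup>2\<close> times the reflection along \<open>x\<close>, hence conformal.
\<close>
lemma inner_inversion_d: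
  assumes "x \<noteq> 0"
  shows "(\<Sum>b\<in>Basis. (inversion_d x b \<bullet> u) * (inversion_d x b \<bullet> v)) = (1 / (x \<bullet> x)\<^sup>2) * (u \<bullet> v)"
proof -
  have s: "x \<bullet> x \<noteq> 0" using assms by simp
  have sym: "inversion_d x b \<bullet> u = inversion_d x u \<bullet> b" for b u
    unfolding inversion_d_def inner_diff_left inner_scaleR_left inner_commute[of b u] by simp
  have "(\<Sum>b\<in>Basis. (inversion_d x b \<bullet> u) * (inversion_d x b \<bullet> v)) = (\<Sum>b\<in>Basis. (inversion_d x u \<bullet> b) * (inversion_d x v \<bullet> b))"
    by (intro sum.cong refl arg_cong2[where f = "(*)"] sym)
  also have "\<dots> = inversion_d x u \<bullet> inversion_d x v"
    by (rule euclidean_inner[symmetric])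
  also have "\<dots> = (1 / (x \<bullet> x)\<^sup>2) * (u \<bullet> v)"
  proof -
    have "1 / s * (1 / s * r) - 1 / s * (2 * q / s\<^sup>2 * p) - (2 * p / s\<^sup>2 * (1 / s * q) - 2 * p / s\<^sup>2 * (2 * q / s\<^sup>2 * s)) = 1 / s\<^sup>2 * r"
      if "s \<noteq> 0" for p q r s :: real
      using that by (simp add: field_simps power2_eq_square)
    from this[OF s, of "u \<bullet> v" "x \<bullet> v" "x \<bullet> u"] show ?thesis
      unfolding inversion_d_def
      by (simp add: inner_diff_left inner_diff_right inner_commute[of u x] right_diff_distrib mult.left_commute)
  qed
  finally show ?thesis .
qed

text \<open>
  The Kelvin transform. With \<open>k x = \<bar>x\<bar> powr (2 - n)\<close>, the trace of the second derivative of
  \<open>k x f (x / \<bar>x\<bar>\<^sup>2)\<close> has four parts: the trace of \<open>H\<close> vanishes since the inversion is conformal, the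
  laplacian of \<open>k\<close> vanishes, and the two remaining parts (the laplacian of the inversion and the
  mixed term) are opposite multiples of the derivative of \<open>f\<close> in direction \<open>x\<close>.
\<close>
theorem harmonic_on_Kelvin:
  fixes f :: "real^'n \<Rightarrow> complex"
  assumes f: "harmonic_on f T"
  shows "harmonic_on (\<lambda>x. ((x \<bullet> x) powr ((2 - real CARD('n)) / 2)) *\<^sub>R f (inversion x)) ({x. x \<noteq> 0 \<and> inversion x \<in> T})"
proof -
  let ?S = "{x. x \<noteq> 0 \<and> inversion x \<in> T}" and ?a = "(2 - real CARD('n)) / 2"
  obtain D H where DH: "twice_derivs f D H T" "\<And>x. x \<in> T \<Longrightarrow> (\<Sum>b\<in>Basis. H x b b) = 0"
    using harmonic_on_twice_derivs[OF f] by blast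
  have "continuous_on (- {0}) (inversion :: real^'n \<Rightarrow> _)" using twice_derivsD(8)[OF twice_derivs_inversion] .
  then have "open (inversion -` T \<inter> - {0})" using harmonic_on_open[OF f] by (metis continuous_on_open_vimage open_Compl closed_singleton inf.commute)
  also have "inversion -` T \<inter> - {0} = ?S" by auto
  finally have op: "open ?S" .
  have sub: "?S \<subseteq> - {0}" "inversion ` ?S \<subseteq> T" by auto
  note fi = twice_derivs_compose[OF DH(1) twice_derivs_subset[OF twice_derivs_inversion sub(1)] sub(2) op]
  show ?thesis
  proof (rule harmonic_onI[OF op twice_derivs_scaleR[OF twice_derivs_subset[OF twice_derivs_norm_powr[of ?a] sub(1)] fi]])
    fix x assume x: "x \<in> ?S"
    let ?k1 = "\<lambda>b. 2 * ?a * (x \<bullet> b) * (x \<bullet> x) powr (?a - 1)"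
    let ?k2 = "\<lambda>b. 2 * ?a * (b \<bullet> b) * (x \<bullet> x) powr (?a - 1) + 4 * ?a * (?a - 1) * (x \<bullet> b) * (x \<bullet> b) * (x \<bullet> x) powr (?a - 2)"
    define s where "s = x \<bullet> x"
    have s: "s > 0" using x by (simp add: s_def)
    have sa: "s powr (?a - 1) = s powr ?a / s" "s powr (?a - 2) = s powr ?a / s\<^sup>2"
      using s by (simp_all add: powr_diff powr_numeral)
    note T = twice_derivsD[OF DH(1)]
    let ?y = "inversion x"
    have linD: "linear (D ?y)" using T(5) x by auto
    define K where "K = s powr ?a"
    have 1: "(\<Sum>b\<in>Basis. H ?y (inversion_d x b) (inversion_d x b)) = 0"
      using sum_Basis_conformal[where B = "H ?y" and L = "inversion_d x", OF _ _ inner_inversion_d] T x DH(2) by auto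
    have 2: "(\<Sum>b\<in>Basis. inversion_dd x b b) = ((4 - 2 * real CARD('n)) / s\<^sup>2) *\<^sub>R x"
    proof -
      have "inversion_dd x b b = ((8 / s ^ 3) * ((x \<bullet> b) * (x \<bullet> b))) *\<^sub>R x - (4 / s\<^sup>2) *\<^sub>R ((x \<bullet> b) *\<^sub>R b) - (2 / s\<^sup>2) *\<^sub>R x"
        if "b \<in> Basis" for b
        using that unfolding inversion_dd_def s_def[symmetric]
        by (simp add: algebra_simps flip: scaleR_add_left)
      then have "(\<Sum>b\<in>Basis. inversion_dd x b b) =
          ((8 / s ^ 3) * (\<Sum>b\<in>Basis. (x \<bullet> b) * (x \<bullet> b))) *\<^sub>R x - (4 / s\<^sup>2) *\<^sub>R (\<Sum>b\<in>Basis. (x \<bullet> b) *\<^sub>R b) - (2 / s\<^sup>2) *\<^sub>R (real CARD('n) *\<^sub>R x)"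
        by (simp only: sum_subtractf sum_distrib_left[symmetric] scaleR_sum_right[symmetric] scaleR_sum_left[symmetric]
            sum_constant_scaleR DIM_cart DIM_real mult_1_right cong: sum.cong)
      also have "\<dots> = (8 / s ^ 3 * s) *\<^sub>R x - (4 / s\<^sup>2) *\<^sub>R x - (2 / s\<^sup>2 * real CARD('n)) *\<^sub>R x"
        unfolding euclidean_representation s_def euclidean_inner[of x x, symmetric] by simp
      also have "\<dots> = (8 / s ^ 3 * s - 4 / s\<^sup>2 - 2 / s\<^sup>2 * real CARD('n)) *\<^sub>R x"
        by (simp only: scaleR_diff_left)
      also have "8 / s ^ 3 * s - 4 / s\<^sup>2 - 2 / s\<^sup>2 * real CARD('n) = (4 - 2 * real CARD('n)) / s\<^sup>2"
        using s by (simp add: field_simps eval_nat_numeral)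
      finally show ?thesis .
    qed
    have 3: "(\<Sum>b\<in>Basis. (x \<bullet> b) *\<^sub>R D ?y (inversion_d x b)) = - (1 / s) *\<^sub>R D ?y x"
    proof -
      have "linear (inversion_d x)" using twice_derivsD(5)[OF twice_derivs_inversion] x by auto
      then have "linear (\<lambda>v. D ?y (inversion_d x v))" using linD linear_compose[of "inversion_d x" "D ?y"] by (simp add: o_def)
      from linear_Basis_expand[OF this, of x]
      have "(\<Sum>b\<in>Basis. (x \<bullet> b) *\<^sub>R D ?y (inversion_d x b)) = D ?y (inversion_d x x)" .
      also have "inversion_d x x = - (1 / s) *\<^sub>R x"
        using s unfolding inversion_d_def s_def by (simp add: power2_eq_square flip: scaleR_diff_left)
      finally show ?thesis by (simp only: linear_cmul[OF linD])
    qed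
    have 4: "(\<Sum>b\<in>(Basis :: (real^'n) set). ?k2 b) = 0"
    proof -
      have "(\<Sum>b\<in>(Basis :: (real^'n) set). ?k2 b)
        = (\<Sum>b\<in>(Basis :: (real^'n) set). 2 * ?a * (K / s) + 4 * ?a * (?a - 1) * (K / s\<^sup>2) * ((x \<bullet> b) * (x \<bullet> b)))"
        unfolding s_def[symmetric] sa K_def by (intro sum.cong) auto
      also have "\<dots> = real CARD('n) * (2 * ?a * (K / s)) + 4 * ?a * (?a - 1) * (K / s\<^sup>2) * s"
        unfolding sum.distrib s_def euclidean_inner[of x x] by (simp add: sum_distrib_left)
      also have "\<dots> = 0" using s by (simp add: field_simps power2_eq_square)
      finally show ?thesis .
    qed
    have "(\<Sum>b\<in>Basis. (x \<bullet> x) powr ?a *\<^sub>R (D ?y (inversion_dd x b b) + H ?y (inversion_d x b) (inversion_d x b)) +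
          ?k1 b *\<^sub>R D ?y (inversion_d x b) +
          (?k1 b *\<^sub>R D ?y (inversion_d x b) +
           ?k2 b *\<^sub>R f ?y)) =
       (\<Sum>b\<in>Basis. K *\<^sub>R D ?y (inversion_dd x b b) + K *\<^sub>R H ?y (inversion_d x b) (inversion_d x b) +
          (4 * ?a * K / s) *\<^sub>R ((x \<bullet> b) *\<^sub>R D ?y (inversion_d x b)) +
           ?k2 b *\<^sub>R f ?y)"
    proof (rule sum.cong[OF refl], goal_cases)
      case (1 b)
      have "?k1 b *\<^sub>R w + ?k1 b *\<^sub>R w =
         (4 * ?a * K / s) *\<^sub>R ((x \<bullet> b) *\<^sub>R w)" for w :: complex
        unfolding s_def[symmetric] sa K_def[symmetric] using s by (simp add: field_simps flip: scaleR_add_left)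
      then show ?case
        unfolding K_def s_def[symmetric] by (simp only: scaleR_add_right add.assoc flip: add.assoc[of "_ *\<^sub>R D _ _" "_ *\<^sub>R D _ _"])
    qed
    also have "\<dots> = K *\<^sub>R D ?y (\<Sum>b\<in>Basis. inversion_dd x b b) + K *\<^sub>R (\<Sum>b\<in>Basis. H ?y (inversion_d x b) (inversion_d x b)) +
          (4 * ?a * K / s) *\<^sub>R (\<Sum>b\<in>Basis. (x \<bullet> b) *\<^sub>R D ?y (inversion_d x b)) +
          (\<Sum>b\<in>(Basis :: (real^'n) set). ?k2 b) *\<^sub>R f ?y"
      by (simp only: scaleR_sum_left) (simp only: sum.distrib scaleR_sum_right linear_sum[OF linD])
    also have "\<dots> = (K * ((4 - 2 * real CARD('n)) / s\<^sup>2) - 4 * ?a * K / s * (1 / s)) *\<^sub>R D ?y x"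
      unfolding 1 2 3 4 by (simp add: linear_cmul[OF linD] scaleR_diff_left)
    also have "K * ((4 - 2 * real CARD('n)) / s\<^sup>2) - 4 * ?a * K / s * (1 / s) = 0"
      using s by (simp add: field_simps power2_eq_square)
    finally show "(\<Sum>b\<in>Basis. (x \<bullet> x) powr ?a *\<^sub>R (D ?y (inversion_dd x b b) + H ?y (inversion_d x b) (inversion_d x b)) +
          ?k1 b *\<^sub>R D ?y (inversion_d x b) +
          (?k1 b *\<^sub>R D ?y (inversion_d x b) +
           ?k2 b *\<^sub>R f ?y)) = 0"
      by simp
  qed
qed

section \<open>Green's identity on the sphere\<close>

text \<open>
  The function \<open>\<eta> (\<bar>x\<bar>\<^sup>2)\<close> is used as a cutoff for the unit ball whose gradient is \<open>2 q (\<bar>x\<bar>\<^sup>2) x\<close>.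
\<close>
lemma antiderivative_vanishing_beyond_1:
  fixes q :: "real \<Rightarrow> real"
  assumes q: "continuous_on UNIV q" "\<And>u. u \<ge> 1 \<Longrightarrow> q u = 0"
  obtains \<eta> where "\<And>u. u \<ge> 0 \<Longrightarrow> (\<eta> has_real_derivative q u) (at u)" "\<And>u. u \<ge> 1 \<Longrightarrow> \<eta> u = 0"
proof
  define I where "I u = integral {-1..u} q" for u
  define \<eta> where "\<eta> u = (if u < 1 then I u - I 1 else 0)" for u
  have cq: "continuous_on A q" for A using q(1) by (rule continuous_on_subset) simp
  have I1: "I u = I 1" if "u \<ge> 1" for u
  proof -
    have "I 1 + integral {1..u} q = I u"
      unfolding I_def using that
      by (intro Henstock_Kurzweil_Integration.integral_combine integrable_continuous_real cq) auto
    moreover have "integral {1..u} q = integral {1..u} (\<lambda>_. 0)"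
      by (rule Henstock_Kurzweil_Integration.integral_cong) (use q(2) in auto)
    ultimately show ?thesis by simp
  qed
  have \<eta>: "\<eta> u = I u - I 1" for u using I1[of u] by (auto simp: \<eta>_def)
  show "\<eta> u = 0" if "u \<ge> 1" for u using that by (simp add: \<eta>_def)
  show "(\<eta> has_real_derivative q u) (at u)" if "u \<ge> 0" for u
  proof -
    have "((\<lambda>u. integral {-1..u} q) has_real_derivative q u) (at u within {-1..u+1})"
      by (rule integral_has_real_derivative[OF cq]) (use that in simp)
    then have "((\<lambda>u. integral {-1..u} q) has_real_derivative q u) (at u)"
      using that at_within_interior[of u "{-1..u+1}"] by simp
    from DERIV_diff[OF this DERIV_const[of "I 1"]] show ?thesis
      unfolding \<eta>[abs_def] I_def by simp
  qed
qed

lemma continuous_on_radial_derivative: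
  assumes "twice_derivs g D H T"
  shows "continuous_on T (\<lambda>x. D x x)"
proof -
  have "continuous_on T (\<lambda>x. \<Sum>b\<in>Basis. (x \<bullet> b) *\<^sub>R D x b)"
    by (intro continuous_intros twice_derivsD(7)[OF assms])
  then show ?thesis
    by (rule continuous_on_eq) (use linear_Basis_expand[OF twice_derivsD(5)[OF assms]] in auto)
qed

text \<open>
  Take the field \<open>\<eta> (\<bar>x\<bar>\<^sup>2) (h \<nabla>g - g \<nabla>h)\<close>, where \<open>\<eta>\<close> vanishes beyond 1. Its divergence integrates to 0,
  and since \<open>g\<close> and \<open>h\<close> are harmonic it equals \<open>2 q (\<bar>x\<bar>\<^sup>2)\<close> times the integrand below, with
  \<open>q = \<eta>'\<close>. As \<open>q\<close> is arbitrary, the integral over the sphere vanishes.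
\<close>
lemma Green_identity_sphere:
  fixes g h :: "real^'n \<Rightarrow> complex"
  assumes T: "open T" "cball 0 1 \<subseteq> T"
    and g: "twice_derivs g D H T" "\<And>x. x \<in> T \<Longrightarrow> (\<Sum>b\<in>Basis. H x b b) = 0"
    and h: "twice_derivs h E K T" "\<And>x. x \<in> T \<Longrightarrow> (\<Sum>b\<in>Basis. K x b b) = 0"
  shows "(\<ointegral>z. h z * D z z - g z * E z z) = 0"
proof (rule integral_sphere_eq_0_if_radial_integrals_eq_0)
  note G = twice_derivsD[OF g(1)] and Hh = twice_derivsD[OF h(1)]
  show "continuous_on (cball 0 1) (\<lambda>z. h z * D z z - g z * E z z)"
    by (rule continuous_on_subset[OF _ T(2)])
       (intro continuous_intros G Hh continuous_on_radial_derivative[OF g(1)] continuous_on_radial_derivative[OF h(1)])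
  fix q :: "real \<Rightarrow> real" assume q: "continuous_on UNIV q" "\<And>u. u \<ge> 1 \<Longrightarrow> q u = 0"
  obtain \<eta> where \<eta>: "\<And>u. u \<ge> 0 \<Longrightarrow> (\<eta> has_real_derivative q u) (at u)" "\<And>u. u \<ge> 1 \<Longrightarrow> \<eta> u = 0"
    using antiderivative_vanishing_beyond_1[OF q] by blast
  define F where "F b x = \<eta> (x \<bullet> x) *\<^sub>R (h x * D x b - g x * E x b)" for b x
  define F' where "F' b x w = \<eta> (x \<bullet> x) *\<^sub>R ((h x * H x b w + E x w * D x b) - (g x * K x b w + D x w * E x b))
      + (q (x \<bullet> x) * (2 * (x \<bullet> w))) *\<^sub>R (h x * D x b - g x * E x b)" for b x w
  have d\<eta>: "((\<lambda>x. \<eta> (x \<bullet> x)) has_derivative (\<lambda>w. q (x \<bullet> x) * (2 * (x \<bullet> w)))) (at x)" for x :: "real^'n"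
  proof (rule has_derivative_compose[where g = \<eta> and g' = "\<lambda>t. q (x \<bullet> x) * t"])
    show "((\<lambda>x. x \<bullet> x) has_derivative (\<lambda>w. 2 * (x \<bullet> w))) (at x)"
      by (auto intro!: derivative_eq_intros simp: inner_commute)
    show "(\<eta> has_derivative (*) (q (x \<bullet> x))) (at (x \<bullet> x))"
      using \<eta>(1)[of "x \<bullet> x"] by (simp add: has_field_derivative_def)
  qed
  have dF: "(F b has_derivative F' b x) (at x)" if "x \<in> T" for b x
    unfolding F_def[abs_def] F'_def[abs_def]
    by (intro has_derivative_scaleR[OF d\<eta>] has_derivative_diff has_derivative_mult G Hh that)
  have out: "F b x = 0" "F' b x w = 0" if "norm x > 1" for b x w
  proof -
    have "x \<bullet> x \<ge> 1" using that by (simp add: dot_square_norm)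
    then show "F b x = 0" "F' b x w = 0" unfolding F_def F'_def using q(2) \<eta>(2) by auto
  qed
  define F0 where "F0 b x = (if x \<in> T then F b x else 0)" for b x
  define F0' where "F0' b x w = (if x \<in> T then F' b x w else 0)" for b x w
  define O1 where "O1 = {x::real^'n. norm x > 1}"
  have O1: "open O1" unfolding O1_def by (intro open_Collect_less continuous_intros)
  have nT: "x \<in> O1" if "x \<notin> T" for x using that T(2) unfolding O1_def by (metis (mono_tags) mem_Collect_eq mem_cball_0 not_le subsetD)
  have dF0: "(F0 b has_derivative F0' b x) (at x)" for b x
  proof (cases "x \<in> T")
    case True
    have "(F0 b has_derivative F' b x) (at x)"
      by (rule has_derivative_transform_within_open[OF dF[OF True] T(1) True]) (simp add: F0_def)
    then show ?thesis using True by (simp add: F0'_def[abs_def])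
  next
    case False
    have "(F0 b has_derivative (\<lambda>_. 0)) (at x)"
      by (rule has_derivative_transform_within_open[OF has_derivative_const O1 nT[OF False]])
         (auto simp: F0_def out O1_def)
    then show ?thesis using False by (simp add: F0'_def[abs_def])
  qed
  have cF0': "continuous_on UNIV (\<lambda>x. F0' b x w)" for b w
  proof -
    have c\<eta>: "continuous_on T (\<lambda>x. \<eta> (x \<bullet> x))"
      by (rule continuous_at_imp_continuous_on) (use d\<eta> has_derivative_continuous in blast)
    have cq: "continuous_on T (\<lambda>x. q (x \<bullet> x))"
      by (rule continuous_on_compose2[OF q(1)]) (auto intro!: continuous_intros)
    have "continuous_on T (\<lambda>x. F' b x w)"
      unfolding F'_def by (intro continuous_intros c\<eta> cq G Hh)
    then have "continuous_on T (\<lambda>x. F0' b x w)" by (rule continuous_on_eq) (simp add: F0'_def)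
    moreover have "continuous_on O1 (\<lambda>x. F0' b x w)"
      by (rule continuous_on_eq[of _ "\<lambda>_. 0"]) (auto simp: F0'_def out O1_def)
    ultimately have "continuous_on (T \<union> O1) (\<lambda>x. F0' b x w)" by (intro continuous_on_open_Un T O1)
    moreover have "T \<union> O1 = UNIV" using nT by blast
    ultimately show ?thesis by simp
  qed
  have zero: "(\<integral>x. F0' b x b \<partial>lborel) = 0" for b
    by (rule integral_directional_derivative_eq_0[OF dF0 cF0', where R = 1]) (auto simp: F0_def out)
  have int: "integrable lborel (\<lambda>x. F0' b x b)" for b
  proof -
    have "integrable lborel (\<lambda>x. indicator (cball 0 1) x *\<^sub>R F0' b x b)"
      by (rule borel_integrable_compact) (auto intro: continuous_on_subset[OF cF0'])
    moreover have "(\<lambda>x. indicator (cball 0 1) x *\<^sub>R F0' b x b) = (\<lambda>x. F0' b x b)"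
      by (auto simp: fun_eq_iff indicator_def F0'_def out)
    ultimately show ?thesis by simp
  qed
  have sum: "(\<Sum>b\<in>Basis. F0' b x b) = 2 *\<^sub>R (q (x \<bullet> x) *\<^sub>R (indicator (cball 0 1) x *\<^sub>R (h x * D x x - g x * E x x)))" for x
  proof (cases "norm x \<le> 1")
    case True
    then have xT: "x \<in> T" using T(2) by auto
    have "(\<Sum>b\<in>Basis. F0' b x b) = (\<Sum>b\<in>Basis. \<eta> (x \<bullet> x) *\<^sub>R (h x * H x b b - g x * K x b b)
      + (2 * q (x \<bullet> x)) *\<^sub>R (h x * ((x \<bullet> b) *\<^sub>R D x b) - g x * ((x \<bullet> b) *\<^sub>R E x b)))"
      using xT by (intro sum.cong refl) (simp add: F0'_def F'_def algebra_simps)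
    also have "\<dots> = \<eta> (x \<bullet> x) *\<^sub>R (h x * (\<Sum>b\<in>Basis. H x b b) - g x * (\<Sum>b\<in>Basis. K x b b))
      + (2 * q (x \<bullet> x)) *\<^sub>R (h x * (\<Sum>b\<in>Basis. (x \<bullet> b) *\<^sub>R D x b) - g x * (\<Sum>b\<in>Basis. (x \<bullet> b) *\<^sub>R E x b))"
      by (simp only: sum.distrib scaleR_sum_right[symmetric] sum_distrib_left sum_subtractf)
    finally show ?thesis
      using True unfolding linear_Basis_expand[OF G(5)[OF xT]] linear_Basis_expand[OF Hh(5)[OF xT]] g(2)[OF xT] h(2)[OF xT]
      by simp
  next
    case False
    then have "F0' b x b = 0" for b by (simp add: F0'_def out)
    then show ?thesis using False by simp
  qed
  have "0 = (\<Sum>b\<in>Basis. \<integral>x. F0' b x b \<partial>lborel)" by (simp add: zero)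
  also have "\<dots> = (\<integral>x. (\<Sum>b\<in>Basis. F0' b x b) \<partial>lborel)"
    by (rule Bochner_Integration.integral_sum[symmetric]) (rule int)
  also have "\<dots> = 2 *\<^sub>R (\<integral>x. q (x \<bullet> x) *\<^sub>R (indicator (cball 0 1) x *\<^sub>R (h x * D x x - g x * E x x)) \<partial>lborel)"
    unfolding sum by (rule integral_scaleR_right)
  finally show "(\<integral>x. q (x \<bullet> x) *\<^sub>R (indicator (cball 0 1) x *\<^sub>R (h x * D x x - g x * E x x)) \<partial>lborel) = 0"
    by simp
qed

lemma twice_derivs_dilation:
  fixes g :: "real^'n \<Rightarrow> complex"
  assumes g: "twice_derivs g D H S" "\<And>x. x \<in> S \<Longrightarrow> (\<Sum>b\<in>Basis. H x b b) = 0"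
    and A: "open A" "\<And>x. x \<in> A \<Longrightarrow> c *\<^sub>R x \<in> S"
  shows "twice_derivs (\<lambda>x. g (c *\<^sub>R x)) (\<lambda>x v. D (c *\<^sub>R x) (c *\<^sub>R v))
           (\<lambda>x v w. D (c *\<^sub>R x) 0 + H (c *\<^sub>R x) (c *\<^sub>R v) (c *\<^sub>R w)) A"
    and "x \<in> A \<Longrightarrow> (\<Sum>b\<in>Basis. D (c *\<^sub>R x) 0 + H (c *\<^sub>R x) (c *\<^sub>R b) (c *\<^sub>R b)) = 0"
proof -
  note G = twice_derivsD[OF g(1)]
  have sc: "twice_derivs (\<lambda>x::real^'n. c *\<^sub>R x) (\<lambda>x v. c *\<^sub>R v) (\<lambda>_ _ _. 0) A"
    unfolding twice_derivs_def by (auto simp: linear_iff intro!: derivative_eq_intros)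
  show "twice_derivs (\<lambda>x. g (c *\<^sub>R x)) (\<lambda>x v. D (c *\<^sub>R x) (c *\<^sub>R v))
      (\<lambda>x v w. D (c *\<^sub>R x) 0 + H (c *\<^sub>R x) (c *\<^sub>R v) (c *\<^sub>R w)) A"
    by (rule twice_derivs_compose[OF g(1) sc _ A(1)]) (use A(2) in auto)
  show "(\<Sum>b\<in>Basis. D (c *\<^sub>R x) 0 + H (c *\<^sub>R x) (c *\<^sub>R b) (c *\<^sub>R b)) = 0" if "x \<in> A" for x
    using g(2)[OF A(2)[OF that]]
    unfolding linear_0[OF G(5)[OF A(2)[OF that]]] linear_cmul[OF G(6)[OF A(2)[OF that]]] linear_cmul[OF G(3)[OF A(2)[OF that]]]
    by (simp flip: scaleR_sum_right)
qed

text \<open>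
  The derivative of \<open>t \<mapsto> \<integral> g (t z) h (r z / t) d\<sigma>\<close> is \<open>1 / t\<close> times the expression in Green's
  identity for the harmonic functions \<open>z \<mapsto> g (t z)\<close> and \<open>z \<mapsto> h (r z / t)\<close>, so it vanishes.
\<close>
lemma Green_symmetry:
  fixes g h :: "real^'n \<Rightarrow> complex"
  assumes g: "harmonic_on g S" and h: "harmonic_on h T" and rt: "0 < r" "r \<le> t"
    and S: "\<And>x. norm x \<le> t \<Longrightarrow> x \<in> S" and T: "cball 0 1 \<subseteq> T"
  shows "(\<ointegral>z. g (t *\<^sub>R z) * h ((r / t) *\<^sub>R z)) = (\<ointegral>z. g (r *\<^sub>R z) * h z)"
proof -
  obtain D H where gD: "twice_derivs g D H S" "\<And>x. x \<in> S \<Longrightarrow> (\<Sum>b\<in>Basis. H x b b) = 0"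
    using harmonic_on_twice_derivs[OF g] by blast
  obtain E K where hE: "twice_derivs h E K T" "\<And>x. x \<in> T \<Longrightarrow> (\<Sum>b\<in>Basis. K x b b) = 0"
    using harmonic_on_twice_derivs[OF h] by blast
  note G = twice_derivsD[OF gD(1)] and Hh = twice_derivsD[OF hE(1)]
  define N where "N = restrict_space lborel {r..t}"
  have N: "finite_measure N" "(\<lambda>x. x) \<in> measurable N borel" "space N = {r..t}" "compact {r..t}"
    using rt unfolding N_def
    by (auto intro!: measurable_restrict_space1 finite_measureI simp: space_restrict_space emeasure_restrict_space)
  define k where "k u z = g (u *\<^sub>R z) * h ((r / u) *\<^sub>R z)" for u z
  define k' where "k' u z = g (u *\<^sub>R z) * ((- (r / u\<^sup>2)) *\<^sub>R E ((r / u) *\<^sub>R z) z) + D (u *\<^sub>R z) z * h ((r / u) *\<^sub>R z)" for u z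
  have inS: "u *\<^sub>R z \<in> S" if "u \<in> {r..t}" "norm z \<le> 1" for u z
    using that rt by (intro S) (auto intro: order_trans[OF mult_left_le])
  have inT: "(r / u) *\<^sub>R z \<in> T" if "u \<in> {r..t}" "norm z \<le> 1" for u z
  proof -
    have "r / u * norm z \<le> 1 * 1" using that rt by (intro mult_mono) auto
    then show ?thesis using that rt T by (intro subsetD[OF T]) auto
  qed
  have scale: "((\<lambda>u. u *\<^sub>R z) has_derivative (\<lambda>w. w *\<^sub>R z)) (at u within {r..t})" for u and z :: "real^'n"
    by (auto intro!: derivative_eq_intros)
  have deriv: "((\<lambda>u. k u z) has_vector_derivative k' u z) (at u within {r..t})" if u: "u \<in> {r..t}" and z: "norm z = 1" for u z
  proof -
    have dg: "((\<lambda>u. g (u *\<^sub>R z)) has_derivative (\<lambda>w. D (u *\<^sub>R z) (w *\<^sub>R z))) (at u within {r..t})"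
      by (rule has_derivative_compose[OF scale G(1)]) (use inS u z in auto)
    have "u \<noteq> 0" using u rt by auto
    then have dru: "((\<lambda>u. (r / u) *\<^sub>R z) has_derivative (\<lambda>w. (- (r / u\<^sup>2) * w) *\<^sub>R z)) (at u within {r..t})"
      by (auto intro!: derivative_eq_intros simp: power2_eq_square divide_simps)
    have dh: "((\<lambda>u. h ((r / u) *\<^sub>R z)) has_derivative (\<lambda>w. E ((r / u) *\<^sub>R z) ((- (r / u\<^sup>2) * w) *\<^sub>R z))) (at u within {r..t})"
      by (rule has_derivative_compose[OF dru Hh(1)]) (use inT u z in auto)
    have "linear (D (u *\<^sub>R z))" "linear (E ((r / u) *\<^sub>R z))" using G(5) Hh(5) inS inT u z by auto
    note lin = linear_cmul[OF this(1)] linear_cmul[OF this(2)]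
    show ?thesis
      using has_derivative_mult[OF dg dh] unfolding has_vector_derivative_def k_def k'_def lin
      by (simp add: algebra_simps scaleR_conv_of_real)
  qed
  have zero: "(\<ointegral>z. k' u z) = 0" if u: "u \<in> {r..t}" for u
  proof -
    have up: "u > 0" using u rt by auto
    define A where "A = {x. u *\<^sub>R x \<in> S \<and> (r / u) *\<^sub>R x \<in> T}"
    have AS: "{x. c *\<^sub>R x \<in> S} = (\<lambda>x. c *\<^sub>R x) -` S" "{x. c *\<^sub>R x \<in> T} = (\<lambda>x. c *\<^sub>R x) -` T" for c by auto
    have opA: "open A" unfolding A_def Collect_conj_eq AS
      using harmonic_on_open[OF g] harmonic_on_open[OF h]
      by (intro open_Int open_vimage continuous_intros)
    have subA: "cball 0 1 \<subseteq> A" unfolding A_def using inS[OF u] inT[OF u] by auto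
    have "u *\<^sub>R x \<in> S" "(r / u) *\<^sub>R x \<in> T" if "x \<in> A" for x using that by (simp_all add: A_def)
    note dil = twice_derivs_dilation[OF gD opA this(1)] twice_derivs_dilation[OF hE opA this(2)]
    have Gr: "(\<ointegral>z. h ((r/u) *\<^sub>R z) * D (u *\<^sub>R z) (u *\<^sub>R z) - g (u *\<^sub>R z) * E ((r/u) *\<^sub>R z) ((r/u) *\<^sub>R z)) = 0"
      by (rule Green_identity_sphere[OF opA subA dil])
    have "(\<ointegral>z. k' u z) =
      (\<ointegral>z. (1 / u) *\<^sub>R (h ((r/u) *\<^sub>R z) * D (u *\<^sub>R z) (u *\<^sub>R z) - g (u *\<^sub>R z) * E ((r/u) *\<^sub>R z) ((r/u) *\<^sub>R z)))"
    proof (rule integral_sphere_cong)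
      fix z :: "real^'n" assume z: "norm z = 1"
      have "linear (D (u *\<^sub>R z))" "linear (E ((r / u) *\<^sub>R z))" using G(5) Hh(5) inS inT u z by auto
      note lin = linear_cmul[OF this(1)] linear_cmul[OF this(2)]
      show "k' u z = (1 / u) *\<^sub>R (h ((r/u) *\<^sub>R z) * D (u *\<^sub>R z) (u *\<^sub>R z) - g (u *\<^sub>R z) * E ((r/u) *\<^sub>R z) ((r/u) *\<^sub>R z))"
        unfolding k'_def lin using up by (simp add: algebra_simps scaleR_diff_right power2_eq_square)
    qed
    then show ?thesis unfolding integral_scaleR_right Gr by simp
  qed
  have cDz: "continuous_on (sphere 0 1 \<times> {r..t}) (\<lambda>(z, u). D (u *\<^sub>R z) z)"
  proof -
    have "continuous_on (sphere 0 1 \<times> {r..t}) (\<lambda>p. \<Sum>b\<in>Basis. (fst p \<bullet> b) *\<^sub>R D (snd p *\<^sub>R fst p) b)"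
      by (intro continuous_intros continuous_on_compose2[OF G(7)]) (use inS in auto)
    then show ?thesis
      by (rule continuous_on_eq) (use inS in \<open>auto intro!: linear_Basis_expand[OF G(5)]\<close>)
  qed
  have cEz: "continuous_on (sphere 0 1 \<times> {r..t}) (\<lambda>(z, u). E ((r / u) *\<^sub>R z) z)"
  proof -
    have "continuous_on (sphere 0 1 \<times> {r..t}) (\<lambda>p. \<Sum>b\<in>Basis. (fst p \<bullet> b) *\<^sub>R E ((r / snd p) *\<^sub>R fst p) b)"
      by (intro continuous_intros continuous_on_compose2[OF Hh(7)]) (use inT rt in auto)
    then show ?thesis
      by (rule continuous_on_eq) (use inT in \<open>auto intro!: linear_Basis_expand[OF Hh(5)]\<close>)
  qed
  have cg: "continuous_on (sphere 0 1 \<times> {r..t}) (\<lambda>p. g (snd p *\<^sub>R fst p))"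
    by (intro continuous_on_compose2[OF G(8)] continuous_intros) (use inS in auto)
  have ch: "continuous_on (sphere 0 1 \<times> {r..t}) (\<lambda>p. h ((r / snd p) *\<^sub>R fst p))"
    by (intro continuous_on_compose2[OF Hh(8)] continuous_intros) (use inT rt in auto)
  have ck': "continuous_on (sphere 0 1 \<times> {r..t}) (\<lambda>(z, u). k' u z)"
    unfolding k'_def split_def
    by (intro continuous_intros cg ch cDz[unfolded split_def] cEz[unfolded split_def]) (use rt in auto)
  have FTC: "(\<integral>u. k' u z \<partial>N) = k t z - k r z" if z: "norm z = 1" for z
  proof -
    have "(\<integral>u. k' u z \<partial>N) = (\<integral>u. indicator {r..t} u *\<^sub>R k' u z \<partial>lborel)"
      unfolding N_def by (subst integral_restrict_space) auto
    also have "\<dots> = k t z - k r z"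
    proof (rule integral_FTC_atLeastAtMost[OF rt(2)])
      show "continuous_on {r..t} (\<lambda>u. k' u z)"
        using continuous_on_compose2[OF ck' continuous_on_Pair[OF continuous_on_const[of "{r..t}" z] continuous_on_id]] z
        by (simp add: image_subset_iff)
    qed (use deriv z in auto)
    finally show ?thesis .
  qed
  have ck: "continuous_on (sphere 0 1) (\<lambda>z. k u z)" if "u \<in> {r..t}" for u
    unfolding k_def
    by (intro continuous_intros continuous_on_compose2[OF G(8)] continuous_on_compose2[OF Hh(8)]) (use inS inT that in auto)
  have "(\<ointegral>z. k t z) - (\<ointegral>z. k r z) = (\<ointegral>z. k t z - k r z)"
    using rt by (intro Bochner_Integration.integral_diff[symmetric] integrable_sphere_continuous ck) auto
  also have "\<dots> = (\<ointegral>z. (\<integral>u. k' u z \<partial>N))"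
    by (rule integral_sphere_cong) (simp add: FTC)
  also have "\<dots> = (\<integral>u. (\<ointegral>z. k' u z) \<partial>N)"
    by (rule Fubini_continuous_compact(1)[OF _ _ space_sphere_measure _ N ck'])
       (auto intro: id_measurable_sphere_measure sphere_measure.finite_measure_axioms)
  also have "\<dots> = (\<integral>u. 0 \<partial>N)"
    by (rule Bochner_Integration.integral_cong) (use N(3) zero in auto)
  finally show ?thesis using rt unfolding k_def by simp
qed

section \<open>The Poisson kernel and the Poisson formula\<close>

definition poisson_kernel :: "real^'n \<Rightarrow> real^'n \<Rightarrow> real" where
  "poisson_kernel x z = (1 - x \<bullet> x) / norm (x - z) ^ CARD('n)"

lemma square_powr_half: "s > 0 \<Longrightarrow> (s * s) powr ((2 - real n) / 2) = s\<^sup>2 / s ^ n"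
proof -
  assume s: "s > 0"
  have "s * s = s powr 2" using s by (simp add: powr_numeral power2_eq_square)
  then have "(s * s) powr ((2 - real n) / 2) = s powr (2 * ((2 - real n) / 2))" by (simp only: powr_powr)
  also have "2 * ((2 - real n) / 2) = 2 - real n" by simp
  also have "s powr (2 - real n) = s powr 2 / s powr (real n)" by (rule powr_diff)
  also have "\<dots> = s\<^sup>2 / s ^ n" using s by (simp add: powr_realpow powr_numeral)
  finally show ?thesis .
qed

lemma poisson_kernel_nonneg: "norm x \<le> 1 \<Longrightarrow> 0 \<le> poisson_kernel x z"
  unfolding poisson_kernel_def by (simp add: dot_square_norm power_le_one)

lemma poisson_kernel_0: "norm z = 1 \<Longrightarrow> poisson_kernel 0 z = 1"
  unfolding poisson_kernel_def by simp

text \<open>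
  Both squares equal \<open>t\<^sup>2 - 2 t (y \<bullet> z) + 1\<close>. The resulting symmetry of the Poisson kernel lets it
  be read as a harmonic function of either variable.
\<close>
lemma norm_scaled_diff_sphere_commute:
  fixes y z :: "real^'n"
  assumes "norm z = 1" "norm y = 1"
  shows "norm (t *\<^sub>R z - y) = norm (t *\<^sub>R y - z)"
proof -
  have "(norm (t *\<^sub>R z - y))\<^sup>2 = (norm (t *\<^sub>R y - z))\<^sup>2"
    using assms unfolding power2_norm_eq_inner norm_eq_1
    by (simp add: inner_diff_left inner_diff_right inner_commute)
  then show ?thesis by (metis norm_ge_zero power2_eq_imp_eq)
qed

lemma poisson_kernel_commute:
  "norm z = 1 \<Longrightarrow> norm y = 1 \<Longrightarrow> poisson_kernel (t *\<^sub>R z) y = poisson_kernel (t *\<^sub>R y) z"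
  unfolding poisson_kernel_def by (simp add: norm_scaled_diff_sphere_commute dot_square_norm)

text \<open>
  With \<open>y = x - z\<close> one has \<open>1 - \<bar>x\<bar>\<^sup>2 = - \<bar>y\<bar>\<^sup>2 - 2 y \<bullet> z\<close>, so the kernel is the Kelvin transform, centered at
  \<open>z\<close>, of the affine function \<open>- 1 - 2 w \<bullet> z\<close>.
\<close>
lemma harmonic_on_poisson_kernel:
  fixes z :: "real^'n"
  assumes z: "norm z = 1"
  shows "harmonic_on (\<lambda>x. complex_of_real (poisson_kernel x z)) (- {z})"
proof -
  have lin: "linear (\<lambda>w::real^'n. complex_of_real (- 2 * (w \<bullet> z)))"
    by (rule linearI) (simp_all add: inner_add_left distrib_left, simp add: scaleR_conv_of_real)
  have "harmonic_on (\<lambda>w::real^'n. - 1 + complex_of_real (- 2 * (w \<bullet> z))) UNIV"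
    by (intro harmonic_on_add harmonic_on_const harmonic_on_linear[OF _ lin]) auto
  from harmonic_on_affine[OF harmonic_on_Kelvin[OF this] orthogonal_transformation_id, of "- z" 1]
  show ?thesis
  proof (rule harmonic_on_cong[OF harmonic_on_subset])
    fix x assume x: "x \<in> - {z}"
    define y where "y = x - z"
    have y: "norm y > 0" using x by (simp add: y_def)
    have "x = y + z" by (simp add: y_def)
    then have xx: "1 - x \<bullet> x = - (norm y)\<^sup>2 - 2 * (y \<bullet> z)"
      using z unfolding power2_norm_eq_inner norm_eq_1
      by (simp add: inner_add_left inner_add_right inner_commute)
    have "(y \<bullet> y) powr ((2 - real CARD('n)) / 2) * (- 1 + - 2 * (inversion y \<bullet> z)) = poisson_kernel x z"
    proof -
      have yy: "y \<bullet> y = norm y * norm y" by (simp add: dot_square_norm power2_eq_square)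
      have "(y \<bullet> y) powr ((2 - real CARD('n)) / 2) = (norm y)\<^sup>2 / norm y ^ CARD('n)"
        unfolding yy using y by (rule square_powr_half)
      moreover have "(norm y)\<^sup>2 * (- 1 + - 2 * (inversion y \<bullet> z)) = 1 - x \<bullet> x"
        unfolding xx inversion_def yy using y by (simp add: field_simps power2_eq_square)
      ultimately show ?thesis unfolding poisson_kernel_def y_def by (simp add: field_simps)
    qed
    from arg_cong[OF this, of complex_of_real]
    show "((- z + 1 *\<^sub>R x) \<bullet> (- z + 1 *\<^sub>R x)) powr ((2 - real CARD('n)) / 2) *\<^sub>R
         (- 1 + complex_of_real (- 2 * (inversion (- z + 1 *\<^sub>R x) \<bullet> z))) = complex_of_real (poisson_kernel x z)"
      by (simp add: y_def scaleR_conv_of_real)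
  qed auto
qed

lemma continuous_on_poisson_kernel:
  assumes "continuous_on A f" "continuous_on A g" "\<And>a. a \<in> A \<Longrightarrow> f a \<noteq> g a"
  shows "continuous_on A (\<lambda>a. poisson_kernel (f a) (g a))"
  unfolding poisson_kernel_def using assms by (intro continuous_intros) auto

lemma norm_integral_sphere_diff_le:
  fixes F :: "real^'n \<Rightarrow> 'c::{banach, second_countable_topology}"
  assumes "continuous_on (sphere 0 1) F" "\<And>z. norm z = 1 \<Longrightarrow> norm (F z - a) \<le> c"
  shows "norm ((\<ointegral>z. F z) - a) \<le> c"
proof -
  have "(\<ointegral>z. F z) - a = (\<ointegral>z. F z - a)"
    using assms(1) by (subst Bochner_Integration.integral_diff)
       (auto intro!: integrable_sphere_continuous simp: measure_sphere_measure_space)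
  then show ?thesis using assms by (auto intro!: norm_integral_sphere_le continuous_intros)
qed

text \<open>
  Green's symmetry with \<open>g = 1\<close> says that all spherical means agree; they tend to \<open>h 0\<close> for small
  radii.
\<close>
theorem harmonic_mean_value:
  fixes h :: "real^'n \<Rightarrow> complex"
  assumes h: "harmonic_on h T" "cball 0 1 \<subseteq> T"
  shows "(\<ointegral>z. h z) = h 0"
proof -
  have cont: "continuous_on T h" using h(1) by (rule harmonic_on_continuous_on)
  have "norm ((\<ointegral>z. h z) - h 0) \<le> e" if "e > 0" for e
  proof -
    have "0 \<in> T" using h(2) by auto
    then have "continuous (at 0 within T) h" using cont by (simp add: continuous_on_eq_continuous_within)
    then have "\<exists>d>0. \<forall>x\<in>T. dist x 0 < d \<longrightarrow> dist (h x) (h 0) < e"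
      unfolding continuous_within_eps_delta using that by (elim allE[of _ e]) simp
    then obtain d where "d > 0" "\<forall>x\<in>T. dist x 0 < d \<longrightarrow> dist (h x) (h 0) < e" by (elim exE conjE)
    then have d: "d > 0" "\<And>x. x \<in> T \<Longrightarrow> dist x 0 < d \<Longrightarrow> dist (h x) (h 0) < e" by simp_all
    define r where "r = min 1 (d / 2)"
    have r: "0 < r" "r \<le> 1" "r < d" using d(1) unfolding r_def by linarith+
    have inT: "r *\<^sub>R z \<in> T" if "norm z = 1" for z using h(2) that r by (intro subsetD[OF h(2)]) auto
    have "(\<ointegral>z. h z) = (\<ointegral>z. h (r *\<^sub>R z))"
      using Green_symmetry[OF harmonic_on_const[OF open_UNIV, of 1] h(1) r(1,2) UNIV_I h(2)] by simp
    also have "norm (\<dots> - h 0) \<le> e"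
    proof (rule norm_integral_sphere_diff_le)
      show "continuous_on (sphere 0 1) (\<lambda>z. h (r *\<^sub>R z))"
        by (rule continuous_on_compose2[OF cont]) (use inT in \<open>auto intro!: continuous_intros\<close>)
      fix z :: "real^'n" assume "norm z = 1"
      then show "norm (h (r *\<^sub>R z) - h 0) \<le> e"
        using d(2)[OF inT, of z] r by (simp add: dist_norm)
    qed
    finally show ?thesis .
  qed
  then have "norm ((\<ointegral>z. h z) - h 0) \<le> 0" by (meson dense_ge)
  then show ?thesis by simp
qed

lemma continuous_on_poisson_kernel_sphere:
  assumes "norm x < 1"
  shows "continuous_on (sphere 0 1) (\<lambda>z. poisson_kernel x z)"
  using assms by (intro continuous_on_poisson_kernel continuous_intros) auto

lemma ball_0_1_cases:
  fixes x :: "real^'n"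
  assumes "norm x < 1"
  obtains t y where "x = t *\<^sub>R y" "0 \<le> t" "t < 1" "norm y = 1" "t = norm x"
proof (cases "x = 0")
  case True
  obtain y :: "real^'n" where "norm y = 1" using vector_choose_size[of 1] by auto
  then show ?thesis using True that[of 0 y] by simp
next
  case False
  then show ?thesis using assms that[of "norm x" "sgn x"] by (simp add: norm_sgn sgn_div_norm)
qed

text \<open>
  By symmetry this is the mean of \<open>z \<mapsto> poisson_kernel (t z) y\<close>, which is harmonic and equals 1 at 0.
\<close>
lemma integral_poisson_kernel:
  fixes x :: "real^'n"
  assumes "norm x < 1"
  shows "(\<ointegral>z. poisson_kernel x z) = 1"
proof -
  obtain t y where ty: "x = t *\<^sub>R y" "0 \<le> t" "t < 1" "norm y = 1"
    using assms by (rule ball_0_1_cases)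
  have "harmonic_on (\<lambda>z. complex_of_real (poisson_kernel (0 + t *\<^sub>R z) y)) ((\<lambda>z. 0 + t *\<^sub>R z) -` (- {y}))"
    by (rule harmonic_on_affine[OF harmonic_on_poisson_kernel[OF ty(4)] orthogonal_transformation_id])
  moreover have "t *\<^sub>R z \<noteq> y" if "norm z \<le> 1" for z
  proof
    assume "t *\<^sub>R z = y"
    then have "t * norm z = 1" using ty by auto
    moreover have "t * norm z \<le> t * 1" using that ty by (intro mult_left_mono) auto
    ultimately show False using ty by simp
  qed
  ultimately have "(\<ointegral>z. complex_of_real (poisson_kernel (t *\<^sub>R z) y)) = complex_of_real (poisson_kernel (t *\<^sub>R 0) y)"
    by (intro harmonic_mean_value) auto
  then have "(\<ointegral>z. poisson_kernel (t *\<^sub>R z) y) = 1"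
    using ty by (simp add: poisson_kernel_0)
  moreover have "(\<ointegral>z. poisson_kernel (t *\<^sub>R z) y) = (\<ointegral>z. poisson_kernel x z)"
    unfolding ty(1) by (rule integral_sphere_cong) (simp add: poisson_kernel_commute ty)
  ultimately show ?thesis by simp
qed

lemma poisson_kernel_away:
  fixes y z :: "real^'n"
  assumes "norm y = 1" "norm z = 1" "0 \<le> t" "t \<le> 1" "d > 0" "d \<le> norm (z - y)" "1 - t \<le> d / 2"
  shows "poisson_kernel (t *\<^sub>R y) z \<le> 2 * (1 - t) / (d / 2) ^ CARD('n)"
proof -
  have "norm (z - y) \<le> norm (z - t *\<^sub>R y) + norm (t *\<^sub>R y - y)"
    using norm_triangle_ineq[of "z - t *\<^sub>R y" "t *\<^sub>R y - y"] by simp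
  also have "norm (t *\<^sub>R y - y) = 1 - t"
  proof -
    have "t *\<^sub>R y - y = (t - 1) *\<^sub>R y" by (simp add: scaleR_diff_left)
    then show ?thesis using assms by simp
  qed
  finally have "d / 2 \<le> norm (t *\<^sub>R y - z)" using assms by (simp add: norm_minus_commute)
  then have p: "(d / 2) ^ CARD('n) \<le> norm (t *\<^sub>R y - z) ^ CARD('n)" using assms by (intro power_mono) auto
  have "1 - (t *\<^sub>R y) \<bullet> (t *\<^sub>R y) = (1 + t) * (1 - t)"
    using assms by (simp add: dot_square_norm power2_eq_square algebra_simps)
  also have "\<dots> \<le> 2 * (1 - t)" using assms by (intro mult_right_mono) auto
  finally show ?thesis
    unfolding poisson_kernel_def using p assms by (intro frac_le) auto
qed

text \<open>
  The kernel has integral 1 and is small away from \<open>y\<close>. The explicit bound is needed because the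
  same \<open>t\<close> has to serve for all \<open>y\<close>, or for a function \<open>F\<close> that itself depends on \<open>t\<close>.
\<close>
lemma poisson_integral_approx:
  fixes F :: "real^'n \<Rightarrow> 'c::{banach, second_countable_topology}"
  assumes F: "continuous_on (sphere 0 1) F" and y: "norm y = 1" and t: "0 \<le> t" "t < 1" "1 - t \<le> d / 2"
    and d: "d > 0" and e: "e \<ge> 0"
    and close: "\<And>z. norm z = 1 \<Longrightarrow> norm (z - y) < d \<Longrightarrow> norm (F z - F y) \<le> e"
    and B: "\<And>z. norm z = 1 \<Longrightarrow> norm (F z) \<le> B"
  shows "norm ((\<ointegral>z. poisson_kernel (t *\<^sub>R y) z *\<^sub>R F z) - F y)
           \<le> e + 2 * B * (2 * (1 - t) / (d / 2) ^ CARD('n))"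
proof -
  let ?k = "poisson_kernel (t *\<^sub>R y)" and ?c = "2 * (1 - t) / (d / 2) ^ CARD('n)"
  have nt: "norm (t *\<^sub>R y) < 1" using y t by simp
  note ck = continuous_on_poisson_kernel_sphere[OF nt]
  have c0: "?c \<ge> 0" using t d by simp
  have B0: "B \<ge> 0" using B[OF y] norm_ge_zero order_trans by blast
  have "(\<ointegral>z. ?k z *\<^sub>R F z) - F y = (\<ointegral>z. ?k z *\<^sub>R F z) - (\<ointegral>z. ?k z *\<^sub>R F y)"
    using integral_poisson_kernel[OF nt] integrable_sphere_continuous[OF ck] by simp
  also have "\<dots> = (\<ointegral>z. ?k z *\<^sub>R (F z - F y))"
    unfolding scaleR_diff_right
    by (rule Bochner_Integration.integral_diff[symmetric]) (intro integrable_sphere_continuous continuous_intros ck F)+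
  also have "norm \<dots> \<le> (\<ointegral>z. norm (?k z *\<^sub>R (F z - F y)))"
    by (rule integral_norm_bound)
  also have "\<dots> \<le> (\<ointegral>z. ?k z * e + 2 * B * ?c)"
  proof (rule integral_sphere_mono)
    show "continuous_on (sphere 0 1) (\<lambda>z. norm (?k z *\<^sub>R (F z - F y)))" by (intro continuous_intros ck F)
    show "continuous_on (sphere 0 1) (\<lambda>z. ?k z * e + 2 * B * ?c)" by (intro continuous_intros ck)
    fix z :: "real^'n" assume z: "norm z = 1"
    have k0: "?k z \<ge> 0" using nt by (intro poisson_kernel_nonneg) auto
    show "norm (?k z *\<^sub>R (F z - F y)) \<le> ?k z * e + 2 * B * ?c"
    proof (cases "norm (z - y) < d")
      case True
      then have "?k z * norm (F z - F y) \<le> ?k z * e" using close z k0 by (intro mult_left_mono) auto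
      moreover have "2 * B * ?c \<ge> 0" using c0 B0 by (intro mult_nonneg_nonneg) auto
      ultimately show ?thesis using k0 by simp
    next
      case False
      then have "?k z \<le> ?c" using y z t d by (intro poisson_kernel_away) auto
      moreover have "norm (F z - F y) \<le> 2 * B" using norm_triangle_ineq4[of "F z" "F y"] B[OF z] B[OF y] by linarith
      ultimately have "?k z * norm (F z - F y) \<le> ?c * (2 * B)" using k0 c0 by (intro mult_mono) auto
      moreover have "?k z * e \<ge> 0" using k0 e by simp
      ultimately show ?thesis using k0 by (simp add: mult.commute)
    qed
  qed
  also have "\<dots> = e + 2 * B * ?c"
    using integral_poisson_kernel[OF nt] integrable_sphere_continuous[OF ck]
    by (simp add: measure_sphere_measure_space)
  finally show ?thesis .
qed

lemma eventually_poisson_error: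
  assumes "d > 0" "e > (0::real)"
  shows "eventually (\<lambda>t. 2 * B * (2 * (1 - t) / (d / 2) ^ n) < e \<and> 1 - t \<le> d / 2 \<and> 0 < t \<and> t < 1) (at_left (1::real))"
proof -
  have "((\<lambda>t. 2 * B * (2 * (1 - t) / (d / 2) ^ n)) \<longlongrightarrow> 2 * B * (2 * (1 - 1) / (d / 2) ^ n)) (at_left (1::real))"
    using assms by (intro tendsto_intros) auto
  then have "eventually (\<lambda>t. 2 * B * (2 * (1 - t) / (d / 2) ^ n) < e) (at_left (1::real))"
    using assms by (intro order_tendstoD(2)) auto
  moreover have "eventually (\<lambda>t. t \<in> {max 0 (1 - d/2)<..<1}) (at_left (1::real))"
    using assms by (intro eventually_at_left_real) auto
  ultimately show ?thesis by eventually_elim auto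
qed

text \<open>
  Write \<open>x = r y\<close>. Green's symmetry, applied to the kernel with pole \<open>y\<close> and to \<open>h\<close>, turns the Poisson
  integral at \<open>r y\<close> into the Poisson integral at \<open>t y\<close> of \<open>z \<mapsto> h (r z / t)\<close>. As \<open>t\<close> tends to 1 the kernel
  concentrates at \<open>y\<close> and the value tends to \<open>h (r y)\<close>.
\<close>
theorem Poisson_formula:
  fixes h :: "real^'n \<Rightarrow> complex"
  assumes h: "harmonic_on h T" "cball 0 1 \<subseteq> T" and x: "norm x < 1"
  shows "(\<ointegral>z. poisson_kernel x z *\<^sub>R h z) = h x"
proof (cases "x = 0")
  case True
  have "(\<ointegral>z. poisson_kernel x z *\<^sub>R h z) = (\<ointegral>z. h z)"
    by (rule integral_sphere_cong) (simp add: True poisson_kernel_0)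
  then show ?thesis using harmonic_mean_value[OF h] True by simp
next
  case False
  obtain r y where ry: "x = r *\<^sub>R y" "0 \<le> r" "r < 1" "norm y = 1"
    using x by (rule ball_0_1_cases)
  have r0: "r > 0" using ry False by (cases "r = 0") auto
  have cT: "continuous_on T h" using h(1) by (rule harmonic_on_continuous_on)
  then have cont: "continuous_on (cball 0 1) h" using h(2) by (rule continuous_on_subset)
  then have "compact (h ` cball 0 1)" by (intro compact_continuous_image) auto
  then obtain B where B: "\<And>x. x \<in> cball 0 1 \<Longrightarrow> norm (h x) \<le> B" "B > 0"
    by (metis compact_imp_bounded bounded_pos image_eqI)
  let ?I = "\<integral>z. poisson_kernel x z *\<^sub>R h z \<partial>sphere_measure"
  have "norm (?I - h x) \<le> e" if e: "e > 0" for e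
  proof -
    have "uniformly_continuous_on (cball 0 1) h" using cont by (intro compact_uniformly_continuous) auto
    then obtain d where d: "d > 0" "\<And>x y. x \<in> cball 0 1 \<Longrightarrow> y \<in> cball 0 1 \<Longrightarrow> dist x y < d \<Longrightarrow> dist (h x) (h y) < e/3"
      unfolding uniformly_continuous_on_def using e by (metis divide_pos_pos zero_less_numeral)
    have "((\<lambda>t. r / t) \<longlongrightarrow> r / 1) (at_left 1)" by (intro tendsto_intros) auto
    then have "eventually (\<lambda>t. dist (r / t) r < d) (at_left 1)"
      using d(1) by (auto dest: tendstoD)
    moreover have "eventually (\<lambda>t. t \<in> {r<..<1}) (at_left 1)"
      using ry by (intro eventually_at_left_real) auto
    moreover have "eventually (\<lambda>t. 2 * B * (2 * (1 - t) / (d / 2) ^ CARD('n)) < e/3 \<and> 1 - t \<le> d / 2 \<and> 0 < t \<and> t < 1) (at_left (1::real))"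
      using d e by (intro eventually_poisson_error) auto
    ultimately have "eventually (\<lambda>t. dist (r / t) r < d \<and> t \<in> {r<..<1} \<and> 2 * B * (2 * (1 - t) / (d / 2) ^ CARD('n)) < e/3 \<and> 1 - t \<le> d / 2) (at_left (1::real))"
      by eventually_elim auto
    then obtain t where t: "dist (r / t) r < d" "r < t" "t < 1" "2 * B * (2 * (1 - t) / (d / 2) ^ CARD('n)) < e/3" "1 - t \<le> d / 2"
      using eventually_happens'[OF trivial_limit_at_left_real] by (metis (no_types, lifting) greaterThanLessThan_iff)
    have rt: "0 < r / t" "r / t < 1" using r0 t by auto
    let ?F = "\<lambda>z. h ((r / t) *\<^sub>R z)"
    have inb: "(r / t) *\<^sub>R z \<in> cball 0 1" if "norm z \<le> 1" for z :: "real^'n"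
    proof -
      have "r / t * norm z \<le> 1 * 1" using that rt by (intro mult_mono) auto
      then show ?thesis using rt by (simp only: mem_cball_0 norm_scaleR abs_of_pos)
    qed
    have cF: "continuous_on (sphere 0 1) ?F"
      by (intro continuous_on_compose2[OF cont] continuous_intros image_subsetI inb) simp
    have "(\<ointegral>z. complex_of_real (poisson_kernel (t *\<^sub>R z) y) * ?F z) =
          (\<ointegral>z. complex_of_real (poisson_kernel (r *\<^sub>R z) y) * h z)"
      using t by (intro Green_symmetry[OF harmonic_on_poisson_kernel[OF ry(4)] h(1) r0 _ _ h(2)]) (auto simp: ry(4))
    also have "\<dots> = ?I"
      unfolding ry(1) by (rule integral_sphere_cong) (simp add: poisson_kernel_commute ry scaleR_conv_of_real[where 'a = complex])
    also have "(\<ointegral>z. complex_of_real (poisson_kernel (t *\<^sub>R z) y) * ?F z) =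
       (\<ointegral>z. poisson_kernel (t *\<^sub>R y) z *\<^sub>R ?F z)"
      by (rule integral_sphere_cong) (simp add: poisson_kernel_commute ry scaleR_conv_of_real[where 'a = complex])
    finally have I: "?I = (\<ointegral>z. poisson_kernel (t *\<^sub>R y) z *\<^sub>R ?F z)" by simp
    have "norm (?I - ?F y) \<le> e/3 + 2 * B * (2 * (1 - t) / (d / 2) ^ CARD('n))"
      unfolding I
    proof (rule poisson_integral_approx[OF cF ry(4)])
      fix z :: "real^'n" assume z: "norm z = 1"
      show "norm (?F z) \<le> B" using B inb[of z] z by simp
      assume "norm (z - y) < d"
      have "dist ((r / t) *\<^sub>R z) ((r / t) *\<^sub>R y) = r / t * norm (z - y)"
        using r0 t by (simp add: dist_norm flip: scaleR_diff_right)
      also have "\<dots> \<le> 1 * norm (z - y)" using rt by (intro mult_right_mono) auto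
      finally have "dist ((r / t) *\<^sub>R z) ((r / t) *\<^sub>R y) < d" using \<open>norm (z - y) < d\<close> by simp
      then have "dist (?F z) (?F y) < e/3" by (intro d inb) (simp_all add: z ry)
      then show "norm (?F z - ?F y) \<le> e/3" by (simp add: dist_norm)
    qed (use t r0 d e in auto)
    moreover have "norm (?F y - h x) \<le> e/3"
    proof -
      have "dist ((r / t) *\<^sub>R y) x = \<bar>r / t - r\<bar>" unfolding ry(1) dist_norm using ry(4) by (simp flip: scaleR_diff_left)
      then have "dist ((r / t) *\<^sub>R y) x < d" using t(1) by (simp add: dist_real_def)
      then have "dist (?F y) (h x) < e/3" by (intro d inb) (use ry(4) x in simp_all)
      then show ?thesis by (simp add: dist_norm)
    qed
    ultimately show ?thesis
      using norm_triangle_ineq[of "?I - ?F y" "?F y - h x"] t(4) by simp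
  qed
  then have "norm (?I - h x) \<le> 0" by (meson dense_ge)
  then show ?thesis by simp
qed

lemma poisson_integral_uniform_approx:
  fixes F :: "real^'n \<Rightarrow> 'c::{banach, second_countable_topology}"
  assumes F: "continuous_on (sphere 0 1) F" and e: "e > 0"
  obtains t where "0 < t" "t < 1"
    "\<And>y. norm y = 1 \<Longrightarrow> norm ((\<ointegral>z. poisson_kernel (t *\<^sub>R y) z *\<^sub>R F z) - F y) \<le> e"
proof -
  have "compact (F ` sphere 0 1)" using F by (intro compact_continuous_image) auto
  then obtain B where B: "\<And>x. x \<in> sphere 0 1 \<Longrightarrow> norm (F x) \<le> B" "B > 0"
    by (metis compact_imp_bounded bounded_pos image_eqI)
  have "uniformly_continuous_on (sphere 0 1) F" using F by (intro compact_uniformly_continuous) auto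
  then obtain d where d: "d > 0" "\<And>x y. x \<in> sphere 0 1 \<Longrightarrow> y \<in> sphere 0 1 \<Longrightarrow> dist x y < d \<Longrightarrow> dist (F x) (F y) < e/2"
    unfolding uniformly_continuous_on_def using e by (metis half_gt_zero)
  have "eventually (\<lambda>t. 2 * B * (2 * (1 - t) / (d / 2) ^ CARD('n)) < e/2 \<and> 1 - t \<le> d / 2 \<and> 0 < t \<and> t < 1) (at_left (1::real))"
    using d e by (intro eventually_poisson_error) auto
  then obtain t where t: "2 * B * (2 * (1 - t) / (d / 2) ^ CARD('n)) < e/2" "1 - t \<le> d / 2" "0 < t" "t < 1"
    using eventually_happens'[OF trivial_limit_at_left_real] by (metis (no_types, lifting))
  show ?thesis
  proof (rule that[OF t(3,4)])
    fix y :: "real^'n" assume y: "norm y = 1"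
    have "norm ((\<ointegral>z. poisson_kernel (t *\<^sub>R y) z *\<^sub>R F z) - F y)
        \<le> e/2 + 2 * B * (2 * (1 - t) / (d / 2) ^ CARD('n))"
      by (rule poisson_integral_approx[OF F y])
         (use t d e B y in \<open>auto simp: dist_norm intro: less_imp_le\<close>)
    then show "norm ((\<ointegral>z. poisson_kernel (t *\<^sub>R y) z *\<^sub>R F z) - F y) \<le> e" using t(1) by simp
  qed
qed

section \<open>Integral means of harmonic functions\<close>

text \<open>
  The tangent to the convex function \<open>u powr p\<close> at \<open>m\<close>, including the cases at the boundary point 0.
\<close>
lemma powr_above_tangent:
  fixes x m p :: real
  assumes "x \<ge> 0" "m \<ge> 0" "p \<ge> 1"
  shows "m powr p + p * m powr (p - 1) * (x - m) \<le> x powr p"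
proof (cases "m = 0 \<or> x = 0")
  case True
  then show ?thesis
  proof
    assume "m = 0" then show ?thesis using assms by simp
  next
    assume "x = 0"
    moreover have "m powr p \<le> p * (m powr (p - 1) * m)"
    proof (cases "m = 0")
      case False
      then have "m powr (p - 1) * m = m powr p" using assms by (simp add: powr_diff)
      then show ?thesis using assms mult_right_mono[of 1 p "m powr p"] by simp
    qed (use assms in auto)
    ultimately show ?thesis using assms by (simp add: algebra_simps)
  qed
next
  case False
  then have pos: "m > 0" "x > 0" using assms by auto
  have "1 + p * (x / m - 1) \<le> (x / m) powr p"
  proof -
    have cvx: "convex_on {0<..} (\<lambda>u::real. u powr p)" using assms(3) by (rule powr_convex)
    have "(x / m) powr p - 1 powr p \<ge> p * (1::real) powr (p - 1) * (x / m - 1)"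
      by (rule convex_on_imp_above_tangent[OF cvx])
         (use pos in \<open>auto intro!: has_field_derivative_at_within has_real_derivative_powr[of 1 p, simplified] simp: connected_Ioi interior_open\<close>)
    then show ?thesis by simp
  qed
  then have "m powr p * (1 + p * (x / m - 1)) \<le> m powr p * (x / m) powr p"
    by (intro mult_left_mono) auto
  also have "m powr p * (x / m) powr p = x powr p" using pos by (simp add: powr_divide)
  also have "m powr p * (1 + p * (x / m - 1)) = m powr p + p * (m powr p / m) * (x - m)"
    using pos by (simp add: field_simps)
  also have "m powr p / m = m powr (p - 1)" using pos by (simp add: powr_diff)
  finally show ?thesis .
qed

text \<open>
  Jensen's inequality: integrate the tangent inequality at the mean value \<open>m\<close>.
\<close>
lemma integral_powr_ge:
  fixes u w :: "real^'n \<Rightarrow> real"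
  assumes u: "continuous_on (sphere 0 1) u" "\<And>z. norm z = 1 \<Longrightarrow> u z \<ge> 0"
    and w: "continuous_on (sphere 0 1) w" "\<And>z. norm z = 1 \<Longrightarrow> w z \<ge> 0" "(\<ointegral>z. w z) = 1"
    and p: "p \<ge> 1"
  shows "(\<ointegral>z. w z * u z) powr p \<le> (\<ointegral>z. w z * u z powr p)"
proof -
  define m where "m = (\<ointegral>z. w z * u z)"
  have m: "m \<ge> 0" unfolding m_def
    by (rule integral_nonneg_AE) (use u(2) w(2) in \<open>auto simp: space_sphere_measure intro!: AE_I2\<close>)
  have cp: "continuous_on (sphere 0 1) (\<lambda>z. u z powr p)"
    using u p by (intro continuous_on_powr' continuous_on_const) auto
  have "m powr p = (m powr p - p * m powr (p - 1) * m) * (\<ointegral>z. w z) + p * m powr (p - 1) * (\<ointegral>z. w z * u z)"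
    using w(3) by (simp add: m_def)
  also have "\<dots> = (\<ointegral>z. (m powr p - p * m powr (p - 1) * m) * w z + p * m powr (p - 1) * (w z * u z))"
    by (subst Bochner_Integration.integral_add)
       (auto intro!: integrable_sphere_continuous continuous_intros u w)
  also have "\<dots> \<le> (\<ointegral>z. w z * u z powr p)"
  proof (rule integral_sphere_mono)
    fix z :: "real^'n" assume z: "norm z = 1"
    have "w z * (m powr p + p * m powr (p - 1) * (u z - m)) \<le> w z * u z powr p"
      using u(2)[OF z] w(2)[OF z] m p by (intro mult_left_mono powr_above_tangent)
    then show "(m powr p - p * m powr (p - 1) * m) * w z + p * m powr (p - 1) * (w z * u z) \<le> w z * u z powr p"
      by (simp add: algebra_simps)
  qed (intro continuous_intros u w cp)+
  finally show ?thesis by (simp add: m_def)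
qed

lemma continuous_on_norm_powr:
  fixes f :: "'a::topological_space \<Rightarrow> 'b::real_normed_vector"
  assumes "continuous_on A f" "p \<ge> (1::real)"
  shows "continuous_on A (\<lambda>x. norm (f x) powr p)"
  using assms by (intro continuous_on_powr' continuous_on_norm continuous_on_const) auto

text \<open>
  Jensen's inequality in the Poisson formula bounds \<open>\<bar>g (r y)\<bar> powr p\<close> by the Poisson integral of
  \<open>\<bar>g\<bar> powr p\<close>; integrating over \<open>y\<close> and using the symmetry of the kernel, the kernel integrates to 1.
\<close>
theorem harmonic_integral_mean_mono:
  fixes g :: "real^'n \<Rightarrow> complex"
  assumes g: "harmonic_on g T" "cball 0 1 \<subseteq> T" and r: "0 \<le> r" "r < 1" and p: "p \<ge> 1"
  shows "(\<ointegral>y. norm (g (r *\<^sub>R y)) powr p) \<le> (\<ointegral>z. norm (g z) powr p)"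
proof -
  have cT: "continuous_on T g" using g(1) by (rule harmonic_on_continuous_on)
  have cS: "continuous_on (sphere 0 1) g" by (rule continuous_on_subset[OF cT]) (use g(2) in auto)
  have inT: "r *\<^sub>R y \<in> T" if "norm y = 1" for y using that r by (intro subsetD[OF g(2)]) auto
  have cr: "continuous_on (sphere 0 1) (\<lambda>y. g (r *\<^sub>R y))"
    by (intro continuous_on_compose2[OF cT] continuous_intros image_subsetI inT) auto
  have ck: "continuous_on (sphere 0 1 \<times> sphere 0 1) (\<lambda>(y, z). poisson_kernel (r *\<^sub>R y) z * norm (g z) powr p)"
  proof -
    have ne: "r *\<^sub>R y \<noteq> z" if "norm y = 1" "norm z = 1" for y z :: "real^'n"
    proof
      assume "r *\<^sub>R y = z"
      then have "norm (r *\<^sub>R y) = 1" using that by simp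
      then show False using that r by simp
    qed
    have cg: "continuous_on (sphere 0 1 \<times> sphere 0 1) (\<lambda>q. norm (g (snd q)) powr p)"
      by (rule continuous_on_compose2[OF continuous_on_norm_powr[OF cS p]]) (auto intro!: continuous_intros)
    show ?thesis
      unfolding split_def
      by (intro continuous_on_mult cg continuous_on_poisson_kernel continuous_intros) (use ne in auto)
  qed
  have nr: "norm (r *\<^sub>R y) < 1" if "norm y = 1" for y using that r by simp
  have isec: "integrable sphere_measure (\<lambda>y. \<integral>z. poisson_kernel (r *\<^sub>R y) z * norm (g z) powr p \<partial>sphere_measure)"
    by (rule Fubini_continuous_compact(2)[OF _ _ space_sphere_measure _ _ _ space_sphere_measure _ ck])
       (auto intro: id_measurable_sphere_measure sphere_measure.finite_measure_axioms)
  have "(\<ointegral>y. norm (g (r *\<^sub>R y)) powr p) \<le>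
     (\<ointegral>y. (\<ointegral>z. poisson_kernel (r *\<^sub>R y) z * norm (g z) powr p))"
  proof (rule integral_mono[OF integrable_sphere_continuous[OF continuous_on_norm_powr[OF cr p]] isec])
    fix y :: "real^'n" assume "y \<in> space sphere_measure"
    then have y: "norm y = 1" by (simp add: space_sphere_measure)
    note cky = continuous_on_poisson_kernel_sphere[OF nr[OF y]]
    have k0: "poisson_kernel (r *\<^sub>R y) z \<ge> 0" for z using nr[OF y] by (intro poisson_kernel_nonneg) auto
    have "norm (g (r *\<^sub>R y)) \<le> (\<ointegral>z. norm (poisson_kernel (r *\<^sub>R y) z *\<^sub>R g z))"
      unfolding Poisson_formula[OF g nr[OF y], symmetric] by (rule integral_norm_bound)
    then have "norm (g (r *\<^sub>R y)) \<le> (\<ointegral>z. poisson_kernel (r *\<^sub>R y) z * norm (g z))"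
      using k0 by simp
    then have "norm (g (r *\<^sub>R y)) powr p \<le> (\<ointegral>z. poisson_kernel (r *\<^sub>R y) z * norm (g z)) powr p"
      using p by (intro powr_mono2) auto
    also have "\<dots> \<le> (\<ointegral>z. poisson_kernel (r *\<^sub>R y) z * norm (g z) powr p)"
      using integral_poisson_kernel[OF nr[OF y]] k0 p
      by (intro integral_powr_ge continuous_intros cS cky) auto
    finally show "norm (g (r *\<^sub>R y)) powr p \<le> (\<ointegral>z. poisson_kernel (r *\<^sub>R y) z * norm (g z) powr p)" .
  qed
  also have "\<dots> = (\<ointegral>z. (\<ointegral>y. poisson_kernel (r *\<^sub>R y) z * norm (g z) powr p))"
    by (rule Fubini_continuous_compact(1)[OF _ _ space_sphere_measure _ _ _ space_sphere_measure _ ck])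
       (auto intro: id_measurable_sphere_measure sphere_measure.finite_measure_axioms)
  also have "\<dots> = (\<ointegral>z. norm (g z) powr p)"
  proof (rule integral_sphere_cong)
    fix z :: "real^'n" assume z: "norm z = 1"
    have "(\<ointegral>y. poisson_kernel (r *\<^sub>R y) z * norm (g z) powr p) =
       (\<ointegral>y. poisson_kernel (r *\<^sub>R y) z) * norm (g z) powr p" by simp
    also have "(\<ointegral>y. poisson_kernel (r *\<^sub>R y) z) = (\<ointegral>y. poisson_kernel (r *\<^sub>R z) y)"
      by (rule integral_sphere_cong) (simp add: poisson_kernel_commute z)
    also have "\<dots> = 1" using integral_poisson_kernel[OF nr[OF z]] .
    finally show "(\<ointegral>y. poisson_kernel (r *\<^sub>R y) z * norm (g z) powr p) = norm (g z) powr p" by simp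
  qed
  finally show ?thesis .
qed

text \<open>
  For every \<open>p \<ge> 1\<close> the mass of the \<open>p\<close>-th power of the kernel with parameter \<open>t y\<close> concentrates at
  \<open>y\<close> as \<open>t\<close> tends to 1: the total mass is at least 1 by Jensen, while the kernel tends to 0 away
  from \<open>y\<close>.
\<close>
lemma poisson_kernel_concentration:
  fixes w :: "real^'n \<Rightarrow> real"
  assumes w: "continuous_on (sphere 0 1) w" "\<And>z. norm z = 1 \<Longrightarrow> 0 \<le> w z"
    and y: "norm y = 1" and p: "p \<ge> 1" and e: "e > 0"
  obtains t where "0 < t" "t < 1"
    "(w y - e) * (\<ointegral>z. poisson_kernel (t *\<^sub>R y) z powr p)
      \<le> (\<ointegral>z. w z * poisson_kernel (t *\<^sub>R y) z powr p)"
    "(\<ointegral>z. poisson_kernel (t *\<^sub>R y) z powr p) \<ge> 1"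
proof -
  have "continuous (at y within sphere 0 1) w" using w(1) y by (simp add: continuous_on_eq_continuous_within)
  then have "\<exists>d>0. \<forall>x\<in>sphere 0 1. dist x y < d \<longrightarrow> dist (w x) (w y) < e / 2"
    unfolding continuous_within_eps_delta using e by (elim allE[of _ "e/2"]) simp
  then obtain d where d0: "d > 0" and d1: "\<forall>x\<in>sphere 0 1. dist x y < d \<longrightarrow> dist (w x) (w y) < e / 2"
    by (elim exE conjE)
  have near: "w z \<ge> w y - e / 2" if "norm z = 1" "norm (z - y) < d" for z
  proof -
    have "\<bar>w z - w y\<bar> < e / 2" using d1 that by (auto simp: dist_norm)
    then show ?thesis by linarith
  qed
  \<comment> \<open>The bound of \<open>poisson_kernel_away\<close> away from \<open>y\<close>; once it is below 1 it also bounds the \<open>p\<close>-th power.\<close>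
  let ?c = "\<lambda>t. 2 * (1 - t) / (d / 2) ^ CARD('n)"
  have "eventually (\<lambda>t. 2 * (1/2) * ?c t < 1 \<and> 1 - t \<le> d / 2 \<and> 0 < t \<and> t < 1) (at_left (1::real))"
    using d0 by (intro eventually_poisson_error) auto
  moreover have "eventually (\<lambda>t. 2 * (w y / 2) * ?c t < e / 2 \<and> 1 - t \<le> d / 2 \<and> 0 < t \<and> t < 1) (at_left (1::real))"
    using d0 e by (intro eventually_poisson_error) auto
  ultimately have "eventually (\<lambda>t. ?c t < 1 \<and> w y * ?c t < e / 2 \<and> 1 - t \<le> d / 2 \<and> 0 < t \<and> t < 1) (at_left (1::real))"
    by eventually_elim auto
  then obtain t where t: "?c t < 1" "w y * ?c t < e / 2" "1 - t \<le> d / 2" "0 < t" "t < 1"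
    using eventually_happens'[OF trivial_limit_at_left_real] by (metis (no_types, lifting))
  have nt: "norm (t *\<^sub>R y) < 1" using y t by simp
  let ?k = "poisson_kernel (t *\<^sub>R y)"
  note ck = continuous_on_poisson_kernel_sphere[OF nt]
  have k0: "?k z \<ge> 0" for z using nt by (intro poisson_kernel_nonneg) auto
  have ckp: "continuous_on (sphere 0 1) (\<lambda>z. ?k z powr p)"
    using continuous_on_norm_powr[OF ck p] k0 by simp
  define J where "J = (\<ointegral>z. ?k z powr p)"
  have "(\<ointegral>z. 1 * ?k z) powr p \<le> (\<ointegral>z. 1 * ?k z powr p)"
    by (rule integral_powr_ge) (use ck k0 p in \<open>auto simp: measure_sphere_measure_space\<close>)
  then have J: "J \<ge> 1" using integral_poisson_kernel[OF nt] by (simp add: J_def)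
  have "0 \<le> e / 2 * J - w y * ?c t" using J t(2) e mult_left_mono[of 1 J "e/2"] by linarith
  also have "\<dots> = (\<ointegral>z. e / 2 * ?k z powr p - w y * ?c t)"
    by (subst Bochner_Integration.integral_diff)
       (auto intro!: integrable_sphere_continuous continuous_intros ckp simp: J_def measure_sphere_measure_space)
  also have "\<dots> \<le> (\<ointegral>z. w z * ?k z powr p - (w y - e) * ?k z powr p)"
  proof (rule integral_sphere_mono)
    show "continuous_on (sphere 0 1) (\<lambda>z. e / 2 * ?k z powr p - w y * ?c t)" by (intro continuous_intros ckp)
    show "continuous_on (sphere 0 1) (\<lambda>z. w z * ?k z powr p - (w y - e) * ?k z powr p)" by (intro continuous_intros ckp w)
    fix z :: "real^'n" assume z: "norm z = 1"
    show "e / 2 * ?k z powr p - w y * ?c t \<le> w z * ?k z powr p - (w y - e) * ?k z powr p"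
    proof (cases "norm (z - y) < d")
      case True
      have "(w y - e / 2) * ?k z powr p \<le> w z * ?k z powr p"
        using near[OF z True] by (intro mult_right_mono) auto
      moreover have "w y * ?c t \<ge> 0" using w(2)[OF y] t d0 by (intro mult_nonneg_nonneg) auto
      ultimately show ?thesis by (simp add: algebra_simps)
    next
      case False
      then have kc: "?k z \<le> ?c t" using y z t d0 by (intro poisson_kernel_away) auto
      have "?k z powr p \<le> ?c t powr p" using kc k0 p by (intro powr_mono2) auto
      also have "\<dots> \<le> ?c t"
        using t d0 p by (intro powr_le_one_le) (auto simp: divide_pos_pos)
      finally have "w y * ?k z powr p \<le> w y * ?c t" using w(2)[OF y] by (intro mult_left_mono)
      moreover have "w z * ?k z powr p \<ge> 0" using w(2)[OF z] by simp
      moreover have "e * ?k z powr p \<ge> 0" using e by simp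
      ultimately show ?thesis by (simp add: algebra_simps)
    qed
  qed
  also have "\<dots> = (\<ointegral>z. w z * ?k z powr p) - (w y - e) * J"
    by (subst Bochner_Integration.integral_diff)
       (auto intro!: integrable_sphere_continuous continuous_intros ckp w simp: J_def)
  finally have "(w y - e) * J \<le> (\<ointegral>z. w z * ?k z powr p)" by simp
  then show ?thesis using that[OF t(4,5)] J unfolding J_def by blast
qed

section \<open>Weighted composition with conformal maps of the ball\<close>

lemma harmonic_on_dilation:
  fixes f :: "real^'n \<Rightarrow> complex"
  assumes "harmonic_on f T"
  shows "harmonic_on (\<lambda>x. f (s *\<^sub>R x)) ((\<lambda>x. s *\<^sub>R x) -` T)"
  using harmonic_on_affine[OF assms orthogonal_transformation_id, of 0 s] by simp

lemma cball_subset_dilated_ball: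
  assumes "0 \<le> s" "s < 1" shows "cball 0 1 \<subseteq> (\<lambda>x::real^'n. s *\<^sub>R x) -` ball 0 1"
proof
  fix x :: "real^'n" assume "x \<in> cball 0 1"
  then have "s * norm x \<le> s * 1" using assms by (intro mult_left_mono) auto
  then show "x \<in> (\<lambda>x. s *\<^sub>R x) -` ball 0 1" using assms by simp
qed

lemma powr_le_powr_abs:
  fixes M k b :: real
  assumes "M \<ge> 1" "1 / M \<le> k" "k \<le> M"
  shows "k powr b \<le> M powr \<bar>b\<bar>"
proof (cases "b \<ge> 0")
  case True
  have "0 < 1 / M" using assms by simp
  then have "0 \<le> k" using assms(2) by linarith
  then show ?thesis using True assms by (auto intro!: powr_mono2)
next
  case False
  have "0 < 1 / M" using assms by simp
  then have "k powr b \<le> (1 / M) powr b" using False assms by (intro powr_mono2') auto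
  also have "\<dots> = M powr \<bar>b\<bar>" using assms False by (simp add: powr_divide powr_minus_divide)
  finally show ?thesis .
qed

text \<open>
  The properties of a conformal automorphism \<open>\<phi>\<close> of the ball, defined near the closed ball, that
  determine the norm of the weighted composition operator: \<open>k\<close> is its conformal factor, \<open>a\<close> the
  point mapped to 0, and \<open>\<theta>\<close> the inverse on the sphere.
\<close>
locale conformal_ball_map =
  fixes \<phi> \<theta> :: "real^'n \<Rightarrow> real^'n" and k :: "real^'n \<Rightarrow> real" and a :: "real^'n" and V :: "(real^'n) set"
  assumes dim: "CARD('n) \<ge> 2"
    and V: "open V" "cball 0 1 \<subseteq> V"
    and cont_map: "continuous_on V \<phi>"
    and cont_factor: "continuous_on V k"
    and factor_pos: "x \<in> V \<Longrightarrow> k x > 0"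
    and defining_function: "x \<in> V \<Longrightarrow> 1 - \<phi> x \<bullet> \<phi> x = k x * (1 - x \<bullet> x)"
    and harmonic_weighted: "harmonic_on f T \<Longrightarrow>
        harmonic_on (\<lambda>x. k x powr ((real CARD('n) - 2) / 2) *\<^sub>R f (\<phi> x)) (V \<inter> \<phi> -` T)"
    and center: "norm a < 1" "\<phi> a = 0"
    and factor_sphere: "norm z = 1 \<Longrightarrow> k z = (1 - a \<bullet> a) / (norm (a - z))\<^sup>2"
    and inverse_cont: "continuous_on (sphere 0 1) \<theta>"
    and inverse_sphere: "norm z = 1 \<Longrightarrow> norm (\<theta> z) = 1"
    and inverse_left: "norm z = 1 \<Longrightarrow> \<theta> (\<phi> z) = z"
begin

abbreviation W :: "(real^'n \<Rightarrow> complex) \<Rightarrow> real^'n \<Rightarrow> complex" where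
  "W f x \<equiv> k x powr ((real CARD('n) - 2) / 2) *\<^sub>R f (\<phi> x)"

definition factor_max :: real where "factor_max = (1 + norm a) / (1 - norm a)"

lemma factor_max_ge_1: "factor_max \<ge> 1" using center(1) by (simp add: factor_max_def)

lemma cball_in_domain: "norm z \<le> 1 \<Longrightarrow> z \<in> V" using V(2) by auto

lemma map_sphere: "norm z = 1 \<Longrightarrow> norm (\<phi> z) = 1"
  using defining_function[OF cball_in_domain[OF eq_refl], of z] by (simp add: norm_eq_1)

lemma map_ball:
  assumes "norm x < 1" shows "norm (\<phi> x) < 1"
proof -
  have "x \<bullet> x < 1" using assms by (simp add: dot_square_norm power_less_one_iff abs_square_less_1)
  then have "k x * (1 - x \<bullet> x) > 0" using factor_pos[OF cball_in_domain] assms by (intro mult_pos_pos) auto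
  then have "\<phi> x \<bullet> \<phi> x < 1" using defining_function[OF cball_in_domain, of x] assms by simp
  then show ?thesis by (simp add: dot_square_norm power_less_one_iff abs_square_less_1)
qed

lemma map_cball: "norm x \<le> 1 \<Longrightarrow> norm (\<phi> x) \<le> 1"
  using map_sphere[of x] map_ball[of x] by (cases "norm x = 1") auto

lemma harmonic_W:
  assumes "harmonic_on f T" "cball 0 1 \<subseteq> T"
  shows "harmonic_on (W f) (V \<inter> \<phi> -` T)" "cball 0 1 \<subseteq> V \<inter> \<phi> -` T"
proof -
  show "harmonic_on (W f) (V \<inter> \<phi> -` T)" by (rule harmonic_weighted[OF assms(1)])
  show "cball 0 1 \<subseteq> V \<inter> \<phi> -` T"
  proof
    fix x :: "real^'n" assume "x \<in> cball 0 1"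
    then show "x \<in> V \<inter> \<phi> -` T" using V(2) map_cball[of x] assms(2) by (auto simp: subset_iff)
  qed
qed

lemma factor_bounds:
  assumes z: "norm z = 1" shows "1 / factor_max \<le> k z" "k z \<le> factor_max"
proof -
  have l: "1 - norm a \<le> norm (a - z)" "norm (a - z) \<le> 1 + norm a"
    using norm_triangle_ineq2[of z a] norm_triangle_ineq4[of a z] z by (auto simp: norm_minus_commute)
  have aa: "1 - a \<bullet> a = (1 - norm a) * (1 + norm a)" by (simp add: dot_square_norm power2_eq_square algebra_simps)
  have p: "0 < 1 - norm a" using center by simp
  have q: "0 < (norm (a - z))\<^sup>2" using p l(1) by (intro zero_less_power) linarith
  have "k z \<le> (1 - norm a) * (1 + norm a) / (1 - norm a)\<^sup>2"
    unfolding factor_sphere[OF z] aa using l p q by (intro divide_left_mono power_mono mult_pos_pos) auto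
  also have "\<dots> = factor_max" using p by (simp add: factor_max_def power2_eq_square)
  finally show "k z \<le> factor_max" .
  have "1 / factor_max = (1 - norm a) * (1 + norm a) / (1 + norm a)\<^sup>2" using p by (simp add: factor_max_def power2_eq_square)
  also have "\<dots> \<le> k z"
    unfolding factor_sphere[OF z] aa using l p q by (intro divide_left_mono power_mono mult_pos_pos) (auto intro: add_pos_nonneg)
  finally show "1 / factor_max \<le> k z" .
qed

text \<open>
  On the sphere, \<open>k\<close> takes its maximum and its minimum at the points in direction \<open>a\<close> and \<open>- a\<close>.
\<close>
lemma factor_powr_attained:
  obtains z where "norm z = 1" "k z powr b = factor_max powr \<bar>b\<bar>"
proof -
  obtain t y where ty: "a = t *\<^sub>R y" "0 \<le> t" "t < 1" "norm y = 1" "t = norm a"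
    using center(1) by (rule ball_0_1_cases)
  have aa: "1 - a \<bullet> a = (1 - t) * (1 + t)" using ty(5) by (simp add: dot_square_norm power2_eq_square algebra_simps)
  show ?thesis
  proof (cases "b \<ge> 0")
    case True
    have "a - y = (t - 1) *\<^sub>R y" by (simp add: ty(1) scaleR_diff_left)
    then have "norm (a - y) = 1 - t" using ty(2-4) by simp
    then have "k y = factor_max" unfolding factor_sphere[OF ty(4)] aa factor_max_def ty(5)[symmetric] using ty(3) by (simp add: power2_eq_square)
    then show ?thesis using that[of y] ty(4) True by simp
  next
    case False
    have "a - - y = (t + 1) *\<^sub>R y" by (simp add: ty(1) scaleR_add_left)
    then have "norm (a - - y) = 1 + t" using ty(2-4) by simp
    moreover have ny: "norm (- y) = 1" using ty(4) by simp
    ultimately have "k (- y) = (1 - t) * (1 + t) / (1 + t)\<^sup>2" by (simp only: factor_sphere[OF ny] aa)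
    then have "k (- y) = 1 / factor_max" unfolding factor_max_def ty(5)[symmetric] using ty(2,3) by (simp add: power2_eq_square)
    then have "k (- y) powr b = factor_max powr \<bar>b\<bar>" using factor_max_ge_1 False by (simp add: powr_divide powr_minus_divide)
    then show ?thesis using that[of "- y"] ny by simp
  qed
qed

text \<open>
  On the sphere, \<open>k powr (n / 2)\<close> is a constant multiple of the Poisson kernel at \<open>a\<close>. So the integral is,
  up to this constant, the Poisson integral of the harmonic function \<open>W f\<close>, whose value at \<open>a\<close> is
  \<open>k a powr ((n - 2) / 2) f 0\<close>.
\<close>
lemma change_of_variables_harmonic:
  assumes f: "harmonic_on f T" "cball 0 1 \<subseteq> T"
  shows "(\<ointegral>z. k z ^ (CARD('n) - 1) *\<^sub>R f (\<phi> z)) = f 0"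
proof -
  let ?n = "real CARD('n)"
  define A where "A = 1 - a \<bullet> a"
  have A: "A > 0" using center(1) by (simp add: A_def dot_square_norm power_less_one_iff abs_square_less_1)
  \<comment> \<open>Both \<open>k\<close> and the kernel are products of powers of \<open>A = 1 - \<bar>a\<bar>\<^sup>2\<close> and \<open>N = \<bar>a - z\<bar>\<close>, so only the
     exponents have to be compared.\<close>
  have key: "poisson_kernel a z * k z powr ((?n - 2) / 2) = A powr ((2 - ?n) / 2) * k z ^ (CARD('n) - 1)"
    if z: "norm z = 1" for z
  proof -
    define N where "N = norm (a - z)"
    have N: "N > 0" using z center by (auto simp: N_def)
    have kz: "k z = A powr 1 * N powr (-2)"
      using factor_sphere[OF z] N A by (simp add: A_def N_def powr_minus powr_numeral divide_inverse)
    have pk: "poisson_kernel a z = A powr 1 * N powr (- ?n)"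
      using N A unfolding poisson_kernel_def by (simp add: A_def N_def powr_minus powr_realpow divide_inverse)
    have kp: "k z powr b = A powr b * N powr (-2 * b)" for b
      unfolding kz using A N by (simp add: powr_mult powr_powr)
    have "k z ^ (CARD('n) - 1) = k z powr (?n - 1)"
      using factor_pos[OF cball_in_domain] z dim by (simp add: of_nat_diff flip: powr_realpow)
    then have kn: "k z ^ (CARD('n) - 1) = A powr (?n - 1) * N powr (- 2 * (?n - 1))" unfolding kp .
    have "poisson_kernel a z * k z powr ((?n - 2) / 2) = A powr (1 + (?n - 2) / 2) * N powr (- ?n + - 2 * ((?n - 2) / 2))"
      unfolding pk kp powr_add by simp
    also have "1 + (?n - 2) / 2 = (2 - ?n) / 2 + (?n - 1)" by (simp add: field_simps)
    also have "- ?n + - 2 * ((?n - 2) / 2) = - 2 * (?n - 1)" by (simp add: field_simps)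
    also have "A powr ((2 - ?n) / 2 + (?n - 1)) * N powr (- 2 * (?n - 1)) = A powr ((2 - ?n) / 2) * k z ^ (CARD('n) - 1)"
      unfolding kn powr_add by simp
    finally show ?thesis .
  qed
  have "1 = k a * A" using defining_function[of a] cball_in_domain[of a] center by (simp add: A_def)
  then have ka: "k a = 1 / A" using A by (simp add: field_simps)
  have "(\<ointegral>z. poisson_kernel a z *\<^sub>R W f z) = W f a"
    by (rule Poisson_formula[OF harmonic_W[OF f] center(1)])
  also have "\<dots> = A powr ((2 - ?n) / 2) *\<^sub>R f 0"
  proof -
    have "(1 / A) powr ((?n - 2) / 2) = A powr (- ((?n - 2) / 2))" using A by (simp add: powr_divide powr_minus_divide)
    also have "- ((?n - 2) / 2) = (2 - ?n) / 2" by (simp only: minus_divide_left minus_diff_eq)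
    finally show ?thesis by (simp only: center(2) ka)
  qed
  also have "(\<ointegral>z. poisson_kernel a z *\<^sub>R W f z) =
      (\<ointegral>z. A powr ((2 - ?n) / 2) *\<^sub>R (k z ^ (CARD('n) - 1) *\<^sub>R f (\<phi> z)))"
    by (rule integral_sphere_cong) (simp add: key)
  also have "\<dots> = A powr ((2 - ?n) / 2) *\<^sub>R (\<ointegral>z. k z ^ (CARD('n) - 1) *\<^sub>R f (\<phi> z))"
    by (rule integral_scaleR_right)
  finally show ?thesis using A by simp
qed

lemma continuous_on_sphere_map:
  "continuous_on (sphere 0 1) \<phi>" "continuous_on (sphere 0 1) k"
proof -
  have "sphere 0 1 \<subseteq> V" using V(2) sphere_cball by blast
  then show "continuous_on (sphere 0 1) \<phi>" "continuous_on (sphere 0 1) k"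
    using cont_map cont_factor continuous_on_subset by blast+
qed

text \<open>
  The formula holds for Poisson integrals \<open>y \<mapsto> \<integral> poisson_kernel (t y) z F z d\<sigma>\<close>: exchange the
  integrals and apply the harmonic case to the kernel. These functions approximate \<open>F\<close> uniformly.
\<close>
theorem change_of_variables_sphere:
  fixes F :: "real^'n \<Rightarrow> real"
  assumes F: "continuous_on (sphere 0 1) F"
  shows "(\<ointegral>z. k z ^ (CARD('n) - 1) * F (\<phi> z)) = (\<ointegral>z. F z)"
proof -
  let ?m = "CARD('n) - 1"
  have one: "(\<ointegral>z. k z ^ ?m) = 1"
  proof -
    have "(\<ointegral>z. complex_of_real (k z ^ ?m)) = 1"
      using change_of_variables_harmonic[OF harmonic_on_const[OF open_UNIV, of 1]]
      by (simp only: subset_UNIV scaleR_conv_of_real mult_1_right)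
    then show ?thesis unfolding integral_complex_of_real by (simp only: of_real_eq_1_iff)
  qed
  have k0: "k z \<ge> 0" if "norm z = 1" for z using factor_pos[OF cball_in_domain, of z] that by simp
  have cF\<phi>: "continuous_on (sphere 0 1) (\<lambda>z. F (\<phi> z))"
    by (rule continuous_on_compose2[OF F continuous_on_sphere_map(1)]) (use map_sphere in auto)
  have pk: "(\<ointegral>w. k w ^ ?m * poisson_kernel (t *\<^sub>R \<phi> w) z) = 1" if t: "0 \<le> t" "t < 1" and z: "norm z = 1" for t z
  proof -
    have "(\<ointegral>w. k w ^ ?m *\<^sub>R complex_of_real (poisson_kernel (t *\<^sub>R \<phi> w) z)) = complex_of_real (poisson_kernel (t *\<^sub>R 0) z)"
    proof (rule change_of_variables_harmonic)
      have "t *\<^sub>R x \<noteq> z" if "norm x \<le> 1" for x using cball_subset_dilated_ball[OF t] that z by auto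
      then show "cball 0 1 \<subseteq> (\<lambda>x. t *\<^sub>R x) -` (- {z})" by auto
    qed (rule harmonic_on_dilation[OF harmonic_on_poisson_kernel[OF z]])
    then have "(\<ointegral>w. complex_of_real (k w ^ ?m * poisson_kernel (t *\<^sub>R \<phi> w) z)) = 1"
      using z by (simp add: poisson_kernel_0 scaleR_conv_of_real[where 'a = complex])
    then show ?thesis unfolding integral_complex_of_real by (simp only: of_real_eq_1_iff)
  qed
  have "\<bar>(\<ointegral>z. F z) - (\<ointegral>z. k z ^ ?m * F (\<phi> z))\<bar> \<le> e" if e: "e > 0" for e
  proof -
    obtain t where t: "0 < t" "t < 1"
      and ap: "\<And>y. norm y = 1 \<Longrightarrow> norm ((\<ointegral>z. poisson_kernel (t *\<^sub>R y) z *\<^sub>R F z) - F y) \<le> e"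
      using poisson_integral_uniform_approx[OF F e] by blast
    have ck: "continuous_on (sphere 0 1 \<times> sphere 0 1) (\<lambda>(w, z). k w ^ ?m * poisson_kernel (t *\<^sub>R \<phi> w) z * F z)"
    proof -
      have "t *\<^sub>R \<phi> w \<noteq> z" if "norm w = 1" "norm z = 1" for w z using that t map_sphere[of w] by auto
      moreover have "continuous_on (sphere 0 1 \<times> sphere 0 1) (\<lambda>p. F (snd p :: real^'n))" "continuous_on (sphere 0 1 \<times> sphere 0 1) (\<lambda>p. k (fst p :: real^'n))"
        "continuous_on (sphere 0 1 \<times> sphere 0 1) (\<lambda>p. \<phi> (fst p))"
        by (auto intro!: continuous_on_compose2[OF F] continuous_on_compose2[OF continuous_on_sphere_map(1)] continuous_on_compose2[OF continuous_on_sphere_map(2)] continuous_intros)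
      ultimately show ?thesis
        unfolding split_def by (intro continuous_intros continuous_on_poisson_kernel) auto
    qed
    note fub = Fubini_continuous_compact[OF sphere_measure.finite_measure_axioms id_measurable_sphere_measure space_sphere_measure compact_sphere
        sphere_measure.finite_measure_axioms id_measurable_sphere_measure space_sphere_measure compact_sphere ck]
    have "(\<ointegral>w. (\<ointegral>z. k w ^ ?m * poisson_kernel (t *\<^sub>R \<phi> w) z * F z)) = (\<ointegral>z. F z)"
      unfolding fub(1) by (rule integral_sphere_cong) (use pk t in simp)
    then have "(\<ointegral>z. F z) - (\<ointegral>z. k z ^ ?m * F (\<phi> z))
       = (\<ointegral>w. (\<ointegral>z. k w ^ ?m * poisson_kernel (t *\<^sub>R \<phi> w) z * F z) - k w ^ ?m * F (\<phi> w))"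
      using fub(2) by (subst Bochner_Integration.integral_diff)
        (auto intro!: integrable_sphere_continuous continuous_intros continuous_on_sphere_map cF\<phi>)
    also have "norm \<dots> \<le> (\<ointegral>w. k w ^ ?m * e)"
    proof (rule Bochner_Integration.integral_norm_bound_integral)
      show "integrable sphere_measure (\<lambda>w. (\<ointegral>z. k w ^ ?m * poisson_kernel (t *\<^sub>R \<phi> w) z * F z) - k w ^ ?m * F (\<phi> w))"
        by (intro Bochner_Integration.integrable_diff fub(2) integrable_sphere_continuous continuous_intros continuous_on_sphere_map cF\<phi>)
      show "integrable sphere_measure (\<lambda>w. k w ^ ?m * e)"
        by (intro integrable_sphere_continuous continuous_intros continuous_on_sphere_map)
      fix w :: "real^'n" assume "w \<in> space sphere_measure"
      then have w: "norm w = 1" by (simp add: space_sphere_measure)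
      have "(\<ointegral>z. k w ^ ?m * poisson_kernel (t *\<^sub>R \<phi> w) z * F z) - k w ^ ?m * F (\<phi> w)
         = k w ^ ?m * ((\<ointegral>z. poisson_kernel (t *\<^sub>R \<phi> w) z *\<^sub>R F z) - F (\<phi> w))"
        by (simp add: mult.assoc right_diff_distrib)
      also have "norm \<dots> \<le> k w ^ ?m * e"
        unfolding norm_mult using ap[OF map_sphere[OF w]] k0[OF w] by (intro mult_mono) auto
      finally show "norm ((\<ointegral>z. k w ^ ?m * poisson_kernel (t *\<^sub>R \<phi> w) z * F z) - k w ^ ?m * F (\<phi> w)) \<le> k w ^ ?m * e" .
    qed
    also have "\<dots> = e" using one by simp
    finally show ?thesis by simp
  qed
  then have "\<bar>(\<ointegral>z. F z) - (\<ointegral>z. k z ^ ?m * F (\<phi> z))\<bar> \<le> 0" by (meson dense_ge)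
  then show ?thesis by simp
qed

text \<open>
  The exponent \<open>b\<close> is \<open>p (n - 2) / 2\<close> from the weight, reduced by \<open>n - 1\<close> from the change of variables.
\<close>
lemma integral_W_powr:
  assumes f: "continuous_on (sphere 0 1) f" and p: "p \<ge> 1"
  defines "b \<equiv> p * (real CARD('n) - 2) / 2 - (real CARD('n) - 1)"
  shows "(\<ointegral>z. norm (W f z) powr p) = (\<ointegral>z. k (\<theta> z) powr b * norm (f z) powr p)"
    and "continuous_on (sphere 0 1) (\<lambda>z. k (\<theta> z) powr b)"
proof -
  show c: "continuous_on (sphere 0 1) (\<lambda>z. k (\<theta> z) powr b)"
    using factor_pos[OF cball_in_domain] inverse_sphere
    by (intro continuous_on_powr continuous_on_compose2[OF continuous_on_sphere_map(2) inverse_cont]) (auto simp: less_imp_neq[symmetric] intro: less_imp_neq[symmetric])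
  have "(\<ointegral>z. k (\<theta> z) powr b * norm (f z) powr p) =
     (\<ointegral>z. k z ^ (CARD('n) - 1) * (k (\<theta> (\<phi> z)) powr b * norm (f (\<phi> z)) powr p))"
    by (rule change_of_variables_sphere[symmetric]) (intro continuous_intros c continuous_on_norm_powr[OF f p])
  also have "\<dots> = (\<ointegral>z. norm (W f z) powr p)"
  proof (rule integral_sphere_cong)
    fix z :: "real^'n" assume z: "norm z = 1"
    have kp: "k z > 0" using factor_pos[OF cball_in_domain, of z] z by simp
    have "k z ^ (CARD('n) - 1) = k z powr (real CARD('n) - 1)"
      using kp dim by (simp add: of_nat_diff flip: powr_realpow)
    then have "k z ^ (CARD('n) - 1) * k z powr b = k z powr (real CARD('n) - 1 + b)" by (simp add: powr_add)
    also have "real CARD('n) - 1 + b = (real CARD('n) - 2) / 2 * p" by (simp add: b_def)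
    finally have "k z ^ (CARD('n) - 1) * k z powr b = (k z powr ((real CARD('n) - 2) / 2)) powr p" by (simp add: powr_powr)
    then show "k z ^ (CARD('n) - 1) * (k (\<theta> (\<phi> z)) powr b * norm (f (\<phi> z)) powr p) = norm (W f z) powr p"
      using inverse_left[OF z] by (simp add: powr_mult mult.assoc[symmetric])
  qed
  finally show "(\<ointegral>z. norm (W f z) powr p) = (\<ointegral>z. k (\<theta> z) powr b * norm (f z) powr p)" ..
qed

end

section \<open>Operator norms on the harmonic Hardy spaces\<close>

text \<open>
  Dominated convergence along \<open>s = 1 - 1 / (j + 2)\<close>, a sequence in \<open>[0, 1)\<close> with limit 1. It serves
  both for boundary values and for the approximation of \<open>f\<close> by its dilations.
\<close>
lemma sphere_parameter_limit:
  fixes G :: "real \<Rightarrow> real^'n \<Rightarrow> real"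
  assumes G: "continuous_on ({0..1} \<times> sphere 0 1) (\<lambda>(s, z). G s z)"
  shows "(\<lambda>j. \<integral>z. G (1 - 1 / (real j + 2)) z \<partial>sphere_measure) \<longlonglongrightarrow> (\<ointegral>z. G 1 z)"
proof -
  have "compact ((\<lambda>(s, z). G s z) ` ({0..1} \<times> sphere 0 1))"
    using G by (intro compact_continuous_image compact_Times) auto
  then obtain B where "\<forall>w \<in> (\<lambda>(s, z). G s z) ` ({0..1} \<times> sphere 0 1). norm w \<le> B"
    using compact_imp_bounded bounded_iff by metis
  then have B: "norm (G s z) \<le> B" if "s \<in> {0..1}" "norm z = 1" for s z
    using that by auto
  have sj: "1 - 1 / (real j + 2) \<in> {0..1}" for j by (simp add: field_simps)
  have sec: "continuous_on (sphere 0 1) (\<lambda>z. G s z)" if "s \<in> {0..1}" for s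
    using continuous_on_compose2[OF G continuous_on_Pair[OF continuous_on_const[of "sphere 0 1" s] continuous_on_id]] that
    by (simp add: image_subset_iff)
  show ?thesis
  proof (rule integral_dominated_convergence[where w = "\<lambda>_. B"])
    show "(\<lambda>z. G 1 z) \<in> borel_measurable sphere_measure"
      using integrable_sphere_continuous[OF sec, of 1] by auto
    show "(\<lambda>z. G (1 - 1 / (real j + 2)) z) \<in> borel_measurable sphere_measure" for j
      using integrable_sphere_continuous[OF sec[OF sj[of j]]] by auto
    show "AE z in sphere_measure. norm (G (1 - 1 / (real j + 2)) z) \<le> B" for j
      using B sj by (intro AE_I2) (simp add: space_sphere_measure)
    have "(\<lambda>j. 1 - 1 / (real j + 2)) \<longlonglongrightarrow> 1 - 0"
    proof (intro tendsto_intros)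
      have "(\<lambda>j. 1 / real (j + 2)) \<longlonglongrightarrow> 0"
        by (rule LIMSEQ_ignore_initial_segment[OF lim_1_over_n])
      then show "(\<lambda>j. 1 / (real j + 2)) \<longlonglongrightarrow> 0" by (simp add: add.commute)
    qed
    then have lim: "(\<lambda>j. 1 - 1 / (real j + 2)) \<longlonglongrightarrow> 1" by simp
    show "AE z in sphere_measure. (\<lambda>j. G (1 - 1 / (real j + 2)) z) \<longlonglongrightarrow> G 1 z"
    proof (rule AE_I2)
      fix z :: "real^'n" assume "z \<in> space sphere_measure"
      then have z: "norm z = 1" by (simp add: space_sphere_measure)
      have "continuous_on {0..1} (\<lambda>s. G s z)"
        using continuous_on_compose2[OF G continuous_on_Pair[OF continuous_on_id continuous_on_const[of "{0..1}" z]]] z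
        by (simp add: image_subset_iff)
      from continuous_on_tendsto_compose[OF this lim] sj
      show "(\<lambda>j. G (1 - 1 / (real j + 2)) z) \<longlonglongrightarrow> G 1 z" by simp
    qed
  qed (simp add: sphere_measure.integrable_const)
qed

lemma hp_norm_cong:
  assumes "\<And>x. norm x < 1 \<Longrightarrow> f x = g x"
  shows "hp_norm p f = hp_norm p (g :: real^'n \<Rightarrow> complex)"
proof -
  have "(\<ointegral>z. norm (f (r *\<^sub>R z)) powr q) = (\<ointegral>z. norm (g (r *\<^sub>R z)) powr q)"
    if "r \<in> {0..<1}" for r q
    by (rule integral_sphere_cong) (use that in \<open>simp add: assms\<close>)
  then show ?thesis unfolding hp_norm_def using assms by (auto intro!: SUP_cong)
qed

lemma enn2real_ge_1: "1 \<le> p \<Longrightarrow> p \<noteq> \<infinity> \<Longrightarrow> enn2real p \<ge> 1"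
  by (cases p) (auto simp: top_ennreal.rep_eq)

text \<open>
  For finite exponents, a norm bound is a bound for all integral means of the \<open>p\<close>-th power; the estimates
  below are made in this form.
\<close>
lemma hp_norm_le_iff:
  assumes p: "1 \<le> p" "p \<noteq> \<infinity>" and c: "c \<ge> 0"
  shows "hp_norm p (f :: real^'n \<Rightarrow> complex) \<le> ennreal c \<longleftrightarrow>
    (\<forall>r\<in>{0..<1}. (\<ointegral>z. norm (f (r *\<^sub>R z)) powr enn2real p) \<le> c powr enn2real p)"
proof -
  obtain q where q: "p = ennreal q" "q \<ge> 1"
    using p by (cases p) (auto simp: top_ennreal.rep_eq)
  have eq: "enn2real p = q" using q by simp
  have "I powr (1 / q) \<le> c \<longleftrightarrow> I \<le> c powr q" if "I \<ge> 0" for I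
  proof
    assume "I powr (1 / q) \<le> c"
    then have "(I powr (1 / q)) powr q \<le> c powr q" using q by (intro powr_mono2) auto
    then show "I \<le> c powr q" using q that by (simp add: powr_powr)
  next
    assume "I \<le> c powr q"
    then have "I powr (1 / q) \<le> (c powr q) powr (1 / q)" using q that by (intro powr_mono2) auto
    then show "I powr (1 / q) \<le> c" using q c by (simp add: powr_powr)
  qed
  then show ?thesis
    unfolding hp_norm_def eq using p(2) c by (simp add: SUP_le_iff ennreal_le_iff integral_nonneg_AE)
qed

lemma integral_sphere_le_hp_norm:
  fixes f :: "real^'n \<Rightarrow> complex"
  assumes p: "1 \<le> p" "p \<noteq> \<infinity>" and c: "c \<ge> 0" and f: "continuous_on (cball 0 1) f" and le: "hp_norm p f \<le> ennreal c"
  shows "(\<ointegral>z. norm (f z) powr enn2real p) \<le> c powr enn2real p"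
proof -
  have p1: "enn2real p \<ge> 1" using p by (rule enn2real_ge_1)
  have "continuous_on ({0..1} \<times> sphere 0 1) (\<lambda>(s, z). norm (f (s *\<^sub>R z)) powr enn2real p)"
    unfolding split_def
    by (intro continuous_on_norm_powr[OF continuous_on_compose2[OF f]] continuous_intros) (use p1 in auto)
  from sphere_parameter_limit[OF this]
  have "(\<lambda>j. \<integral>z. norm (f ((1 - 1 / (real j + 2)) *\<^sub>R z)) powr enn2real p \<partial>sphere_measure)
     \<longlonglongrightarrow> (\<ointegral>z. norm (f z) powr enn2real p)" by simp
  moreover have "1 - 1 / (real j + 2) \<in> {0..<1}" for j by (simp add: field_simps)
  ultimately show ?thesis
    using le unfolding hp_norm_le_iff[OF p c] by (intro LIMSEQ_le_const2) blast+
qed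

context conformal_ball_map
begin

lemma W_harmonic_ball:
  assumes "harmonic_on f (ball 0 1)" shows "harmonic_on (W f) (ball 0 1)"
proof (rule harmonic_on_subset[OF harmonic_weighted[OF assms]])
  show "ball 0 1 \<subseteq> V \<inter> \<phi> -` ball 0 1" using map_ball cball_in_domain by auto
qed auto

text \<open>
  The mean on the sphere of radius \<open>r\<close> is at most the mean on the unit sphere, where the change of
  variables applies and the power of the conformal factor is bounded.
\<close>
lemma integral_W_le_of_harmonic_nbhd:
  assumes f: "harmonic_on f T" "cball 0 1 \<subseteq> T" and p: "p \<ge> 1" and r: "0 \<le> r" "r < 1"
  defines "b \<equiv> p * (real CARD('n) - 2) / 2 - (real CARD('n) - 1)"
  shows "(\<ointegral>z. norm (W f (r *\<^sub>R z)) powr p) \<le> factor_max powr \<bar>b\<bar> * (\<ointegral>z. norm (f z) powr p)"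
proof -
  have cf: "continuous_on (sphere 0 1) f"
    by (rule continuous_on_subset[OF harmonic_on_continuous_on[OF f(1)]]) (use f(2) in auto)
  note I = integral_W_powr[OF cf p, folded b_def]
  have "(\<ointegral>z. norm (W f (r *\<^sub>R z)) powr p) \<le> (\<ointegral>z. norm (W f z) powr p)"
    by (rule harmonic_integral_mean_mono[OF harmonic_W[OF f] r p])
  also have "\<dots> = (\<ointegral>z. k (\<theta> z) powr b * norm (f z) powr p)" by (rule I(1))
  also have "\<dots> \<le> (\<ointegral>z. factor_max powr \<bar>b\<bar> * norm (f z) powr p)"
    using factor_bounds[OF inverse_sphere] factor_max_ge_1
    by (intro integral_sphere_mono continuous_on_mult I(2) continuous_on_const continuous_on_norm_powr[OF cf p]
        mult_right_mono powr_le_powr_abs) auto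
  finally show ?thesis by simp
qed

text \<open>
  A function that is harmonic only in the open ball need not have boundary values, so it is replaced by the
  dilations \<open>x \<mapsto> f (s x)\<close>, which are harmonic near the closed ball, and \<open>s\<close> tends to 1.
\<close>
lemma integral_W_le:
  assumes f: "harmonic_on f (ball 0 1)" and p: "p \<ge> 1" and r: "0 \<le> r" "r < 1"
    and N: "\<And>s. s \<in> {0..<1} \<Longrightarrow> (\<ointegral>z. norm (f (s *\<^sub>R z)) powr p) \<le> N"
  defines "b \<equiv> p * (real CARD('n) - 2) / 2 - (real CARD('n) - 1)"
  shows "(\<ointegral>z. norm (W f (r *\<^sub>R z)) powr p) \<le> factor_max powr \<bar>b\<bar> * N"
proof -
  let ?s = "\<lambda>j. 1 - 1 / (real j + 2)"
  let ?G = "\<lambda>s z. norm (W (\<lambda>x. f (s *\<^sub>R x)) (r *\<^sub>R z)) powr p"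
  have rz: "r *\<^sub>R z \<in> V" "norm (\<phi> (r *\<^sub>R z)) < 1" if "norm z = 1" for z
    using that r by (auto intro!: cball_in_domain map_ball)
  have inb: "s *\<^sub>R \<phi> (r *\<^sub>R z) \<in> ball 0 1" if "norm z = 1" "s \<in> {0..1}" for s z
    using rz(2)[OF that(1)] that(2) mult_left_le_one_le[of "norm (\<phi> (r *\<^sub>R z))" s] by simp
  have c1: "continuous_on ({0..1} \<times> sphere 0 1) (\<lambda>q::real \<times> (real^'n). \<phi> (r *\<^sub>R snd q))"
    by (intro continuous_on_compose2[OF cont_map] continuous_intros) (use rz in auto)
  have c2: "continuous_on ({0..1} \<times> sphere 0 1) (\<lambda>q::real \<times> (real^'n). k (r *\<^sub>R snd q))"
    by (intro continuous_on_compose2[OF cont_factor] continuous_intros) (use rz in auto)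
  have c3: "continuous_on ({0..1} \<times> sphere 0 1) (\<lambda>q::real \<times> (real^'n). f (fst q *\<^sub>R \<phi> (r *\<^sub>R snd q)))"
    by (intro continuous_on_compose2[OF harmonic_on_continuous_on[OF f]] continuous_intros c1 image_subsetI inb) auto
  have "k (r *\<^sub>R z) \<noteq> 0" if "norm z = 1" for z using factor_pos[OF rz(1)[OF that]] by simp
  then have "continuous_on ({0..1} \<times> sphere 0 1) (\<lambda>(s, z). ?G s z)"
    unfolding split_def
    by (intro continuous_on_norm_powr p continuous_on_scaleR c3 continuous_on_powr c2 continuous_on_const) auto
  from sphere_parameter_limit[OF this]
  have "(\<lambda>j. \<integral>z. ?G (?s j) z \<partial>sphere_measure) \<longlonglongrightarrow> (\<ointegral>z. norm (W f (r *\<^sub>R z)) powr p)" by simp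
  moreover have "(\<ointegral>z. ?G (?s j) z) \<le> factor_max powr \<bar>b\<bar> * N" for j
  proof -
    have sj: "?s j \<in> {0..<1}" by (simp add: field_simps)
    have "(\<ointegral>z. ?G (?s j) z) \<le> factor_max powr \<bar>b\<bar> * (\<ointegral>z. norm (f (?s j *\<^sub>R z)) powr p)"
      unfolding b_def
      by (rule integral_W_le_of_harmonic_nbhd[OF harmonic_on_dilation[OF f] cball_subset_dilated_ball p r]) (use sj in auto)
    also have "\<dots> \<le> factor_max powr \<bar>b\<bar> * N" using N[OF sj] by (intro mult_left_mono) auto
    finally show ?thesis .
  qed
  ultimately show ?thesis by (intro LIMSEQ_le_const2) blast+
qed

text \<open>
  The test function is a dilated Poisson kernel with pole at \<open>y = \<phi> z0\<close>, where \<open>z0\<close> maximizes the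
  power of \<open>k\<close>: its \<open>p\<close>-th power concentrates where the weight in the integral of \<open>\<bar>W f\<bar> powr p\<close> is largest.
\<close>
lemma integral_W_nearly_attained:
  assumes p: "p \<ge> 1" and e: "e > 0"
  defines "b \<equiv> p * (real CARD('n) - 2) / 2 - (real CARD('n) - 1)"
  obtains f T where "harmonic_on f T" "cball 0 1 \<subseteq> T"
    "(\<ointegral>z. norm (f z) powr p) \<ge> 1"
    "(\<ointegral>z. norm (W f z) powr p) \<ge> (factor_max powr \<bar>b\<bar> - e) * (\<ointegral>z. norm (f z) powr p)"
proof -
  obtain z0 where z0: "norm z0 = 1" "k z0 powr b = factor_max powr \<bar>b\<bar>" by (rule factor_powr_attained)
  define y where "y = \<phi> z0"
  have y: "norm y = 1" "\<theta> y = z0" using z0 map_sphere inverse_left by (auto simp: y_def)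
  have cw: "continuous_on (sphere 0 1) (\<lambda>z. k (\<theta> z) powr b)"
    using integral_W_powr(2)[OF continuous_on_const p] unfolding b_def .
  obtain t where t: "0 < t" "t < 1"
    "(k (\<theta> y) powr b - e) * (\<ointegral>z. poisson_kernel (t *\<^sub>R y) z powr p)
      \<le> (\<ointegral>z. k (\<theta> z) powr b * poisson_kernel (t *\<^sub>R y) z powr p)"
    "(\<ointegral>z. poisson_kernel (t *\<^sub>R y) z powr p) \<ge> 1"
    by (rule poisson_kernel_concentration[OF cw _ y(1) p e]) auto
  define f where "f x = complex_of_real (poisson_kernel (t *\<^sub>R x) y)" for x
  let ?T = "(\<lambda>x. t *\<^sub>R x) -` (- {y})"
  have h: "harmonic_on f ?T" unfolding f_def by (rule harmonic_on_dilation[OF harmonic_on_poisson_kernel[OF y(1)]])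
  have T: "cball 0 1 \<subseteq> ?T"
  proof
    fix x :: "real^'n" assume "x \<in> cball 0 1"
    then have "norm (t *\<^sub>R x) < 1" using cball_subset_dilated_ball[of t] t by auto
    then show "x \<in> ?T" using y by auto
  qed
  have nf: "norm (f z) = poisson_kernel (t *\<^sub>R y) z" if "norm z = 1" for z
    unfolding f_def using that y t poisson_kernel_nonneg[of "t *\<^sub>R y" z]
    by (simp add: poisson_kernel_commute)
  have cf: "continuous_on (sphere 0 1) f"
    by (rule continuous_on_subset[OF harmonic_on_continuous_on[OF h]]) (use T in auto)
  have 1: "(\<ointegral>z. norm (f z) powr p) = (\<ointegral>z. poisson_kernel (t *\<^sub>R y) z powr p)"
    by (rule integral_sphere_cong) (simp add: nf)
  have 2: "(\<ointegral>z. norm (W f z) powr p) = (\<ointegral>z. k (\<theta> z) powr b * poisson_kernel (t *\<^sub>R y) z powr p)"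
    unfolding integral_W_powr(1)[OF cf p] b_def by (rule integral_sphere_cong) (simp add: nf)
  show ?thesis
    by (rule that[OF h T]) (use t(3,4) in \<open>simp_all only: 1 2 y(2) z0(2)\<close>)
qed

text \<open>
  The weight is \<open>W 1\<close>, hence harmonic, and the Poisson formula bounds it by its maximum on the sphere.
\<close>
lemma factor_powr_ball:
  assumes x: "norm x < 1"
  shows "k x powr ((real CARD('n) - 2) / 2) \<le> factor_max powr ((real CARD('n) - 2) / 2)"
proof -
  let ?e = "(real CARD('n) - 2) / 2"
  have e: "?e \<ge> 0" using dim by simp
  note h = harmonic_W[OF harmonic_on_const[OF open_UNIV, of 1] subset_UNIV]
  note cpk = continuous_on_poisson_kernel_sphere[OF x]
  have ck: "continuous_on (sphere 0 1) (\<lambda>z. k z powr ?e)"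
    using factor_pos[OF cball_in_domain] by (intro continuous_on_powr continuous_on_sphere_map continuous_on_const) (auto simp: less_imp_neq[symmetric])
  have "complex_of_real (k x powr ?e) = (\<ointegral>z. complex_of_real (poisson_kernel x z * k z powr ?e))"
    using Poisson_formula[OF h x] by (simp add: scaleR_conv_of_real)
  then have "k x powr ?e = (\<ointegral>z. poisson_kernel x z * k z powr ?e)"
    unfolding integral_complex_of_real by (simp only: of_real_eq_iff)
  also have "\<dots> \<le> (\<ointegral>z. poisson_kernel x z * factor_max powr ?e)"
  proof (rule integral_sphere_mono)
    fix z :: "real^'n" assume z: "norm z = 1"
    have "k z powr ?e \<le> factor_max powr ?e" using factor_bounds[OF z] factor_pos[OF cball_in_domain, of z] z e by (intro powr_mono2) auto
    then show "poisson_kernel x z * k z powr ?e \<le> poisson_kernel x z * factor_max powr ?e"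
      using poisson_kernel_nonneg[of x z] x by (intro mult_left_mono) auto
  qed (intro continuous_intros cpk ck)+
  also have "\<dots> = factor_max powr ?e" using integral_poisson_kernel[OF x] by simp
  finally show ?thesis .
qed

text \<open>
  The exponent for the integrals of \<open>q\<close>-th powers and the exponent for the norm differ by the factor
  \<open>- q\<close>.
\<close>
lemma factor_max_powr_exponents:
  assumes q: "q \<ge> 1"
  shows "factor_max powr \<bar>q * (real CARD('n) - 2) / 2 - (real CARD('n) - 1)\<bar> =
    (factor_max powr \<bar>(real CARD('n) - 1) / q - (real CARD('n) - 2) / 2\<bar>) powr q"
proof -
  have "q * (real CARD('n) - 2) / 2 - (real CARD('n) - 1) = - (((real CARD('n) - 1) / q - (real CARD('n) - 2) / 2) * q)"
    using q by (simp add: field_simps)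
  then show ?thesis using q by (simp add: abs_mult powr_powr)
qed

lemma hp_norm_W_le:
  assumes f: "harmonic_on f (ball 0 1)" and p: "1 \<le> p" and c: "c \<ge> 0" and le: "hp_norm p f \<le> ennreal c"
  defines "E \<equiv> \<bar>(if p = \<infinity> then 0 else (real CARD('n) - 1) / enn2real p) - (real CARD('n) - 2) / 2\<bar>"
  shows "hp_norm p (W f) \<le> ennreal (factor_max powr E * c)"
proof (cases "p = \<infinity>")
  case True
  have E: "E = (real CARD('n) - 2) / 2" using dim unfolding E_def True by simp
  have "norm (W f x) \<le> factor_max powr E * c" if x: "norm x < 1" for x
  proof -
    have "ennreal (norm (f (\<phi> x))) \<le> ennreal c"
      using le map_ball[OF x] True unfolding hp_norm_def by (auto simp: SUP_le_iff)
    then have "norm (f (\<phi> x)) \<le> c" using c by simp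
    then show ?thesis using factor_powr_ball[OF x] unfolding E by (auto intro!: mult_mono)
  qed
  then show ?thesis unfolding hp_norm_def using True by (auto simp: SUP_le_iff intro!: ennreal_leI)
next
  case False
  let ?q = "enn2real p"
  have q: "?q \<ge> 1" using p False by (rule enn2real_ge_1)
  let ?b = "?q * (real CARD('n) - 2) / 2 - (real CARD('n) - 1)"
  have Mb: "factor_max powr \<bar>?b\<bar> * c powr ?q = (factor_max powr E * c) powr ?q"
    using factor_max_powr_exponents[OF q] c False by (simp add: E_def powr_mult)
  show ?thesis
    unfolding hp_norm_le_iff[OF p False mult_nonneg_nonneg[OF powr_ge_zero c]] Mb[symmetric]
    using integral_W_le[OF f q] le unfolding hp_norm_le_iff[OF p False c] by auto
qed

text \<open>
  For \<open>p = \<infinity>\<close> the constant function 1 is extremal: its image is the weight itself. For finite \<open>p\<close> the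
  nearly extremal functions are normalized to norm at most 1.
\<close>
lemma le_hp_opnorm_W:
  assumes p: "1 \<le> p" and T: "\<And>f x. norm x < 1 \<Longrightarrow> T f x = W f x"
  defines "E \<equiv> \<bar>(if p = \<infinity> then 0 else (real CARD('n) - 1) / enn2real p) - (real CARD('n) - 2) / 2\<bar>"
  shows "ennreal (factor_max powr E) \<le> hp_opnorm p T"
proof (cases "hp_opnorm p T")
  case (real s)
  have T': "hp_norm p (T f) = hp_norm p (W f)" for f by (rule hp_norm_cong) (simp add: T)
  have le: "hp_norm p (W f) \<le> ennreal s" if "harmonic_on f (ball 0 1)" "hp_norm p f \<le> 1" for f
  proof -
    have "hp_norm p f < \<infinity>" using that(2) by (rule le_less_trans) simp
    then have "hp_norm p (T f) \<le> hp_opnorm p T"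
      unfolding hp_opnorm_def using that by (intro SUP_upper) (auto simp: hp_space_def)
    then show ?thesis using real T' by simp
  qed
  show ?thesis
  proof (cases "p = \<infinity>")
    case True
    have E: "E = (real CARD('n) - 2) / 2" using dim unfolding E_def True by simp
    obtain z where z: "norm z = 1" "k z powr E = factor_max powr \<bar>E\<bar>" by (rule factor_powr_attained)
    have E0: "E \<ge> 0" using dim E by simp
    have "hp_norm p (\<lambda>_::real^'n. 1) \<le> 1" unfolding hp_norm_def using True by (auto intro!: SUP_least)
    then have "hp_norm p (W (\<lambda>_. 1)) \<le> ennreal s" by (intro le harmonic_on_const) auto
    then have le1: "k x powr E \<le> s" if "norm x < 1" for x
      using that True real unfolding hp_norm_def E[symmetric] by (auto simp: SUP_le_iff)
    have "((\<lambda>t. k (t *\<^sub>R z) powr E) \<longlongrightarrow> k (1 *\<^sub>R z) powr E) (at_left 1)"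
    proof (rule tendsto_powr)
      have "isCont k z" using cont_factor V(1) cball_in_domain z(1) by (simp add: continuous_on_eq_continuous_at)
      moreover have "((\<lambda>t. t *\<^sub>R z) \<longlongrightarrow> 1 *\<^sub>R z) (at_left 1)" by (intro tendsto_intros)
      ultimately show "((\<lambda>t. k (t *\<^sub>R z)) \<longlongrightarrow> k (1 *\<^sub>R z)) (at_left 1)"
        by (intro isCont_tendsto_compose[of "1 *\<^sub>R z" k]) auto
    qed (use factor_pos[OF cball_in_domain, of z] z(1) in auto)
    moreover have "eventually (\<lambda>t. k (t *\<^sub>R z) powr E \<le> s) (at_left (1::real))"
      using eventually_at_left_real[of 0 "1::real"] by (auto elim!: eventually_mono intro!: le1 simp: z(1))
    ultimately have "k (1 *\<^sub>R z) powr E \<le> s" by (rule tendsto_upperbound) simp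
    then show ?thesis using z E0 real by (simp add: ennreal_leI)
  next
    case False
    let ?q = "enn2real p"
    have q: "?q \<ge> 1" using p False by (rule enn2real_ge_1)
    let ?b = "?q * (real CARD('n) - 2) / 2 - (real CARD('n) - 1)"
    have Mb: "factor_max powr \<bar>?b\<bar> = (factor_max powr E) powr ?q"
      using factor_max_powr_exponents[OF q] False by (simp add: E_def)
    have "factor_max powr \<bar>?b\<bar> \<le> s powr ?q + e" if e: "e > 0" for e
    proof -
      obtain f S where f: "harmonic_on f S" "cball 0 1 \<subseteq> S"
        and J: "(\<ointegral>z. norm (f z) powr ?q) \<ge> 1"
        and Wf: "(\<ointegral>z. norm (W f z) powr ?q) \<ge> (factor_max powr \<bar>?b\<bar> - e) * (\<ointegral>z. norm (f z) powr ?q)"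
        using integral_W_nearly_attained[OF q e] by blast
      define J where "J = (\<ointegral>z. norm (f z) powr ?q)"
      have J1: "J \<ge> 1" using J by (simp add: J_def)
      define c where "c = J powr (1 / ?q)"
      have c: "c > 0" "c powr ?q = J" using J1 q by (simp_all add: c_def powr_powr)
      define g where "g x = complex_of_real (1 / c) * f x" for x
      have hg: "harmonic_on g S" unfolding g_def by (rule harmonic_on_cmult[OF f(1)])
      have ng: "norm (g x) powr ?q = norm (f x) powr ?q / J" for x
        using c by (simp add: g_def norm_mult powr_divide norm_divide)
      have nWg: "norm (W g x) powr ?q = norm (W f x) powr ?q / J" for x
        using c by (simp add: g_def norm_mult powr_divide norm_divide powr_mult)
      have "hp_norm p g \<le> ennreal 1"
        unfolding hp_norm_le_iff[OF p False zero_le_one]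
      proof
        fix r :: real assume r: "r \<in> {0..<1}"
        have "(\<ointegral>z. norm (g (r *\<^sub>R z)) powr ?q) \<le> (\<ointegral>z. norm (g z) powr ?q)"
          by (rule harmonic_integral_mean_mono[OF hg f(2) _ _ q]) (use r in auto)
        also have "\<dots> = 1" unfolding ng using J1 by (simp add: J_def[symmetric])
        finally show "(\<ointegral>z. norm (g (r *\<^sub>R z)) powr ?q) \<le> 1 powr ?q" by simp
      qed
      moreover have "harmonic_on g (ball 0 1)"
        by (rule harmonic_on_subset[OF hg]) (use f(2) in auto)
      ultimately have "hp_norm p (W g) \<le> ennreal s" by (intro le) auto
      moreover have "continuous_on (cball 0 1) (W g)"
        using harmonic_on_continuous_on[OF harmonic_W(1)[OF hg f(2)]] harmonic_W(2)[OF hg f(2)] by (rule continuous_on_subset)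
      ultimately have "(\<ointegral>z. norm (W g z) powr ?q) \<le> s powr ?q"
        using real by (intro integral_sphere_le_hp_norm[OF p False]) auto
      then have "(\<ointegral>z. norm (W f z) powr ?q) / J \<le> s powr ?q" unfolding nWg by simp
      moreover have "factor_max powr \<bar>?b\<bar> - e \<le> (\<ointegral>z. norm (W f z) powr ?q) / J"
        using Wf J1 by (simp add: J_def[symmetric] pos_le_divide_eq)
      ultimately show ?thesis by linarith
    qed
    then have "(factor_max powr E) powr ?q \<le> s powr ?q" unfolding Mb by (rule field_le_epsilon)
    then have "factor_max powr E \<le> s" using q real by (metis powr_less_mono2 linorder_not_le less_le_trans zero_less_one)
    then show ?thesis using real by (simp add: ennreal_leI)
  qed
qed simp

theorem hp_opnorm_W:
  assumes p: "1 \<le> p" and T: "\<And>f x. norm x < 1 \<Longrightarrow> T f x = W f x"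
  defines "E \<equiv> \<bar>(if p = \<infinity> then 0 else (real CARD('n) - 1) / enn2real p) - (real CARD('n) - 2) / 2\<bar>"
  shows "T ` hp_space p \<subseteq> hp_space p" "hp_opnorm p T = ennreal (factor_max powr E)"
proof -
  have T': "hp_norm p (T f) = hp_norm p (W f)" for f by (rule hp_norm_cong) (simp add: T)
  show "T ` hp_space p \<subseteq> hp_space p"
  proof (rule image_subsetI)
    fix f :: "real^'n \<Rightarrow> complex" assume "f \<in> hp_space p"
    then have f: "harmonic_on f (ball 0 1)" "hp_norm p f < \<infinity>" by (auto simp: hp_space_def)
    then obtain c where c: "hp_norm p f = ennreal c" "c \<ge> 0" by (cases "hp_norm p f") auto
    have "hp_norm p (W f) \<le> ennreal (factor_max powr E * c)"
      unfolding E_def by (rule hp_norm_W_le[OF f(1) p c(2)]) (simp add: c)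
    then have "hp_norm p (T f) < \<infinity>" unfolding T' by (rule le_less_trans) simp
    moreover have "harmonic_on (T f) (ball 0 1)"
      by (rule harmonic_on_cong[OF W_harmonic_ball[OF f(1)]]) (simp add: T)
    ultimately show "T f \<in> hp_space p" by (simp add: hp_space_def)
  qed
  have "hp_norm p (T f) \<le> ennreal (factor_max powr E)" if "f \<in> hp_space p" "hp_norm p f \<le> 1" for f
    unfolding T' using hp_norm_W_le[of f p 1] that p by (simp add: hp_space_def E_def)
  then have "hp_opnorm p T \<le> ennreal (factor_max powr E)" unfolding hp_opnorm_def by (auto intro!: SUP_least)
  moreover have "ennreal (factor_max powr E) \<le> hp_opnorm p T" unfolding E_def using p T by (rule le_hp_opnorm_W)
  ultimately show "hp_opnorm p T = ennreal (factor_max powr E)" by (rule antisym)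
qed

end

section \<open>Moebius transformations of the ball\<close>

definition reflection_along :: "real^'n \<Rightarrow> real^'n \<Rightarrow> real^'n" where
  "reflection_along d v = v - (2 * (d \<bullet> v) / (d \<bullet> d)) *\<^sub>R d"

lemma orthogonal_transformation_reflection_along: "orthogonal_transformation (reflection_along d)"
proof (cases "d = 0")
  case True
  then have "reflection_along d = (\<lambda>v. v)" by (simp add: reflection_along_def fun_eq_iff)
  then show ?thesis by simp
next
  case False
  then have d: "d \<bullet> d \<noteq> 0" by simp
  have "linear (reflection_along d)"
    by (rule linearI) (simp_all add: reflection_along_def inner_add_right algebra_simps add_divide_distrib)
  moreover have "reflection_along d v \<bullet> reflection_along d w = v \<bullet> w" for v w
    using d unfolding reflection_along_def
    by (simp add: inner_diff_left inner_diff_right inner_commute[of v d] inner_commute[of w d])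
  ultimately show ?thesis by (simp add: orthogonal_transformation_def)
qed

lemma inversion_scaleR: "inversion (c *\<^sub>R x) = (1 / c) *\<^sub>R inversion x"
  by (cases "c = 0") (simp_all add: inversion_def)

lemma inversion_inversion: "inversion (inversion x) = x"
  by (cases "x = 0") (simp_all add: inversion_def)

lemma inversion_orthogonal: "orthogonal_transformation U \<Longrightarrow> inversion (U x) = U (inversion x)"
  by (simp add: inversion_def orthogonal_transformation_def linear_cmul)

lemma inversion_0 [simp]: "inversion 0 = 0"
  by (simp add: inversion_def)

lemma inversion_eq_0: "inversion x = 0 \<longleftrightarrow> x = 0"
  by (simp add: inversion_def)

text \<open>
  The identity that closes the normal forms below under composition: inverting, translating and
  inverting again amounts to a single inversion about another center, followed by a reflection, a
  scaling and a translation. The point \<open>z = 0\<close> is excluded because \<open>inversion 0\<close> is the default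
  value 0 and not the point at infinity.
\<close>
lemma inversion_add_inversion:
  fixes d z :: "real^'n"
  assumes d: "d \<noteq> 0" and z0: "z \<noteq> 0" and z: "z + inversion d \<noteq> 0"
  shows "inversion (d + inversion z) = inversion d + (1 / (d \<bullet> d)) *\<^sub>R reflection_along d (inversion (z + inversion d))"
proof -
  define D where "D = d \<bullet> d"
  define Z where "Z = z \<bullet> z"
  define q where "q = d \<bullet> z"
  have DZ: "D > 0" "Z > 0" using d z0 by (auto simp: D_def Z_def)
  define w where "w = z + inversion d"
  define Q where "Q = w \<bullet> w"
  have Q: "Q = Z + 2 * q / D + 1 / D"
    using DZ unfolding Q_def w_def inversion_def
    by (simp add: inner_add_left inner_add_right inner_commute[of z d] D_def[symmetric] Z_def[symmetric] q_def[symmetric] power2_eq_square add_divide_distrib)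
  have Qp: "Q > 0" using z by (simp add: Q_def w_def)
  have n: "(d + inversion z) \<bullet> (d + inversion z) = D * Q / Z"
    unfolding Q inversion_def using DZ
    by (simp add: inner_add_left inner_add_right inner_commute[of z d] D_def[symmetric] Z_def[symmetric] q_def[symmetric] field_simps power2_eq_square)
  have dw: "d \<bullet> w = q + 1" using DZ by (simp add: w_def inversion_def inner_add_right q_def D_def[symmetric])
  have "inversion (d + inversion z) = (Z / (D * Q)) *\<^sub>R d + (1 / (D * Q)) *\<^sub>R z"
    using DZ unfolding inversion_def[of "d + inversion z"] n
    by (simp add: inversion_def[of z] Z_def[symmetric] scaleR_add_right)
  moreover have "inversion d + (1 / D) *\<^sub>R reflection_along d (inversion w) =
      (1 / D - 2 * (q + 1) / (D * Q * D) + 1 / (D * Q * D)) *\<^sub>R d + (1 / (D * Q)) *\<^sub>R z"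
  proof -
    have "reflection_along d (inversion w) = (1 / Q) *\<^sub>R w - (2 * ((1 / Q) * (q + 1)) / D) *\<^sub>R d"
      by (simp add: reflection_along_def inversion_def[of w] dw D_def Q_def)
    also have "(1 / Q) *\<^sub>R w = (1 / Q) *\<^sub>R z + (1 / Q * (1 / D)) *\<^sub>R d"
      by (simp add: w_def inversion_def D_def scaleR_add_right)
    finally show ?thesis
      by (simp add: inversion_def D_def[symmetric] scaleR_add_right scaleR_diff_right scaleR_add_left scaleR_diff_left mult_ac)
  qed
  moreover have "1 / D - 2 * (q + 1) / (D * Q * D) + 1 / (D * Q * D) = Z / (D * Q)"
  proof -
    have "Z = Q - 2 * q / D - 1 / D" using Q by simp
    then show ?thesis using DZ(1) Qp by (simp only:) (simp add: field_simps)
  qed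
  ultimately show ?thesis by (simp add: D_def w_def)
qed

definition similarity_map :: "real^'n \<Rightarrow> real \<Rightarrow> (real^'n \<Rightarrow> real^'n) \<Rightarrow> (real^'n) option \<Rightarrow> (real^'n) option" where
  "similarity_map b c U z = (case z of None \<Rightarrow> None | Some x \<Rightarrow> Some (b + c *\<^sub>R U x))"

definition inversive_map :: "real^'n \<Rightarrow> real^'n \<Rightarrow> real \<Rightarrow> (real^'n \<Rightarrow> real^'n) \<Rightarrow> (real^'n) option \<Rightarrow> (real^'n) option" where
  "inversive_map p b c U z =
     (case z of None \<Rightarrow> Some b | Some x \<Rightarrow> if x = p then None else Some (b + c *\<^sub>R U (inversion (x - p))))"

text \<open>
  Moebius transformations that fix infinity are similarities; the others are a similarity after the
  inversion about the point \<open>p\<close> that is sent to infinity.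
\<close>
inductive moebius_normal_form :: "((real^'n) option \<Rightarrow> (real^'n) option) \<Rightarrow> bool" where
  similarity: "c > 0 \<Longrightarrow> orthogonal_transformation U \<Longrightarrow> moebius_normal_form (similarity_map b c U)"
| inversive: "c > 0 \<Longrightarrow> orthogonal_transformation U \<Longrightarrow> moebius_normal_form (inversive_map p b c U)"

lemma sphere_reflection_eq: "sphere_reflection a r = inversive_map a a (r\<^sup>2) (\<lambda>x. x)"
  by (auto simp: fun_eq_iff sphere_reflection_def inversive_map_def inversion_def power2_norm_eq_inner split: option.split)

lemma hyperplane_reflection_eq:
  "norm a = 1 \<Longrightarrow> hyperplane_reflection a t = similarity_map ((2 * t) *\<^sub>R a) 1 (reflection_along a)"
  by (auto simp: fun_eq_iff hyperplane_reflection_def similarity_map_def reflection_along_def norm_eq_1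
      inner_commute algebra_simps split: option.split)

lemma hyperplane_reflection_normal_form:
  assumes "norm a = 1" "moebius_normal_form \<Psi>"
  shows "moebius_normal_form (hyperplane_reflection a t \<circ> \<Psi>)"
  using assms(2)
proof cases
  let ?R = "reflection_along a"
  have R: "orthogonal_transformation ?R" "linear ?R"
    using orthogonal_transformation_reflection_along orthogonal_transformation_linear by blast+
  case (similarity c U b)
  have "hyperplane_reflection a t \<circ> \<Psi> = similarity_map ((2 * t) *\<^sub>R a + ?R b) c (?R \<circ> U)"
    unfolding hyperplane_reflection_eq[OF assms(1)] similarity(1)
    by (auto simp: fun_eq_iff similarity_map_def linear_add[OF R(2)] linear_cmul[OF R(2)] split: option.split)
  then show ?thesis using similarity R by (auto intro!: moebius_normal_form.similarity orthogonal_transformation_compose)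
next
  let ?R = "reflection_along a"
  have R: "orthogonal_transformation ?R" "linear ?R"
    using orthogonal_transformation_reflection_along orthogonal_transformation_linear by blast+
  case (inversive c U p b)
  have "hyperplane_reflection a t \<circ> \<Psi> = inversive_map p ((2 * t) *\<^sub>R a + ?R b) c (?R \<circ> U)"
    unfolding hyperplane_reflection_eq[OF assms(1)] inversive(1)
    by (auto simp: fun_eq_iff similarity_map_def inversive_map_def linear_add[OF R(2)] linear_cmul[OF R(2)] split: option.split)
  then show ?thesis using inversive R by (auto intro!: moebius_normal_form.inversive orthogonal_transformation_compose)
qed

lemma orthogonal_transformation_preimage:
  fixes U :: "real^'n \<Rightarrow> real^'n"
  assumes "orthogonal_transformation U" obtains x where "U x = y"
  using orthogonal_transformation_surj[OF assms] by (metis surjD)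

text \<open>
  The essential case is an inversive map with value \<open>b \<noteq> a\<close> at infinity. There the new pole is
  \<open>p' = p - w\<close> with \<open>U w = c (inversion (b - a))\<close>, the point that the map sends to \<open>a\<close>.
\<close>
lemma sphere_reflection_normal_form:
  assumes r: "r > 0" and \<Psi>: "moebius_normal_form \<Psi>"
  shows "moebius_normal_form (sphere_reflection a r \<circ> \<Psi>)"
  using \<Psi>
proof cases
  case (similarity c U b)
  have U: "linear U" "inj U" using similarity(3) by (auto simp: orthogonal_transformation_linear orthogonal_transformation_inj)
  obtain x0 where x0: "U x0 = (1 / c) *\<^sub>R (a - b)" using similarity(3) by (rule orthogonal_transformation_preimage)
  have e: "b + c *\<^sub>R U x - a = c *\<^sub>R U (x - x0)" for x
    using similarity(2) by (simp add: linear_diff[OF U(1)] x0 scaleR_diff_right)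
  have z: "b + c *\<^sub>R U x = a \<longleftrightarrow> x = x0" for x
  proof -
    have "b + c *\<^sub>R U x = a \<longleftrightarrow> c *\<^sub>R U (x - x0) = 0" using e[of x] by (metis eq_iff_diff_eq_0)
    also have "\<dots> \<longleftrightarrow> x = x0" using similarity(2) linear_injective_0[OF U(1)] U(2) linear_0[OF U(1)] by auto
    finally show ?thesis .
  qed
  have "sphere_reflection a r \<circ> \<Psi> = inversive_map x0 a (r\<^sup>2 / c) U"
    unfolding sphere_reflection_eq similarity(1)
    by (auto simp: fun_eq_iff similarity_map_def inversive_map_def z e inversion_scaleR inversion_orthogonal[OF similarity(3)] split: option.split)
  then show ?thesis using similarity r by (auto intro!: moebius_normal_form.inversive)
next
  case (inversive c U p b)
  have U: "linear U" "inj U" using inversive(3) by (auto simp: orthogonal_transformation_linear orthogonal_transformation_inj)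
  show ?thesis
  proof (cases "b = a")
    case True
    have z: "U (inversion (x - p)) = 0 \<longleftrightarrow> x = p" for x
      using inversive(2) linear_injective_0[OF U(1)] U(2) linear_0[OF U(1)] by (auto simp: inversion_eq_0)
    have "sphere_reflection a r \<circ> \<Psi> = similarity_map (a - (r\<^sup>2 / c) *\<^sub>R U p) (r\<^sup>2 / c) U"
      unfolding sphere_reflection_eq inversive(1) True
      by (auto simp: fun_eq_iff similarity_map_def inversive_map_def z less_imp_neq[OF inversive(2), symmetric] inversion_scaleR inversion_orthogonal[OF inversive(3)]
          inversion_inversion linear_diff[OF U(1)] algebra_simps split: option.split)
    then show ?thesis using inversive r by (auto intro!: moebius_normal_form.similarity)
  next
    case False
    define d where "d = b - a"
    have d: "d \<noteq> 0" using False by (simp add: d_def)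
    let ?R = "reflection_along d"
    have R: "orthogonal_transformation ?R" "linear ?R"
      using orthogonal_transformation_reflection_along orthogonal_transformation_linear by blast+
    obtain w where w: "U w = c *\<^sub>R inversion d" using inversive(3) by (rule orthogonal_transformation_preimage)
    define p' where "p' = p - w"
    have c: "c > 0" by fact
    have z1: "c *\<^sub>R U (inversion (x - p)) = inversion ((1 / c) *\<^sub>R U (x - p))" for x
      using c by (simp add: inversion_scaleR inversion_orthogonal[OF inversive(3)])
    have z2: "(1 / c) *\<^sub>R U (x - p) + inversion d = (1 / c) *\<^sub>R U (x - p')" for x
    proof -
      have "x - p' = (x - p) + w" by (simp add: p'_def)
      then show ?thesis using c by (simp only: linear_add[OF U(1)] w scaleR_add_right) simp
    qed
    have U0: "U v = 0 \<longleftrightarrow> v = 0" for v using linear_injective_0[OF U(1)] U(2) linear_0[OF U(1)] by auto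
    have main: "a + (r\<^sup>2) *\<^sub>R inversion (d + c *\<^sub>R U (inversion (x - p))) =
       (a + r\<^sup>2 *\<^sub>R inversion d) + (r\<^sup>2 * c / (d \<bullet> d)) *\<^sub>R (?R \<circ> U) (inversion (x - p'))" if "x \<noteq> p'" "x \<noteq> p" for x
    proof -
      have nz: "(1 / c) *\<^sub>R U (x - p) \<noteq> 0" using that c U0 by simp
      have "(1 / c) *\<^sub>R U (x - p) + inversion d \<noteq> 0" unfolding z2 using that c U0 by simp
      from inversion_add_inversion[OF d nz this]
      have "inversion (d + c *\<^sub>R U (inversion (x - p))) = inversion d + (1 / (d \<bullet> d)) *\<^sub>R ?R (inversion ((1 / c) *\<^sub>R U (x - p')))"
        unfolding z1 z2 .
      also have "inversion ((1 / c) *\<^sub>R U (x - p')) = c *\<^sub>R U (inversion (x - p'))"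
        by (simp add: inversion_scaleR inversion_orthogonal[OF inversive(3)])
      finally show ?thesis by (simp add: linear_cmul[OF R(2)] scaleR_add_right)
    qed
    have pole: "b + c *\<^sub>R U (inversion (x - p)) = a \<longleftrightarrow> x = p'" if "x \<noteq> p" for x
    proof -
      have "b + c *\<^sub>R U (inversion (x - p)) = a \<longleftrightarrow> inversion ((1 / c) *\<^sub>R U (x - p)) = - d"
        unfolding z1[symmetric] d_def by (auto simp: algebra_simps)
      also have "\<dots> \<longleftrightarrow> (1 / c) *\<^sub>R U (x - p) = inversion (- d)" by (metis inversion_inversion)
      also have "inversion (- d) = - inversion d" using inversion_scaleR[of "-1" d] by simp
      also have "(1 / c) *\<^sub>R U (x - p) = - inversion d \<longleftrightarrow> (1 / c) *\<^sub>R U (x - p') = 0"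
        unfolding z2[symmetric] by (simp add: eq_neg_iff_add_eq_0)
      also have "\<dots> \<longleftrightarrow> x = p'" using c U0 by simp
      finally show ?thesis .
    qed
    have pp': "p \<noteq> p'" using w d c U0[of 0] by (auto simp: p'_def inversion_eq_0 linear_0[OF U(1)])
    have "(sphere_reflection a r \<circ> \<Psi>) z = inversive_map p' (a + r\<^sup>2 *\<^sub>R inversion d) (r\<^sup>2 * c / (d \<bullet> d)) (?R \<circ> U) z" for z
    proof (cases z)
      case None
      then show ?thesis using False unfolding sphere_reflection_eq inversive(1) by (simp add: inversive_map_def d_def)
    next
      case (Some x)
      show ?thesis
      proof (cases "x = p")
        case True
        have "a = a + r\<^sup>2 *\<^sub>R inversion d + (r\<^sup>2 * c / (d \<bullet> d)) *\<^sub>R (?R \<circ> U) (inversion (p - p'))"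
        proof -
          have "U (inversion (p - p')) = (1 / c) *\<^sub>R d"
            using w by (simp add: p'_def inversion_orthogonal[OF inversive(3), symmetric] inversion_scaleR inversion_inversion)
          moreover have "?R d = - d" using d by (simp add: reflection_along_def) (simp add: scaleR_2)
          ultimately show ?thesis
            using c by (simp add: linear_cmul[OF R(2)] inversion_def[of d])
        qed
        then show ?thesis using True Some pp' unfolding sphere_reflection_eq inversive(1) by (simp add: inversive_map_def)
      next
        case False
        have e: "b + v - a = d + v" for v by (simp add: d_def)
        show ?thesis using False Some pole[OF False] main[of x]
          unfolding sphere_reflection_eq inversive(1) by (simp add: inversive_map_def e)
      qed
    qed
    then have "sphere_reflection a r \<circ> \<Psi> = inversive_map p' (a + r\<^sup>2 *\<^sub>R inversion d) (r\<^sup>2 * c / (d \<bullet> d)) (?R \<circ> U)"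
      by (rule ext)
    then show ?thesis using inversive r d R by (auto intro!: moebius_normal_form.inversive orthogonal_transformation_compose)
  qed
qed

text \<open>
  Composition from the left with a generator preserves the normal form, so the induction is over
  \<open>\<Phi>\<close> with an arbitrary normal form composed on the right.
\<close>
theorem moebius_imp_normal_form:
  fixes \<Phi> :: "(real^'n) option \<Rightarrow> (real^'n) option"
  assumes "\<Phi> \<in> moebius" shows "moebius_normal_form \<Phi>"
proof -
  have "moebius_normal_form \<Psi> \<Longrightarrow> moebius_normal_form (\<Phi> \<circ> \<Psi>)" for \<Psi>
    using assms
  proof (induction arbitrary: \<Psi> rule: moebius.induct)
    case (comp \<Phi>1 \<Phi>2)
    then show ?case by (metis comp_assoc)
  qed (auto intro: sphere_reflection_normal_form hyperplane_reflection_normal_form)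
  moreover have "moebius_normal_form (id :: (real^'n) option \<Rightarrow> (real^'n) option)"
  proof -
    have "(id :: (real^'n) option \<Rightarrow> (real^'n) option) = similarity_map 0 1 (\<lambda>x::real^'n. x)"
      by (auto simp: fun_eq_iff similarity_map_def split: option.split)
    moreover have "moebius_normal_form (similarity_map 0 1 (\<lambda>x::real^'n. x))"
      by (intro moebius_normal_form.similarity) auto
    ultimately show ?thesis by (simp only:)
  qed
  ultimately have "moebius_normal_form (\<Phi> \<circ> id)" by blast
  then show ?thesis by simp
qed

text \<open>
  For \<open>\<bar>p\<bar> > 1\<close> this is the reflection in the sphere with center \<open>p\<close> that is orthogonal to the unit sphere.
\<close>
definition ball_reflection :: "real^'n \<Rightarrow> real^'n \<Rightarrow> real^'n" where
  "ball_reflection p x = p + (p \<bullet> p - 1) *\<^sub>R inversion (x - p)"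

lemma ball_reflection_defining:
  assumes "x \<noteq> p"
  shows "1 - ball_reflection p x \<bullet> ball_reflection p x = (p \<bullet> p - 1) / ((x - p) \<bullet> (x - p)) * (1 - x \<bullet> x)"
proof -
  define y where "y = x - p"
  define s where "s = y \<bullet> y"
  have s: "s > 0" using assms by (simp add: s_def y_def)
  have x: "x = y + p" by (simp add: y_def)
  have xx: "x \<bullet> x = s + 2 * (y \<bullet> p) + p \<bullet> p"
    unfolding x s_def by (simp add: inner_add_left inner_add_right inner_commute)
  have "ball_reflection p x \<bullet> ball_reflection p x = p \<bullet> p + 2 * ((p \<bullet> p - 1) / s) * (y \<bullet> p) + (p \<bullet> p - 1)\<^sup>2 / s"
    using s unfolding ball_reflection_def y_def[symmetric] inversion_def s_def[symmetric]
    by (simp add: inner_add_left inner_add_right inner_commute[of p y] s_def[symmetric] power2_eq_square)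
      (simp add: field_simps)
  note B = this
  show ?thesis
    unfolding y_def[symmetric] s_def[symmetric] xx B using s by (simp add: field_simps power2_eq_square)
qed

lemma ball_reflection_involution:
  assumes "x \<noteq> p" "p \<bullet> p > 1" shows "ball_reflection p (ball_reflection p x) = x"
  using assms by (simp add: ball_reflection_def inversion_scaleR inversion_inversion)

lemma ball_reflection_ball:
  assumes p: "p \<bullet> p > 1"
  shows "ball_reflection p ` ball 0 1 = ball 0 1"
proof -
  have np: "norm p > 1" using p by (metis dot_square_norm norm_ge_zero one_power2 power_less_imp_less_base)
  have sub: "ball_reflection p x \<in> ball 0 1" if "x \<in> ball 0 1" for x
  proof -
    have xp: "x \<noteq> p" using that np by auto
    have "1 - x \<bullet> x > 0" using that by (simp add: dot_square_norm power_less_one_iff abs_square_less_1)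
    then have "1 - ball_reflection p x \<bullet> ball_reflection p x > 0"
      unfolding ball_reflection_defining[OF xp] using xp p by (intro mult_pos_pos divide_pos_pos) auto
    then show ?thesis by (simp add: dot_square_norm power_less_one_iff abs_square_less_1)
  qed
  have "x \<in> ball_reflection p ` ball 0 1" if "x \<in> ball 0 1" for x
    using sub[OF that] ball_reflection_involution[of x p] p that np by (metis dist_0_norm image_eqI mem_ball not_less_iff_gr_or_eq)
  then show ?thesis using sub by auto
qed

lemma similarity_ball_imp_orthogonal:
  fixes U :: "real^'n \<Rightarrow> real^'n"
  assumes U: "orthogonal_transformation U" and c: "c > 0" and im: "(\<lambda>x. b + c *\<^sub>R U x) ` ball 0 1 = ball 0 1"
  shows "b = 0" "c = 1"
proof -
  have "(\<lambda>x. b + c *\<^sub>R U x) ` ball 0 1 = ball b c"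
  proof (intro equalityI subsetI)
    fix y assume "y \<in> (\<lambda>x. b + c *\<^sub>R U x) ` ball 0 1"
    then show "y \<in> ball b c" using c by (auto simp: dist_norm orthogonal_transformation_norm[OF U])
  next
    fix y assume y: "y \<in> ball b c"
    obtain x where x: "U x = (1 / c) *\<^sub>R (y - b)" using U by (rule orthogonal_transformation_preimage)
    have "norm x = norm (U x)" by (simp add: orthogonal_transformation_norm[OF U])
    also have "\<dots> < 1" using y c unfolding x by (simp add: dist_norm norm_minus_commute)
    finally have "x \<in> ball 0 1" by simp
    moreover have "y = b + c *\<^sub>R U x" using c unfolding x by simp
    ultimately show "y \<in> (\<lambda>x. b + c *\<^sub>R U x) ` ball 0 1" by blast
  qed
  then have "ball b c = ball 0 1" using im by simp
  then show "b = 0" "c = 1" using c unfolding ball_eq_ball_iff by auto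
qed

text \<open>
  An inversive map of the ball has its pole \<open>p\<close> outside of the closed ball: inside it, a point of
  the ball would go to infinity, and on the sphere the image of the ball would be unbounded. The map is
  then a similarity after the reflection of the ball with center \<open>p\<close>, and a similarity that maps the
  ball onto itself is orthogonal.
\<close>
theorem moebius_ball_cases:
  fixes \<Phi> :: "(real^'n) option \<Rightarrow> (real^'n) option"
  assumes "\<Phi> \<in> moebius_ball"
  obtains (orthogonal) U where "orthogonal_transformation U" "\<And>x. norm x < 1 \<Longrightarrow> point_map \<Phi> x = U x"
  | (reflected) U p where "orthogonal_transformation U" "p \<bullet> p > 1"
      "\<And>x. norm x < 1 \<Longrightarrow> point_map \<Phi> x = U (ball_reflection p x)"
proof -
  have nf: "moebius_normal_form \<Phi>" and im: "\<Phi> ` (Some ` ball 0 1) = Some ` ball 0 1"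
    using assms moebius_imp_normal_form by (auto simp: moebius_ball_def)
  have some: "\<exists>y. \<Phi> (Some x) = Some y \<and> norm y < 1" if "norm x < 1" for x
  proof -
    have "\<Phi> (Some x) \<in> \<Phi> ` (Some ` ball 0 1)" using that by auto
    then have "\<Phi> (Some x) \<in> Some ` ball 0 1" by (simp only: im)
    then show ?thesis by auto
  qed
  have pm: "point_map \<Phi> ` ball 0 1 = ball 0 1"
  proof -
    have "point_map \<Phi> ` ball 0 1 = the ` (\<Phi> ` (Some ` ball 0 1))" by (auto simp: point_map_def image_image)
    also have "\<dots> = ball 0 1" unfolding im by (auto simp: image_image)
    finally show ?thesis .
  qed
  from nf show ?thesis
  proof cases
    case (similarity c U b)
    have p: "point_map \<Phi> = (\<lambda>x. b + c *\<^sub>R U x)" by (simp add: similarity(1) point_map_def similarity_map_def fun_eq_iff)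
    have "b = 0" "c = 1" using similarity_ball_imp_orthogonal[OF similarity(3,2)] pm p by auto
    then show ?thesis using orthogonal[OF similarity(3)] p by simp
  next
    case (inversive c U p b)
    have pnb: "norm p \<ge> 1" using some[of p] inversive(1) by (auto simp: inversive_map_def not_le[symmetric])
    have pf: "point_map \<Phi> x = b + c *\<^sub>R U (inversion (x - p))" if "norm x < 1" for x
      using that pnb by (auto simp: inversive(1) point_map_def inversive_map_def)
    have "norm p \<noteq> 1"
    proof
      assume p1: "norm p = 1"
      \<comment> \<open>At distance \<open>\<delta>\<close> from the pole the inversive part has norm \<open>c / \<delta>\<close>, which is at least \<open>1 + \<bar>b\<bar>\<close>.\<close>
      define \<delta> where "\<delta> = min 1 (c / (1 + norm b))"
      have b1: "1 + norm b > 0" by (simp add: add_pos_nonneg)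
      have \<delta>: "0 < \<delta>" "\<delta> \<le> 1" "\<delta> \<le> c / (1 + norm b)" using inversive(2) b1 by (auto simp: \<delta>_def)
      define x where "x = (1 - \<delta>) *\<^sub>R p"
      have nx: "norm x < 1" using \<delta> p1 by (simp add: x_def)
      have "x - p = (- \<delta>) *\<^sub>R p" by (simp add: x_def scaleR_diff_left)
      then have "inversion (x - p) = - ((1 / \<delta>) *\<^sub>R p)"
        using p1 by (simp only: inversion_scaleR) (simp add: inversion_def norm_eq_1)
      then have "norm (c *\<^sub>R U (inversion (x - p))) = c / \<delta>"
        using p1 \<delta> inversive(2) by (simp add: orthogonal_transformation_norm[OF inversive(3)])
      also have "\<dots> \<ge> 1 + norm b"
        using \<delta> b1 by (simp add: pos_le_divide_eq mult.commute)
      finally have "norm (point_map \<Phi> x) \<ge> 1"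
        unfolding pf[OF nx] using norm_triangle_ineq4[of "b + c *\<^sub>R U (inversion (x - p))" b] by simp
      moreover have "norm (point_map \<Phi> x) < 1" using some[OF nx] by (auto simp: point_map_def)
      ultimately show False by simp
    qed
    then have np: "norm p > 1" using pnb by simp
    then have pp: "p \<bullet> p > 1" by (simp add: dot_square_norm)
    have lin: "linear U" using inversive(3) by (rule orthogonal_transformation_linear)
    let ?c = "c / (p \<bullet> p - 1)"
    have c': "?c > 0" using inversive(2) pp by simp
    have e: "point_map \<Phi> x = (b - ?c *\<^sub>R U p) + ?c *\<^sub>R U (ball_reflection p x)" if "norm x < 1" for x
      using pp unfolding pf[OF that] ball_reflection_def
      by (simp add: linear_add[OF lin] linear_cmul[OF lin] scaleR_add_right)
    have "(\<lambda>y. (b - ?c *\<^sub>R U p) + ?c *\<^sub>R U y) ` ball 0 1 = (\<lambda>y. (b - ?c *\<^sub>R U p) + ?c *\<^sub>R U y) ` (ball_reflection p ` ball 0 1)"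
      by (simp only: ball_reflection_ball[OF pp])
    also have "\<dots> = point_map \<Phi> ` ball 0 1" unfolding image_image by (intro image_cong) (auto simp: e)
    finally have im': "(\<lambda>y. (b - ?c *\<^sub>R U p) + ?c *\<^sub>R U y) ` ball 0 1 = ball 0 1" using pm by simp
    note bc = similarity_ball_imp_orthogonal[OF inversive(3) c' im']
    show ?thesis
    proof (rule reflected[OF inversive(3) pp])
      fix x :: "real^'n" assume "norm x < 1"
      from e[OF this] show "point_map \<Phi> x = U (ball_reflection p x)"
        by (simp only: bc(1)) (simp only: bc(2) scaleR_one add_0)
    qed
  qed
qed

section \<open>The norm of the weighted composition operator\<close>

lemma deriv_size_conformal:
  fixes \<phi> :: "real^'n \<Rightarrow> real^'n"
  assumes d: "(\<phi> has_derivative (\<lambda>v. c *\<^sub>R U v)) (at x)" and U: "orthogonal_transformation U" and c: "c > 0"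
  shows "deriv_size \<phi> x = c"
proof -
  have "jacobian \<phi> (at x) = matrix ((*\<^sub>R) c \<circ> U)"
    unfolding jacobian_def frechet_derivative_at[OF d, symmetric] by (simp add: o_def)
  also have "\<dots> = matrix ((*\<^sub>R) c) ** matrix U"
    by (rule matrix_compose) (auto simp: orthogonal_transformation_linear[OF U] linear_scale_self)
  finally have "\<bar>det (jacobian \<phi> (at x))\<bar> = c ^ CARD('n) * \<bar>det (matrix U)\<bar>"
    using c by (simp add: det_mul abs_mult)
  also have "\<bar>det (matrix U)\<bar> = 1" using U by simp
  finally show ?thesis using c by (simp add: deriv_size_def powr_powr flip: powr_realpow)
qed

lemma conformal_ball_map_orthogonal:
  fixes U :: "real^'n \<Rightarrow> real^'n"
  assumes U: "orthogonal_transformation U" and n: "CARD('n) \<ge> 2"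
  shows "conformal_ball_map U (inv U) (\<lambda>_. 1) 0 UNIV"
proof
  note inv = orthogonal_transformation_inv[OF U]
  have cont: "continuous_on A F" if "orthogonal_transformation F" for A and F :: "real^'n \<Rightarrow> real^'n"
    using orthogonal_transformation_linear[OF that] by (simp add: linear_continuous_on linear_linear)
  show "continuous_on UNIV U" "continuous_on (sphere 0 1) (inv U)" using U inv by (auto intro: cont)
  show "1 - U x \<bullet> U x = 1 * (1 - x \<bullet> x)" for x using U by (simp add: orthogonal_transformation_def)
  show "harmonic_on (\<lambda>x. 1 powr ((real CARD('n) - 2) / 2) *\<^sub>R f (U x)) (UNIV \<inter> U -` T)" if "harmonic_on f T" for f T
    using harmonic_on_affine[OF that U, of 0 1] by simp
  show "U 0 = 0" using orthogonal_transformation_linear[OF U] by (rule linear_0)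
  show "norm (inv U z) = 1" if "norm z = 1" for z using that by (simp add: orthogonal_transformation_norm[OF inv])
  show "inv U (U z) = z" for z using orthogonal_transformation_inj[OF U] by simp
qed (use n in auto)

lemma ball_reflection_inversion: "p \<bullet> p > 1 \<Longrightarrow> ball_reflection p (inversion p) = 0"
proof -
  assume p: "p \<bullet> p > 1"
  have "inversion p - p = (- ((p \<bullet> p - 1) / (p \<bullet> p))) *\<^sub>R p"
    using p by (simp add: inversion_def diff_divide_distrib scaleR_diff_left)
  then show ?thesis using p by (simp only: ball_reflection_def inversion_scaleR) (simp add: inversion_def)
qed

lemma ball_reflection_0: "p \<bullet> p > 1 \<Longrightarrow> ball_reflection p 0 = inversion p"
  using inversion_scaleR[of "-1" p]
  by (simp add: ball_reflection_def) (simp add: inversion_def diff_divide_distrib scaleR_diff_left)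

lemma has_derivative_ball_reflection:
  assumes "x \<noteq> p"
  shows "(ball_reflection p has_derivative
    (\<lambda>v. ((p \<bullet> p - 1) / ((x - p) \<bullet> (x - p))) *\<^sub>R reflection_along (x - p) v)) (at x)"
proof -
  have "((\<lambda>x. x - p) has_derivative (\<lambda>v. v)) (at x)" by (auto intro!: derivative_eq_intros)
  from has_derivative_compose[OF this has_derivative_inversion(1)[of "x - p"]] assms
  have "((\<lambda>x. inversion (x - p)) has_derivative (\<lambda>v. inversion_d (x - p) v)) (at x)" by simp
  then have "((\<lambda>x. p + (p \<bullet> p - 1) *\<^sub>R inversion (x - p)) has_derivative (\<lambda>v. 0 + (p \<bullet> p - 1) *\<^sub>R inversion_d (x - p) v)) (at x)"
    by (intro has_derivative_add has_derivative_const has_derivative_scaleR_right)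
  moreover have "(p \<bullet> p - 1) *\<^sub>R inversion_d (x - p) v = ((p \<bullet> p - 1) / ((x - p) \<bullet> (x - p))) *\<^sub>R reflection_along (x - p) v" for v
    by (simp add: inversion_d_def reflection_along_def scaleR_diff_right power2_eq_square)
  ultimately show ?thesis by (simp add: ball_reflection_def[abs_def])
qed

text \<open>
  The Kelvin transform about \<open>p\<close> gives the harmonic weight: the \<open>(n - 2) / 2\<close>-th power of the
  conformal factor \<open>(\<bar>p\<bar>\<^sup>2 - 1) / \<bar>x - p\<bar>\<^sup>2\<close> is a constant times \<open>\<bar>x - p\<bar> powr (2 - n)\<close>.
\<close>
lemma conformal_ball_map_reflected:
  fixes U :: "real^'n \<Rightarrow> real^'n"
  assumes U: "orthogonal_transformation U" and p: "p \<bullet> p > 1" and n: "CARD('n) \<ge> 2"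
  shows "conformal_ball_map (\<lambda>x. U (ball_reflection p x)) (\<lambda>y. ball_reflection p (inv U y))
     (\<lambda>x. (p \<bullet> p - 1) / ((x - p) \<bullet> (x - p))) (inversion p) (- {p})"
proof
  note inv = orthogonal_transformation_inv[OF U]
  note lin = orthogonal_transformation_linear[OF U]
  have np: "norm p > 1" using p by (metis dot_square_norm norm_ge_zero one_power2 power_less_imp_less_base)
  have cont: "continuous_on A F" if "orthogonal_transformation F" for A and F :: "real^'n \<Rightarrow> real^'n"
    using orthogonal_transformation_linear[OF that] by (simp add: linear_continuous_on linear_linear)
  have contR: "continuous_on (- {p}) (ball_reflection p)"
    by (rule continuous_at_imp_continuous_on) (use has_derivative_ball_reflection has_derivative_continuous in blast)
  have Rs: "norm (ball_reflection p z) = 1" if "norm z = 1" for z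
  proof -
    have "z \<noteq> p" using that np by auto
    from ball_reflection_defining[OF this] that show ?thesis by (simp add: norm_eq_1)
  qed
  have invs: "norm (inv U z) = 1" if "norm z = 1" for z using that by (simp add: orthogonal_transformation_norm[OF inv])
  show "continuous_on (- {p}) (\<lambda>x. U (ball_reflection p x))"
    by (rule continuous_on_compose2[OF cont[OF U, of UNIV] contR]) auto
  show "continuous_on (- {p}) (\<lambda>x. (p \<bullet> p - 1) / ((x - p) \<bullet> (x - p)))" by (intro continuous_intros) auto
  show "(p \<bullet> p - 1) / ((x - p) \<bullet> (x - p)) > 0" if "x \<in> - {p}" for x using that p by auto
  show "1 - U (ball_reflection p x) \<bullet> U (ball_reflection p x) = (p \<bullet> p - 1) / ((x - p) \<bullet> (x - p)) * (1 - x \<bullet> x)" if "x \<in> - {p}" for x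
    using ball_reflection_defining[of x p] that U by (simp add: orthogonal_transformation_def)
  have p0: "p \<noteq> 0" using np by auto
  show "norm (inversion p) < 1" using np p0 by (simp add: inversion_def dot_square_norm power2_eq_square)
  show "U (ball_reflection p (inversion p)) = 0" using ball_reflection_inversion[OF p] linear_0[OF lin] by simp
  show "(p \<bullet> p - 1) / ((z - p) \<bullet> (z - p)) = (1 - inversion p \<bullet> inversion p) / (norm (inversion p - z))\<^sup>2" if z: "norm z = 1" for z
  proof -
    have zz: "z \<bullet> z = 1" using z by (simp add: norm_eq_1)
    have 1: "1 - inversion p \<bullet> inversion p = (p \<bullet> p - 1) / (p \<bullet> p)" using p p0 by (simp add: inversion_def field_simps)
    have 2: "(norm (inversion p - z))\<^sup>2 = ((z - p) \<bullet> (z - p)) / (p \<bullet> p)"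
      using p p0 unfolding power2_norm_eq_inner inversion_def
      by (simp add: inner_diff_left inner_diff_right zz inner_commute[of z p] field_simps)
    show ?thesis unfolding 1 2 using p p0 by simp
  qed
  show "continuous_on (sphere 0 1) (\<lambda>y. ball_reflection p (inv U y))"
    by (rule continuous_on_compose2[OF contR cont[OF inv]]) (use invs np in auto)
  show "cball 0 1 \<subseteq> - {p}" using np by auto
  show "norm (ball_reflection p (inv U z)) = 1" if "norm z = 1" for z using Rs[OF invs[OF that]] .
  show "ball_reflection p (inv U (U (ball_reflection p z))) = z" if "norm z = 1" for z
  proof -
    have "z \<noteq> p" using that np by auto
    then show ?thesis using ball_reflection_involution[OF _ p] orthogonal_transformation_inj[OF U] by simp
  qed
  show "harmonic_on (\<lambda>x. ((p \<bullet> p - 1) / ((x - p) \<bullet> (x - p))) powr ((real CARD('n) - 2) / 2) *\<^sub>R f (U (ball_reflection p x)))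
      (- {p} \<inter> (\<lambda>x. U (ball_reflection p x)) -` T)" if f: "harmonic_on f T" for f T
  proof -
    let ?A = "p \<bullet> p - 1" and ?e = "(real CARD('n) - 2) / 2"
    have A: "?A > 0" using p by simp
    have e: "U (ball_reflection p x) = U p + ?A *\<^sub>R U (inversion (x - p))" for x
      by (simp add: ball_reflection_def linear_add[OF lin] linear_cmul[OF lin])
    note h = harmonic_on_cmult[OF harmonic_on_affine[OF harmonic_on_Kelvin[OF harmonic_on_affine[OF f U, of "U p" ?A]]
        orthogonal_transformation_id, of "- p" 1], of "complex_of_real (?A powr ?e)"]
    have set: "(\<lambda>x. - p + 1 *\<^sub>R x) -` {x. x \<noteq> 0 \<and> inversion x \<in> (\<lambda>x. U p + ?A *\<^sub>R U x) -` T} =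
        - {p} \<inter> (\<lambda>x. U (ball_reflection p x)) -` T"
      unfolding e by auto
    show ?thesis
    proof (rule harmonic_on_cong[OF h[unfolded set]])
      fix x assume "x \<in> - {p} \<inter> (\<lambda>x. U (ball_reflection p x)) -` T"
      then have s: "(x - p) \<bullet> (x - p) > 0" by simp
      have "(?A / ((x - p) \<bullet> (x - p))) powr ?e = ?A powr ?e * ((x - p) \<bullet> (x - p)) powr (- ?e)"
        using s A by (simp add: powr_divide powr_minus_divide)
      also have "- ?e = (2 - real CARD('n)) / 2" by (simp only: minus_divide_left minus_diff_eq)
      finally show "complex_of_real (?A powr ?e) *
          (((- p + 1 *\<^sub>R x) \<bullet> (- p + 1 *\<^sub>R x)) powr ((2 - real CARD('n)) / 2) *\<^sub>R f (U p + ?A *\<^sub>R U (inversion (- p + 1 *\<^sub>R x)))) =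
        (?A / ((x - p) \<bullet> (x - p))) powr ?e *\<^sub>R f (U (ball_reflection p x))"
        by (simp add: e scaleR_conv_of_real[where 'a = complex])
    qed
  qed
qed (use n in auto)

text \<open>
  Both normal forms of \<open>\<Phi>\<close> are conformal maps of the ball in the sense above. It remains to identify
  the conformal factor with \<open>deriv_size\<close> and \<open>\<bar>a\<bar>\<close> with \<open>\<bar>\<phi> 0\<bar>\<close>.
\<close>

theorem theorem1p2:
  fixes \<Phi> :: "(real ^ 'n) option \<Rightarrow> (real ^ 'n) option"
    and \<phi> :: "real ^ 'n \<Rightarrow> real ^ 'n"
    and \<psi> :: "real ^ 'n \<Rightarrow> real"
    and p :: ennreal
  assumes "CARD('n) \<ge> 2"
    and "1 \<le> p"
    and "\<Phi> \<in> moebius_ball"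
    and "\<phi> = point_map \<Phi>"
    and "\<psi> = (\<lambda>x. deriv_size \<phi> x powr ((real CARD('n) - 2) / 2))"
  shows "weighted_comp \<phi> \<psi> ` hp_space p \<subseteq> hp_space p \<and>
         hp_opnorm p (weighted_comp \<phi> \<psi>) =
           ennreal (((1 + norm (\<phi> 0)) / (1 - norm (\<phi> 0))) powr
             \<bar>(if p = \<infinity> then 0 else (real CARD('n) - 1) / enn2real p) - (real CARD('n) - 2) / 2\<bar>)"
proof -
  have main: ?thesis
    if cbm: "conformal_ball_map \<phi>' \<theta> k a V"
      and eq: "\<And>x. norm x < 1 \<Longrightarrow> \<phi> x = \<phi>' x"
      and ds: "\<And>x. norm x < 1 \<Longrightarrow> deriv_size \<phi> x = k x"
      and na: "norm (\<phi> 0) = norm a" for \<phi>' \<theta> k a V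
  proof -
    interpret conformal_ball_map \<phi>' \<theta> k a V by (rule cbm)
    have "weighted_comp \<phi> \<psi> f x = W f x" if "norm x < 1" for f x
      unfolding weighted_comp_def assms(5) using that by (simp add: eq ds scaleR_conv_of_real)
    from hp_opnorm_W[OF assms(2), of "weighted_comp \<phi> \<psi>", OF this]
    show ?thesis unfolding na factor_max_def by simp
  qed
  have deriv_eq: "(\<phi> has_derivative D) (at x)"
    if "(\<phi>' has_derivative D) (at x)" "norm x < 1" "\<And>x. norm x < 1 \<Longrightarrow> \<phi> x = \<phi>' x" for \<phi>' D x
    by (rule has_derivative_transform_within_open[OF that(1) open_ball[of 0 1]]) (use that in auto)
  from assms(3) show ?thesis
  proof (cases rule: moebius_ball_cases)
    case (orthogonal U)
    note lin = orthogonal_transformation_linear[OF orthogonal(1)]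
    have eq: "\<phi> x = U x" if "norm x < 1" for x using orthogonal(2) that by (simp add: assms(4))
    show ?thesis
    proof (rule main[OF conformal_ball_map_orthogonal[OF orthogonal(1) assms(1)] eq])
      fix x :: "real^'n" assume x: "norm x < 1"
      have "(U has_derivative (\<lambda>v. 1 *\<^sub>R U v)) (at x)"
        using lin by (simp add: bounded_linear_imp_has_derivative linear_linear)
      from deriv_size_conformal[OF deriv_eq[OF this x eq] orthogonal(1)] show "deriv_size \<phi> x = 1" by simp
    qed (simp_all add: eq linear_0[OF lin])
  next
    case (reflected U c)
    note lin = orthogonal_transformation_linear[OF reflected(1)]
    have eq: "\<phi> x = U (ball_reflection c x)" if "norm x < 1" for x using reflected(3) that by (simp add: assms(4))
    have nc: "norm c > 1" using reflected(2) by (metis dot_square_norm norm_ge_zero one_power2 power_less_imp_less_base)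
    show ?thesis
    proof (rule main[OF conformal_ball_map_reflected[OF reflected(1,2) assms(1)] eq])
      fix x :: "real^'n" assume x: "norm x < 1"
      then have xc: "x \<noteq> c" using nc by auto
      let ?k = "(c \<bullet> c - 1) / ((x - c) \<bullet> (x - c))"
      have k: "?k > 0" using xc reflected(2) by simp
      have "(U has_derivative U) (at y)" for y
        using lin by (simp add: bounded_linear_imp_has_derivative linear_linear)
      from has_derivative_compose[OF has_derivative_ball_reflection[OF xc] this]
      have "((\<lambda>x. U (ball_reflection c x)) has_derivative (\<lambda>v. ?k *\<^sub>R (U \<circ> reflection_along (x - c)) v)) (at x)"
        by (simp add: linear_cmul[OF lin])
      from deriv_size_conformal[OF deriv_eq[OF this x eq] orthogonal_transformation_compose[OF reflected(1) orthogonal_transformation_reflection_along] k]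
      show "deriv_size \<phi> x = ?k" .
    qed (simp_all add: eq ball_reflection_0[OF reflected(2)] orthogonal_transformation_norm[OF reflected(1)])
  qed
qed

end
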